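(* Suppose the FOGD iterates $(\boldsymbol x^\tau,\boldsymbol\lambda^\tau)$ described in the context converge to a strict local solution $(\boldsymbol x^*,\boldsymbol\lambda^* )$ as $\tau\to\infty$, and define $$\Psi^\tau:=\max_{k\in\mathcal V}\Psi^\tau_k:=\max_{k\in\mathcal V}\|(\boldsymbol x_k^\tau,\boldsymbol\lambda_k^\tau)-(\boldsymbol x_k^*,\boldsymbol\lambda_k^* )\|.$$ Suppose assumptions (A1)–(A7) of the context hold, fix $\mu\ge\hat\mu$, and suppose the parameters $\eta_1,\eta_2>0$ and $\delta_{\mu,b}$ satisfy $$\eta_1\ge\frac{9}{\eta_2\gamma_G},\qquad\eta_2\le\frac{\gamma_H}{7\hat\Upsilon^2},\qquad\delta_{\mu,b}\le\frac{0.5-\beta}{1.5-\beta}\cdot\frac{\eta_2\gamma_G}{8.5\,\eta_1\hat\Upsilon^2}.$$ Then, for all sufficiently large $\tau$, $$\Psi^{\tau+1}\le2\{\Upsilon_\mu\,\mathrm{poly}_{\mathcal G\circ\mathcal W}(b+4)\}^2\rho_\mu^b\cdot\Psi^\tau .$$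
   Context: Graph notation. $\mathcal G=(\mathcal V,\mathcal E)$ is a finite undirected graph with strictly ordered node set; $d_{\mathcal G}(i,j)$ is the number of edges of a shortest path between $i$ and $j$, and $d_{\mathcal G}(i,\mathcal W)$ is the distance from $i$ to the set $\mathcal W$. $N^b_{\mathcal G}[\mathcal W]=\{i\in\mathcal V:d_{\mathcal G}(i,\mathcal W)\le b\}$, $N_{\mathcal G}[\mathcal W]=N^1_{\mathcal G}[\mathcal W]$, $N_{\mathcal G}(\mathcal W)=N_{\mathcal G}[\mathcal W]\setminus\mathcal W$, $N^b_{\mathcal G}[i]=N^b_{\mathcal G}[\{i\}]$, $[M]=\{1,\dots,M\}$. Problem. The graph-structured nonlinear program is $\min\sum_{i\in\mathcal V}f_i(\{\boldsymbol x_j\}_{j\in N_{\mathcal G}[i]})$ subject to $\boldsymbol c_i(\{\boldsymbol x_j\}_{j\in N_{\mathcal G}[i]})=\boldsymbol 0$, $i\in\mathcal V$, with $\boldsymbol x_i\in\mathbb R^{r_i}$, $f_i$ real valued, $\boldsymbol c_i$ valued in $\mathbb R^{m_i}$, and dual variables $\boldsymbol\lambda_i\in\mathbb R^{m_i}$. Put $f=\sum_if_i$, $\boldsymbol c=\{\boldsymbol c_i\}_{i\in\mathcal V}$, $\mathcal L(\boldsymbol x,\boldsymbol\lambda)=f(\boldsymbol x)+\boldsymbol\lambda^T\boldsymbol c(\boldsymbol x)$, $G(\boldsymbol x)=\nabla\boldsymbol c(\boldsymbol x)$ (constraint Jacobian), $H(\boldsymbol x,\boldsymbol\lambda)=\nabla^2_{\boldsymbol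 x}\mathcal L(\boldsymbol x,\boldsymbol\lambda)$. At iterates $(\boldsymbol x^\tau,\boldsymbol\lambda^\tau)$, $\tau=0,1,\dots$, a superscript $\tau$ denotes evaluation there ($\boldsymbol c^\tau,\nabla\mathcal L^\tau,G^\tau,H^\tau$), and $\hat H^\tau$ is a symmetric structure-preserving modification of $H^\tau$. A strict local solution $(\boldsymbol x^*,\boldsymbol\lambda^* )$ consists of a strict local minimizer $\boldsymbol x^*$ and an associated multiplier, $\nabla\mathcal L(\boldsymbol x^*,\boldsymbol\lambda^* )=\boldsymbol0$. Vectors and matrices are indexed blockwise by nodes; $A_{i,j}$ is the $(i,j)$-block and $A[\mathcal I][\mathcal J]$ (or $v[\mathcal I]$) the subarray with row indices in $\mathcal I$ and column indices in $\mathcal J$. Thus $H_{i,j}=\hat H^\tau_{i,j}=\boldsymbol0$ if $d_{\mathcal G}(i,j)>2$ and $G_{i,j}=\boldsymbol0$ if $d_{\mathcal G}(i,j)>1$. $\|\cdot\|$ is the Euclidean/spectral norm. Overlapping decomposition. $\{\mathcal V_\ell\}_{\ell\in[M]}$ is a disjoint partition of $\mathcal V$, $b\ge1$ is an integer (overlap size), and $\mathcal W_\ell\subseteq\mathcal V$ satisfies $N^b_{\mathcal G}[\mathcal V_\ell]\subseteq\mathcal W_\ell$. Set $\tilde{\mathcal W}_\ell=N_{\mathcal G}(N_{\mathcal G}(\mathcal W_\ell))\cap\mathcal W_\ell$ and $\hat{\mathcal W}_\ell=N_{\mathcal G}(\mathcal W_\ell)\cup\tilde{\mathcal W}_\ell$.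 FOGD method. Input: initial point $(\boldsymbol x^0,\boldsymbol\lambda^0)$, scalars $\mu,\eta_1,\eta_2>0$, $\beta\in(0,0.5)$. For $\tau=0,1,2,\dots$: (i) for each $\ell\in[M]$ compute the primal-dual solution $(\tilde{\boldsymbol\omega}^*_\ell,\tilde{\boldsymbol\zeta}^*_\ell)$ (unique for $\mu\ge\hat\mu$) of $$\min_{\tilde{\boldsymbol\omega}_\ell}\ \tfrac12\tilde{\boldsymbol\omega}_\ell^T\hat H^\tau[\mathcal W_\ell][\mathcal W_\ell]\tilde{\boldsymbol\omega}_\ell+\tilde{\boldsymbol\omega}_\ell^T\nabla_{\boldsymbol x}\mathcal L^\tau[\mathcal W_\ell]+\tfrac\mu2\|\boldsymbol c^\tau[\hat{\mathcal W}_\ell]+G^\tau[\hat{\mathcal W}_\ell][\mathcal W_\ell]\tilde{\boldsymbol\omega}_\ell\|^2\ \ \text{s.t.}\ \ \boldsymbol c^\tau[\mathcal W_\ell\setminus\tilde{\mathcal W}_\ell]+G^\tau[\mathcal W_\ell\setminus\tilde{\mathcal W}_\ell][\mathcal W_\ell]\tilde{\boldsymbol\omega}_\ell=\boldsymbol0,$$ where $\tilde{\boldsymbol\omega}_\ell$ is indexed by $\mathcal W_\ell$ and the dual variable $\tilde{\boldsymbol\zeta}_\ell$ by $\mathcal W_\ell\setminus\tilde{\mathcal W}_\ell$; (ii) form $(\tilde\Delta\boldsymbol x^\tau,\tilde\Delta\boldsymbol\lambda^\tau)$: for $k\in\mathcal V$ and the unique $\ell$ with $k\in\mathcal V_\ell$,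 its components at node $k$ are those of $(\tilde{\boldsymbol\omega}^*_\ell,\tilde{\boldsymbol\zeta}^*_\ell)$ at node $k$; (iii) set $(\boldsymbol x^{\tau+1},\boldsymbol\lambda^{\tau+1})=(\boldsymbol x^\tau,\boldsymbol\lambda^\tau)+\alpha_\tau(\tilde\Delta\boldsymbol x^\tau,\tilde\Delta\boldsymbol\lambda^\tau)$, where $\alpha_\tau$ is found by backtracking line search (start from $\alpha_\tau=1$ and multiply by a fixed factor in $(0,1)$ until accepted) so as to satisfy the Armijo condition $$\mathcal L_\eta(\boldsymbol x^{\tau+1},\boldsymbol\lambda^{\tau+1})\le\mathcal L_\eta(\boldsymbol x^\tau,\boldsymbol\lambda^\tau)+\beta\alpha_\tau\nabla\mathcal L_\eta(\boldsymbol x^\tau,\boldsymbol\lambda^\tau)^T(\tilde\Delta\boldsymbol x^\tau,\tilde\Delta\boldsymbol\lambda^\tau)$$ with the exact augmented Lagrangian $\mathcal L_\eta(\boldsymbol x,\boldsymbol\lambda)=\mathcal L(\boldsymbol x,\boldsymbol\lambda)+\frac{\eta_1}2\|\nabla_{\boldsymbol\lambda}\mathcal L(\boldsymbol x,\boldsymbol\lambda)\|^2+\frac{\eta_2}2\|\nabla_{\boldsymbol x}\mathcal L(\boldsymbol x,\boldsymbol\lambda)\|^2$. Assumptions. (A1) For a constant $\gamma_H\in(0,1]$ and all $\tau\ge0$, $\boldsymbol\omega^T\hat H^\tau\boldsymbol\omega\ge\gamma_H\|\boldsymbol\omega\|^2$ whenever $G^\tau\boldsymbol\omega=\boldsymbol0$.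 (A2) For a constant $\gamma_G\in(0,1]$ and all $\tau\ge0$, $G^\tau(G^\tau)^T\succeq\gamma_GI$. (A3) For a constant $\Upsilon\ge1$, all $\tau\ge0$ and all $i,j\in\mathcal V$, $\max\{\|\hat H^\tau_{i,j}\|,\|H^\tau_{i,j}\|,\|G^\tau_{i,j}\|\}\le\Upsilon$. (A4) There are polynomials $\mathrm{poly}_{\mathcal W},\mathrm{poly}_{\mathcal G}$ such that $d_{\mathcal G}(i,j)\le\mathrm{poly}_{\mathcal W}(b)$ for all $i,j\in\mathcal W_\ell$, $\ell\in[M]$, and $|\{j\in\mathcal V:d_{\mathcal G}(i,j)\le d\}|\le\mathrm{poly}_{\mathcal G}(d)$ for all $i\in\mathcal V$ and any integer $d$. (A5) There is a compact set $\mathcal X\times\Lambda$ with $(\boldsymbol x^\tau+\alpha\tilde\Delta\boldsymbol x^\tau,\boldsymbol\lambda^\tau+\alpha\tilde\Delta\boldsymbol\lambda^\tau)\in\mathcal X\times\Lambda$ for all $\tau\ge0$, $\alpha\in[0,1]$; the functions $f_i,\boldsymbol c_i$ ($i\in\mathcal V$) are thrice continuously differentiable in $\mathcal X\times\Lambda$; and (with the same constant $\Upsilon\ge1$) $\sup_{\boldsymbol x\in\mathcal X,\boldsymbol\lambda\in\Lambda}\|H_{i,j}(\boldsymbol x,\boldsymbol\lambda)\|\le\Upsilon$ and $\sup_{\boldsymbol x\in\mathcal X}\|G_{i,j}(\boldsymbol x)\|\le\Upsilon$ for all $i,j\in\mathcal V$. (A6) $\hat H^\tau\to H^\tau$ as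 $\tau\to\infty$, i.e. $\|\hat H^\tau-H^\tau\|\to0$. (A7) There is a constant $\Upsilon_L\ge1$ such that for any two points $(\boldsymbol x,\boldsymbol\lambda),(\boldsymbol x',\boldsymbol\lambda')$ sufficiently close to $(\boldsymbol x^*,\boldsymbol\lambda^* )$ and any $i,j\in\mathcal V$, $\|H_{i,j}(\boldsymbol x,\boldsymbol\lambda)-H_{i,j}(\boldsymbol x',\boldsymbol\lambda')\|\le\Upsilon_L\max_{k\in N^2_{\mathcal G}[i]}\|(\boldsymbol x_k,\boldsymbol\lambda_k)-(\boldsymbol x'_k,\boldsymbol\lambda'_k)\|$ and $\|G_{i,j}(\boldsymbol x,\boldsymbol\lambda)-G_{i,j}(\boldsymbol x',\boldsymbol\lambda')\|\le\Upsilon_L\max_{k\in N_{\mathcal G}[i]}\|(\boldsymbol x_k,\boldsymbol\lambda_k)-(\boldsymbol x'_k,\boldsymbol\lambda'_k)\|$ (here $G(\boldsymbol x,\boldsymbol\lambda)=G(\boldsymbol x)$). Constants: $\mathrm{poly}_{\mathcal G\circ\mathcal W}(\cdot):=\mathrm{poly}_{\mathcal G}(\mathrm{poly}_{\mathcal W}(\cdot))$, $\hat\Upsilon:=\Upsilon\cdot\mathrm{poly}_{\mathcal G}(1)^2$ (which bounds $\|\hat H^\tau\|,\|H^\tau\|,\|G^\tau\|$ for all $\tau$), $\hat\mu:=4\hat\Upsilon^2/(\gamma_G\gamma_H)$, $\Upsilon_K=1.5\mu\hat\Upsilon^2$, $\gamma_K=\gamma_H^3\gamma_G^2/(75\Upsilon_K^6)$,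 $\rho_\mu=\big((\Upsilon_K^2-\gamma_K^2)/(\Upsilon_K^2+\gamma_K^2)\big)^{1/4}\in(0,1)$, $\Upsilon_\mu=\Upsilon_K/(\gamma_K^2\rho_\mu^2)$, $\Upsilon_{\mu,b}=\frac{\sqrt2\Upsilon_\mu\Upsilon_K}{\rho_\mu\sqrt{1-\rho_\mu^2}}\mathrm{poly}_{\mathcal G\circ\mathcal W}(b)\{\mathrm{poly}_{\mathcal G}(b+2)\}^{1/2}$, and $\delta_{\mu,b}:=\Upsilon_{\mu,b}\rho_\mu^b$.
   Formalization: The polynomials poly_W and poly_G in (A4) are additionally assumed nondecreasing on [0,∞); without this the claim fails, e.g. one node with poly_W = 1/2 and poly_G(t) = 4(t-1/2)^2 makes the right-hand side zero. *)

theory Defs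
  imports "HOL-Analysis.Analysis" "HOL-Computational_Algebra.Polynomial"
begin

text \<open>
  Encoding of the block structure. All nodal vectors are stacked into one primal vector in
  \<open>real^'p\<close> and one dual vector in \<open>real^'d\<close>. The maps \<open>np :: 'p \<Rightarrow> 'v\<close> and \<open>nd :: 'd \<Rightarrow> 'v\<close> tell to
  which node a coordinate belongs, so that \<open>r_i = card (np -` {i})\<close> and \<open>m_i = card (nd -` {i})\<close> are
  arbitrary and may vary with the node. A subvector \<open>v[I]\<close> or submatrix \<open>A[I][J]\<close> is represented
  by zero padding, which changes neither norms, inner products nor matrix products.
\<close>

text \<open>
  The graph on the node type \<open>'v\<close> is given by its (symmetric) set of edges. The pair \<open>(i, j)\<close> is in
  \<open>E ^^ n\<close> iff there is a walk with \<open>n\<close> edges from \<open>i\<close> to \<open>j\<close>; the distance is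
  \<open>\<infinity>\<close> if there is none.
\<close>

definition gdist :: "('v \<times> 'v) set \<Rightarrow> 'v \<Rightarrow> 'v \<Rightarrow> enat" where
  "gdist E i j = (INF n\<in>{n. (i, j) \<in> E ^^ n}. enat n)"

definition gdist_set :: "('v \<times> 'v) set \<Rightarrow> 'v \<Rightarrow> 'v set \<Rightarrow> enat" where
  "gdist_set E i W = (INF j\<in>W. gdist E i j)"

definition nbhd :: "('v \<times> 'v) set \<Rightarrow> nat \<Rightarrow> 'v set \<Rightarrow> 'v set" where
  "nbhd E b W = {i. gdist_set E i W \<le> enat b}"

definition nbhd_open :: "('v \<times> 'v) set \<Rightarrow> 'v set \<Rightarrow> 'v set" where
  "nbhd_open E W = nbhd E 1 W - W"

definition W_tilde :: "('v \<times> 'v) set \<Rightarrow> 'v set \<Rightarrow> 'v set" where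
  "W_tilde E W = nbhd_open E (nbhd_open E W) \<inter> W"

definition W_hat :: "('v \<times> 'v) set \<Rightarrow> 'v set \<Rightarrow> 'v set" where
  "W_hat E W = nbhd_open E W \<union> W_tilde E W"

definition vsub :: "('n \<Rightarrow> 'v) \<Rightarrow> 'v set \<Rightarrow> real^'n \<Rightarrow> real^'n" where
  "vsub nv I v = (\<chi> p. if nv p \<in> I then v $ p else 0)"

definition msub :: "('r \<Rightarrow> 'v) \<Rightarrow> ('n \<Rightarrow> 'v) \<Rightarrow> 'v set \<Rightarrow> 'v set \<Rightarrow> real^'n^'r \<Rightarrow> real^'n^'r" where
  "msub nr nc I J A = (\<chi> p q. if nr p \<in> I \<and> nc q \<in> J then A $ p $ q else 0)"

definition spec_norm :: "real^'n^'r \<Rightarrow> real" where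
  "spec_norm A = onorm (\<lambda>v. A *v v)"

definition node_norm ::
    "('p \<Rightarrow> 'v) \<Rightarrow> ('d \<Rightarrow> 'v) \<Rightarrow> 'v \<Rightarrow> (real^'p) \<times> (real^'d) \<Rightarrow> real" where
  "node_norm np nd k z = norm (vsub np {k} (fst z), vsub nd {k} (snd z))"

definition grad :: "('a::euclidean_space \<Rightarrow> real) \<Rightarrow> 'a \<Rightarrow> 'a" where
  "grad g x = (\<Sum>e\<in>Basis. frechet_derivative g (at x) e *\<^sub>R e)"

text \<open>\<open>k\<close>-fold continuous differentiability; meant for open sets \<open>S\<close>.\<close>

primrec Ck_on :: "nat \<Rightarrow> ('a::euclidean_space \<Rightarrow> real) \<Rightarrow> 'a set \<Rightarrow> bool" where
  "Ck_on 0 g S = continuous_on S g"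
| "Ck_on (Suc k) g S = ((\<forall>x\<in>S. g differentiable (at x)) \<and>
     (\<forall>e\<in>Basis. Ck_on k (\<lambda>x. frechet_derivative g (at x) e) S))"

text \<open>
  The nodal constraint function of node \<open>i\<close> consists of the components of \<open>c\<close> that belong to
  \<open>i\<close>. The functions of node \<open>i\<close> may depend on the variables in the closed neighbourhood of
  \<open>i\<close> only.
\<close>

definition graph_structured ::
    "('v \<times> 'v) set \<Rightarrow> ('p \<Rightarrow> 'v) \<Rightarrow> ('d \<Rightarrow> 'v) \<Rightarrow> ('v \<Rightarrow> real^'p \<Rightarrow> real) \<Rightarrow> (real^'p \<Rightarrow> real^'d) \<Rightarrow> bool"
where
  "graph_structured E np nd f c \<longleftrightarrow>
     (\<forall>i x y. vsub np (nbhd E 1 {i}) x = vsub np (nbhd E 1 {i}) y \<longrightarrow>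
        f i x = f i y \<and> vsub nd {i} (c x) = vsub nd {i} (c y))"

definition total_obj :: "('v::finite \<Rightarrow> real^'p \<Rightarrow> real) \<Rightarrow> real^'p \<Rightarrow> real" where
  "total_obj f x = (\<Sum>i\<in>UNIV. f i x)"

definition lagr ::
    "('v::finite \<Rightarrow> real^'p \<Rightarrow> real) \<Rightarrow> (real^'p \<Rightarrow> real^'d) \<Rightarrow> real^'p \<Rightarrow> real^'d \<Rightarrow> real" where
  "lagr f c x l = total_obj f x + l \<bullet> c x"

definition grad_x ::
    "('v::finite \<Rightarrow> real^'p \<Rightarrow> real) \<Rightarrow> (real^'p \<Rightarrow> real^'d) \<Rightarrow> real^'p \<Rightarrow> real^'d \<Rightarrow> real^'p" where
  "grad_x f c x l = grad (\<lambda>y. lagr f c y l) x"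

definition grad_l ::
    "('v::finite \<Rightarrow> real^'p \<Rightarrow> real) \<Rightarrow> (real^'p \<Rightarrow> real^'d) \<Rightarrow> real^'p \<Rightarrow> real^'d \<Rightarrow> real^'d" where
  "grad_l f c x l = grad (\<lambda>y. lagr f c x y) l"

definition Gjac :: "(real^'p \<Rightarrow> real^'d) \<Rightarrow> real^'p \<Rightarrow> real^'p^'d" where
  "Gjac c x = jacobian c (at x)"

definition Hess ::
    "('v::finite \<Rightarrow> real^'p \<Rightarrow> real) \<Rightarrow> (real^'p \<Rightarrow> real^'d) \<Rightarrow> real^'p \<Rightarrow> real^'d \<Rightarrow> real^'p^'p" where
  "Hess f c x l = jacobian (\<lambda>y. grad_x f c y l) (at x)"

definition strict_local_solution ::
    "('v::finite \<Rightarrow> real^'p \<Rightarrow> real) \<Rightarrow> (real^'p \<Rightarrow> real^'d) \<Rightarrow> real^'p \<Rightarrow> real^'d \<Rightarrow> bool" where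
  "strict_local_solution f c xs ls \<longleftrightarrow>
     c xs = 0 \<and>
     (\<exists>e>0. \<forall>x. c x = 0 \<and> x \<noteq> xs \<and> dist x xs < e \<longrightarrow> total_obj f xs < total_obj f x) \<and>
     grad (\<lambda>z. lagr f c (fst z) (snd z)) (xs, ls) = 0"

definition aug_lagr ::
    "('v::finite \<Rightarrow> real^'p \<Rightarrow> real) \<Rightarrow> (real^'p \<Rightarrow> real^'d) \<Rightarrow> real \<Rightarrow> real \<Rightarrow> (real^'p) \<times> (real^'d) \<Rightarrow> real"
where
  "aug_lagr f c eta1 eta2 z =
     lagr f c (fst z) (snd z)
     + eta1 / 2 * (norm (grad_l f c (fst z) (snd z)))\<^sup>2
     + eta2 / 2 * (norm (grad_x f c (fst z) (snd z)))\<^sup>2"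

text \<open>
  Subproblem on \<open>W\<close> with data \<open>Hh\<close> (modified Hessian), \<open>g\<close> (gradient of the Lagrangian in
  \<open>x\<close>), \<open>cv\<close> (constraint values) and \<open>G\<close> (constraint Jacobian).
\<close>

definition sub_obj ::
    "('v \<times> 'v) set \<Rightarrow> ('p \<Rightarrow> 'v) \<Rightarrow> ('d \<Rightarrow> 'v) \<Rightarrow> real \<Rightarrow> 'v set \<Rightarrow>
     real^'p^'p \<Rightarrow> real^'p \<Rightarrow> real^'d \<Rightarrow> real^'p^'d \<Rightarrow> real^'p \<Rightarrow> real"
where
  "sub_obj E np nd mu W Hh g cv G w =
     1 / 2 * (w \<bullet> (msub np np W W Hh *v w)) + w \<bullet> vsub np W g
     + mu / 2 * (norm (vsub nd (W_hat E W) cv + msub nd np (W_hat E W) W G *v w))\<^sup>2"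

definition sub_con ::
    "('v \<times> 'v) set \<Rightarrow> ('p \<Rightarrow> 'v) \<Rightarrow> ('d \<Rightarrow> 'v) \<Rightarrow> 'v set \<Rightarrow> real^'d \<Rightarrow> real^'p^'d \<Rightarrow> real^'p \<Rightarrow> real^'d"
where
  "sub_con E np nd W cv G w =
     vsub nd (W - W_tilde E W) cv + msub nd np (W - W_tilde E W) W G *v w"

text \<open>
  Primal-dual solution: \<open>w\<close> is a minimizer and \<open>z\<close> an associated Lagrange multiplier. The first two
  conjuncts say that \<open>w\<close> and \<open>z\<close> are indexed by \<open>W\<close> and \<open>W - W_tilde E W\<close>. The coordinates outside
  \<open>W\<close> do not enter the subproblem, so the full gradient in the last conjunct vanishes there anyway.
\<close>

definition sub_pd_solution ::
    "('v \<times> 'v) set \<Rightarrow> ('p \<Rightarrow> 'v) \<Rightarrow> ('d \<Rightarrow> 'v) \<Rightarrow> real \<Rightarrow> 'v set \<Rightarrow>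
     real^'p^'p \<Rightarrow> real^'p \<Rightarrow> real^'d \<Rightarrow> real^'p^'d \<Rightarrow> real^'p \<Rightarrow> real^'d \<Rightarrow> bool"
where
  "sub_pd_solution E np nd mu W Hh g cv G w z \<longleftrightarrow>
     vsub np W w = w \<and> vsub nd (W - W_tilde E W) z = z \<and>
     sub_con E np nd W cv G w = 0 \<and>
     (\<forall>u. vsub np W u = u \<and> sub_con E np nd W cv G u = 0 \<longrightarrow>
        sub_obj E np nd mu W Hh g cv G w \<le> sub_obj E np nd mu W Hh g cv G u) \<and>
     grad (\<lambda>u. sub_obj E np nd mu W Hh g cv G u + z \<bullet> sub_con E np nd W cv G u) w = 0"

text \<open>
  Of the primal-dual solution \<open>(w k, z k)\<close> on the overlapping set \<open>W k\<close>, only the components in the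
  partition set \<open>V k\<close> are kept.
\<close>

definition fogd_direction ::
    "('v::finite \<times> 'v) set \<Rightarrow> ('p \<Rightarrow> 'v) \<Rightarrow> ('d \<Rightarrow> 'v) \<Rightarrow>
     ('v \<Rightarrow> real^'p \<Rightarrow> real) \<Rightarrow> (real^'p \<Rightarrow> real^'d) \<Rightarrow> nat \<Rightarrow> (nat \<Rightarrow> 'v set) \<Rightarrow> (nat \<Rightarrow> 'v set) \<Rightarrow>
     real \<Rightarrow> real^'p^'p \<Rightarrow> real^'p \<Rightarrow> real^'d \<Rightarrow> real^'p \<Rightarrow> real^'d \<Rightarrow> bool"
where
  "fogd_direction E np nd f c M V W mu Hh x l dx dl \<longleftrightarrow>
     (\<exists>w z.
        (\<forall>k\<in>{1..M}. sub_pd_solution E np nd mu (W k) Hh (grad_x f c x l) (c x) (Gjac c x) (w k) (z k)) \<and>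
        (\<forall>k\<in>{1..M}. \<forall>p. np p \<in> V k \<longrightarrow> dx $ p = w k $ p) \<and>
        (\<forall>k\<in>{1..M}. \<forall>q. nd q \<in> V k \<longrightarrow> dl $ q = z k $ q))"

definition armijo ::
    "('v::finite \<Rightarrow> real^'p \<Rightarrow> real) \<Rightarrow> (real^'p \<Rightarrow> real^'d) \<Rightarrow> real \<Rightarrow> real \<Rightarrow> real \<Rightarrow>
     (real^'p) \<times> (real^'d) \<Rightarrow> (real^'p) \<times> (real^'d) \<Rightarrow> real \<Rightarrow> bool"
where
  "armijo f c eta1 eta2 beta z d a \<longleftrightarrow>
     aug_lagr f c eta1 eta2 (z + a *\<^sub>R d)
       \<le> aug_lagr f c eta1 eta2 z + beta * a * (grad (aug_lagr f c eta1 eta2) z \<bullet> d)"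

text \<open>Backtracking: the accepted step is the first of \<open>1, nu, nu\<^sup>2, \<dots>\<close> that passes the Armijo test.\<close>

definition backtracking_step ::
    "('v::finite \<Rightarrow> real^'p \<Rightarrow> real) \<Rightarrow> (real^'p \<Rightarrow> real^'d) \<Rightarrow> real \<Rightarrow> real \<Rightarrow> real \<Rightarrow> real \<Rightarrow>
     (real^'p) \<times> (real^'d) \<Rightarrow> (real^'p) \<times> (real^'d) \<Rightarrow> real \<Rightarrow> bool"
where
  "backtracking_step f c eta1 eta2 beta nu z d a \<longleftrightarrow>
     (\<exists>n. a = nu ^ n \<and> armijo f c eta1 eta2 beta z d (nu ^ n) \<and>
          (\<forall>m<n. \<not> armijo f c eta1 eta2 beta z d (nu ^ m)))"

definition fogd_iterates ::
    "('v::finite \<times> 'v) set \<Rightarrow> ('p \<Rightarrow> 'v) \<Rightarrow> ('d \<Rightarrow> 'v) \<Rightarrow>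
     ('v \<Rightarrow> real^'p \<Rightarrow> real) \<Rightarrow> (real^'p \<Rightarrow> real^'d) \<Rightarrow> nat \<Rightarrow> (nat \<Rightarrow> 'v set) \<Rightarrow> (nat \<Rightarrow> 'v set) \<Rightarrow>
     real \<Rightarrow> real \<Rightarrow> real \<Rightarrow> real \<Rightarrow> real \<Rightarrow> (nat \<Rightarrow> real^'p^'p) \<Rightarrow>
     (nat \<Rightarrow> real^'p) \<Rightarrow> (nat \<Rightarrow> real^'d) \<Rightarrow> (nat \<Rightarrow> real^'p) \<Rightarrow> (nat \<Rightarrow> real^'d) \<Rightarrow> (nat \<Rightarrow> real) \<Rightarrow> bool"
where
  "fogd_iterates E np nd f c M V W mu eta1 eta2 beta nu Hh x l dx dl alpha \<longleftrightarrow>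
     (\<forall>t. fogd_direction E np nd f c M V W mu (Hh t) (x t) (l t) (dx t) (dl t) \<and>
          backtracking_step f c eta1 eta2 beta nu (x t, l t) (dx t, dl t) (alpha t) \<and>
          x (Suc t) = x t + alpha t *\<^sub>R dx t \<and>
          l (Suc t) = l t + alpha t *\<^sub>R dl t)"

definition Ups_hat :: "real \<Rightarrow> real poly \<Rightarrow> real" where
  "Ups_hat Ups pG = Ups * (poly pG 1)\<^sup>2"

definition mu_hat :: "real \<Rightarrow> real \<Rightarrow> real \<Rightarrow> real poly \<Rightarrow> real" where
  "mu_hat gH gG Ups pG = 4 * (Ups_hat Ups pG)\<^sup>2 / (gG * gH)"

definition Ups_K :: "real \<Rightarrow> real \<Rightarrow> real poly \<Rightarrow> real" where
  "Ups_K mu Ups pG = 1.5 * mu * (Ups_hat Ups pG)\<^sup>2"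

definition gam_K :: "real \<Rightarrow> real \<Rightarrow> real \<Rightarrow> real \<Rightarrow> real poly \<Rightarrow> real" where
  "gam_K mu gH gG Ups pG = gH ^ 3 * gG\<^sup>2 / (75 * (Ups_K mu Ups pG) ^ 6)"

definition rho_mu :: "real \<Rightarrow> real \<Rightarrow> real \<Rightarrow> real \<Rightarrow> real poly \<Rightarrow> real" where
  "rho_mu mu gH gG Ups pG =
     (((Ups_K mu Ups pG)\<^sup>2 - (gam_K mu gH gG Ups pG)\<^sup>2) /
      ((Ups_K mu Ups pG)\<^sup>2 + (gam_K mu gH gG Ups pG)\<^sup>2)) powr (1 / 4)"

definition Ups_mu :: "real \<Rightarrow> real \<Rightarrow> real \<Rightarrow> real \<Rightarrow> real poly \<Rightarrow> real" where
  "Ups_mu mu gH gG Ups pG =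
     Ups_K mu Ups pG / ((gam_K mu gH gG Ups pG)\<^sup>2 * (rho_mu mu gH gG Ups pG)\<^sup>2)"

definition poly_GW :: "real poly \<Rightarrow> real poly \<Rightarrow> real \<Rightarrow> real" where
  "poly_GW pG pW t = poly pG (poly pW t)"

definition Ups_mu_b ::
    "real \<Rightarrow> nat \<Rightarrow> real \<Rightarrow> real \<Rightarrow> real \<Rightarrow> real poly \<Rightarrow> real poly \<Rightarrow> real" where
  "Ups_mu_b mu b gH gG Ups pG pW =
     sqrt 2 * Ups_mu mu gH gG Ups pG * Ups_K mu Ups pG /
       (rho_mu mu gH gG Ups pG * sqrt (1 - (rho_mu mu gH gG Ups pG)\<^sup>2))
     * poly_GW pG pW (real b) * sqrt (poly pG (real (b + 2)))"

definition delta_mu_b ::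
    "real \<Rightarrow> nat \<Rightarrow> real \<Rightarrow> real \<Rightarrow> real \<Rightarrow> real poly \<Rightarrow> real poly \<Rightarrow> real" where
  "delta_mu_b mu b gH gG Ups pG pW = Ups_mu_b mu b gH gG Ups pG pW * (rho_mu mu gH gG Ups pG) ^ b"

definition Psi ::
    "('p \<Rightarrow> 'v::finite) \<Rightarrow> ('d \<Rightarrow> 'v) \<Rightarrow> (real^'p) \<times> (real^'d) \<Rightarrow> (real^'p) \<times> (real^'d) \<Rightarrow> real" where
  "Psi np nd z zs = (MAX k. node_norm np nd k (z - zs))"

end

theory Submission
  imports Defs
begin

text \<open>
  Let \<open>e = z\<^sup>\<tau> - z\<^sup>*\<close> be the current error. Since \<open>\<nabla>L\<close> vanishes at \<open>z\<^sup>*\<close> and the modified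
  KKT matrices converge to the exact one, \<open>-e\<close> solves the full Newton system up to a residual
  \<open>o(e)\<close>, so the direction is compared with \<open>-e\<close> and no exact Newton direction is needed. On an
  overlapping set \<open>W\<close> the subproblem is the restriction of the KKT system with Hessian
  \<open>H + \<mu> G\<^sup>T G\<close>; the restriction of \<open>-e\<close> violates it only by a term supported near the
  boundary of \<open>W\<close>. The inverse of this well-conditioned banded system decays exponentially with the
  graph distance, whence the error of the direction on the inner set is of order \<open>\<rho>\<^sup>b\<close> times
  \<open>e\<close> plus \<open>o(e)\<close>. In the Euclidean norm this makes the direction accurate enough for the second
  order expansion of the augmented Lagrangian at \<open>z\<^sup>*\<close> to yield acceptance of the unit step, and
  nodewise it gives the rate.
\<close>

subsection \<open>Neighbourhoods\<close>

text \<open>Each restricted system inherits its conditioning from the full one. Positivity of the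
  Hessian is known only on the kernel of \<open>G\<close>, and cutting to a node set does not
  respect that kernel; but \<open>H + mu G^T G\<close> is coercive on the whole space once
  \<open>mu\<close> reaches \<open>mu_hat\<close>, hence also on vectors supported in
  \<open>W\<close>. The inf-sup bound survives because the constraints imposed exactly, those of
  \<open>W - W_tilde E W\<close>, involve only variables in \<open>W\<close>. The decay comes from
  Richardson iteration on the squared operator: a step widens the support by four and contracts by
  at most \<open>rho ^ 4\<close>, that is, \<open>rho\<close> per edge. The same penalised form
  carries the bounds to the limit, where the kernel of the Jacobian may differ from those at the
  iterates. Geometric error and residual share one budget: twice the geometric constant stays below
  both \<open>delta_mu_b\<close> and the claimed rate, and the residual eventually fits into the
  other half. The Euclidean estimate needs a bound on the number of extended sets through a node,
  the nodewise one a bound on their size.\<close>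

lemma gdist_le_iff: "gdist E i j \<le> enat n \<longleftrightarrow> (\<exists>m\<le>n. (i, j) \<in> E ^^ m)"
proof
  assume a: "gdist E i j \<le> enat n"
  \<comment> \<open>The strict form lets \<open>INF_less_iff\<close> extract an actual walk from the
    infimum.\<close>
  have "gdist E i j < enat (Suc n)"
    using a by (rule le_less_trans) simp
  then obtain m where "(i, j) \<in> E ^^ m" "enat m < enat (Suc n)"
    unfolding gdist_def by (auto simp: INF_less_iff)
  then show "\<exists>m\<le>n. (i, j) \<in> E ^^ m" using less_Suc_eq_le by auto
next
  assume "\<exists>m\<le>n. (i, j) \<in> E ^^ m"
  then obtain m where "m \<le> n" "(i, j) \<in> E ^^ m" by blast
  then show "gdist E i j \<le> enat n"
    unfolding gdist_def by (metis (mono_tags, lifting) INF_lower2 enat_ord_simps(1) mem_Collect_eq)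
qed

lemma nbhd_iff: "i \<in> nbhd E n S \<longleftrightarrow> (\<exists>j\<in>S. \<exists>m\<le>n. (i, j) \<in> E ^^ m)"
proof
  assume "i \<in> nbhd E n S"
  then have "gdist_set E i S < enat (Suc n)"
    unfolding nbhd_def by (auto elim: le_less_trans)
  then obtain j where "j \<in> S" "gdist E i j < enat (Suc n)"
    unfolding gdist_set_def by (auto simp: INF_less_iff)
  then have "gdist E i j \<le> enat n"
    by (cases "gdist E i j") auto
  then show "\<exists>j\<in>S. \<exists>m\<le>n. (i, j) \<in> E ^^ m"
    using \<open>j \<in> S\<close> unfolding gdist_le_iff by blast
next
  assume "\<exists>j\<in>S. \<exists>m\<le>n. (i, j) \<in> E ^^ m"
  then obtain j where "j \<in> S" "gdist E i j \<le> enat n"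
    unfolding gdist_le_iff by blast
  then show "i \<in> nbhd E n S"
    unfolding nbhd_def gdist_set_def by (auto intro: INF_lower2)
qed

lemma relpow_sym: "sym E \<Longrightarrow> (i, j) \<in> E ^^ m \<Longrightarrow> (j, i) \<in> E ^^ m"
proof (induction m arbitrary: j)
  case 0
  then show ?case by simp
next
  case (Suc m)
  then obtain k where "(i, k) \<in> E ^^ m" "(k, j) \<in> E" by auto
  with Suc have "(k, i) \<in> E ^^ m" "(j, k) \<in> E" by (auto dest: symD)
  then show ?case by (rule relpow_Suc_I2[rotated])
qed

lemma relpow_sym_iff: "sym E \<Longrightarrow> (i, j) \<in> E ^^ m \<longleftrightarrow> (j, i) \<in> E ^^ m"
  by (rule iffI) (erule (1) relpow_sym)+

lemma nbhd_singleton_sym: "sym E \<Longrightarrow> i \<in> nbhd E n {j} \<longleftrightarrow> j \<in> nbhd E n {i}"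
  unfolding nbhd_iff by (simp add: relpow_sym_iff[of E i j])

lemma nbhd_superset: "S \<subseteq> nbhd E n S"
  unfolding nbhd_iff subset_iff by (blast intro: relpow_0_I)

lemma nbhd_mono: "m \<le> n \<Longrightarrow> S \<subseteq> T \<Longrightarrow> nbhd E m S \<subseteq> nbhd E n T"
proof
  fix i assume "m \<le> n" "S \<subseteq> T" "i \<in> nbhd E m S"
  then obtain j k where "j \<in> S" "k \<le> m" "(i, j) \<in> E ^^ k"
    unfolding nbhd_iff by blast
  moreover have "j \<in> T" "k \<le> n"
    using calculation \<open>m \<le> n\<close> \<open>S \<subseteq> T\<close> by auto
  ultimately show "i \<in> nbhd E n T"
    unfolding nbhd_iff by blast
qed

lemma nbhd_nbhd: "nbhd E m (nbhd E n S) \<subseteq> nbhd E (m + n) S"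
proof
  fix i assume "i \<in> nbhd E m (nbhd E n S)"
  then obtain k j m' n' where "m' \<le> m" "n' \<le> n" "j \<in> S" "(i, k) \<in> E ^^ m'" "(k, j) \<in> E ^^ n'"
    by (auto simp: nbhd_iff)
  then have "(i, j) \<in> E ^^ (m' + n')" "m' + n' \<le> m + n"
    unfolding relpow_add by auto
  then show "i \<in> nbhd E (m + n) S"
    unfolding nbhd_iff using \<open>j \<in> S\<close> by blast
qed

lemma nbhd_add_eq: "nbhd E (m + n) S = nbhd E m (nbhd E n S)"
proof
  show "nbhd E (m + n) S \<subseteq> nbhd E m (nbhd E n S)"
  proof
    fix i assume "i \<in> nbhd E (m + n) S"
    then obtain j k where j: "j \<in> S" "k \<le> m + n" "(i, j) \<in> E ^^ k"
      unfolding nbhd_iff by blast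
    \<comment> \<open>The walk is cut after \<open>min k m\<close> edges, so that the first piece
      has length at most \<open>m\<close> and the second at most \<open>n\<close>.\<close>
    define k1 where "k1 = min k m"
    have k: "k1 + (k - k1) = k" "k1 \<le> m" "k - k1 \<le> n"
      using j(2) by (auto simp: k1_def)
    have "(i, j) \<in> E ^^ (k1 + (k - k1))"
      using j(3) k(1) by simp
    then have "(i, j) \<in> E ^^ k1 O E ^^ (k - k1)"
      by (simp only: relpow_add)
    then obtain h where "(i, h) \<in> E ^^ k1" "(h, j) \<in> E ^^ (k - k1)" by blast
    moreover from this have "h \<in> nbhd E n S"
      using k(3) j(1) nbhd_iff by fast
    ultimately show "i \<in> nbhd E m (nbhd E n S)"
      using k(2) nbhd_iff by fast
  qed
qed (rule nbhd_nbhd)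

lemma nbhd_UN: "nbhd E n S = (\<Union>j\<in>S. nbhd E n {j})"
  unfolding set_eq_iff by (auto simp: nbhd_iff)

lemma nbhd_singleton: "sym E \<Longrightarrow> nbhd E n {i} = {j. gdist E i j \<le> enat n}"
  unfolding set_eq_iff mem_Collect_eq gdist_le_iff nbhd_iff by (simp add: relpow_sym_iff[of E i])

lemma card_nbhd_le:
  fixes E :: "('v::finite \<times> 'v) set"
  assumes "\<And>i. real (card (nbhd E n {i})) \<le> N"
  shows "real (card (nbhd E n S)) \<le> real (card S) * N"
proof -
  have "card (nbhd E n S) \<le> (\<Sum>j\<in>S. card (nbhd E n {j}))"
    by (subst nbhd_UN) (rule card_UN_le, simp)
  then have "real (card (nbhd E n S)) \<le> (\<Sum>j\<in>S. real (card (nbhd E n {j})))"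
    by (metis of_nat_le_iff of_nat_sum)
  also have "\<dots> \<le> (\<Sum>j\<in>S. N)"
    by (rule sum_mono) (rule assms)
  finally show ?thesis by simp
qed

text \<open>The radius-two ball is the union of the unit balls about the points of a unit ball. This
  is the origin of the square of \<open>poly pG 1\<close> in \<open>Ups_hat\<close>: it bounds the
  number of nonzero blocks in a block row of the modified Hessian.\<close>

lemma card_nbhd_2_le:
  fixes E :: "('v::finite \<times> 'v) set"
  assumes "\<And>i. real (card (nbhd E 1 {i})) \<le> N"
  shows "real (card (nbhd E 2 {i})) \<le> N\<^sup>2"
proof -
  have N: "0 \<le> N"
    using assms[of i] by (rule order_trans[rotated]) simp
  have "nbhd E 2 {i} = nbhd E 1 (nbhd E 1 {i})"
    using nbhd_add_eq[of E 1 1 "{i}"] by (simp only: one_add_one)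
  then have "real (card (nbhd E 2 {i})) \<le> real (card (nbhd E 1 {i})) * N"
    using card_nbhd_le[OF assms, of "nbhd E 1 {i}"] by (simp only:)
  also have "\<dots> \<le> N * N"
    by (rule mult_right_mono[OF assms N])
  finally show ?thesis by (simp only: power2_eq_square)
qed

subsection \<open>Restriction of vectors to node sets\<close>

lemma vsub_nth [simp]: "vsub nv S v $ p = (if nv p \<in> S then v $ p else 0)"
  by (simp add: vsub_def)

lemma linear_vsub: "linear (vsub nv S)"
  by (rule linearI) (auto simp: vec_eq_iff)

lemma vsub_add: "vsub nv S (u + v) = vsub nv S u + vsub nv S v"
  and vsub_scaleR: "vsub nv S (a *\<^sub>R v) = a *\<^sub>R vsub nv S v"
  by (auto simp: vec_eq_iff)

lemma vsub_vsub: "vsub nv S (vsub nv T v) = vsub nv (S \<inter> T) v"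
  by (auto simp: vec_eq_iff)

lemma vsub_UNIV [simp]: "vsub nv UNIV v = v"
  by (auto simp: vec_eq_iff)

lemma vsub_eq_self: "vsub nv S v = v \<longleftrightarrow> (\<forall>p. nv p \<notin> S \<longrightarrow> v $ p = 0)"
  by (auto simp: vec_eq_iff)

lemma vsub_eq_0: "vsub nv S v = 0 \<longleftrightarrow> (\<forall>p. nv p \<in> S \<longrightarrow> v $ p = 0)"
  by (auto simp: vec_eq_iff)

lemma inner_vsub: "vsub nv S u \<bullet> v = u \<bullet> vsub nv S v"
  unfolding inner_vec_def by (rule sum.cong) auto

lemma norm_vec_power2: "(norm (v :: real^'n))\<^sup>2 = (\<Sum>p\<in>UNIV. (v $ p)\<^sup>2)"
  unfolding power2_norm_eq_inner inner_vec_def by (simp add: power2_eq_square)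

lemma sum_norm_vsub:
  assumes "finite L" "disjoint_family_on V L"
  shows "(\<Sum>k\<in>L. (norm (vsub nv (V k) v))\<^sup>2) = (norm (vsub nv (\<Union>k\<in>L. V k) v))\<^sup>2"
proof -
  have "(\<Sum>k\<in>L. (vsub nv (V k) v $ p)\<^sup>2) = (vsub nv (\<Union>k\<in>L. V k) v $ p)\<^sup>2" for p
  proof (cases "\<exists>k\<in>L. nv p \<in> V k")
    case True
    then obtain k where k: "k \<in> L" "nv p \<in> V k" by blast
    have "nv p \<notin> V j" if "j \<in> L - {k}" for j
      using assms(2) k that unfolding disjoint_family_on_def by blast
    then have "(\<Sum>j\<in>L - {k}. (vsub nv (V j) v $ p)\<^sup>2) = 0"
      by (intro sum.neutral) auto
    then show ?thesis
      using k assms(1) by (subst sum.remove[of L k]) auto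
  qed auto
  then show ?thesis
    unfolding norm_vec_power2 by (subst sum.swap) simp
qed

lemma sum_norm_vsub_node:
  fixes nv :: "'n::finite \<Rightarrow> 'v::finite"
  shows "(\<Sum>k\<in>UNIV. (norm (vsub nv {k} v))\<^sup>2) = (norm v)\<^sup>2"
  using sum_norm_vsub[of UNIV "\<lambda>k. {k}" nv v] by (simp add: disjoint_family_on_def)

lemma msub_mult: "msub nr nc I J A *v v = vsub nr I (A *v vsub nc J v)"
  unfolding msub_def matrix_vector_mult_def vec_eq_iff
  by (auto intro!: sum.cong)

lemma norm_msub_mult_le: "norm (vsub nr I (A *v vsub nc J v)) \<le> spec_norm (msub nr nc I J A) * norm v"
  unfolding msub_mult[symmetric] spec_norm_def by (rule onorm) simp

lemma sum_squared_le_card: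
  "(\<Sum>i\<in>A. f i)\<^sup>2 \<le> real (card A) * (\<Sum>i\<in>A. (f i :: real)\<^sup>2)"
  using Cauchy_Schwarz_ineq_sum[of "\<lambda>_. 1" f A] by simp

text \<open>A Schur-type test. Cauchy-Schwarz over the at most \<open>N\<close> nonzero blocks of a
  block row gives one factor \<open>N\<close>; exchanging the sums, with at most \<open>N\<close>
  nonzero blocks per block column, gives the other. \<open>R j\<close> lists the block rows that
  block column \<open>j\<close> may meet.\<close>

lemma norm_block_banded_le:
  fixes A :: "real^'n^'m" and nr :: "'m \<Rightarrow> 'v::finite" and nc :: "'n \<Rightarrow> 'v"
  assumes block: "\<And>i j. spec_norm (msub nr nc {i} {j} A) \<le> C"
    and zero: "\<And>i j. i \<notin> R j \<Longrightarrow> msub nr nc {i} {j} A = 0"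
    and row: "\<And>i. real (card {j. i \<in> R j}) \<le> N"
    and col: "\<And>j. real (card (R j)) \<le> N"
  shows "norm (A *v v) \<le> C * N * norm v"
proof -
  have C: "0 \<le> C"
    using onorm_pos_le[of "\<lambda>w. msub nr nc {undefined} {undefined} A *v w"] block[of undefined undefined]
    by (simp add: spec_norm_def)
  have N: "0 \<le> N"
    using col[of undefined] by (meson of_nat_0_le_iff order_trans)
  let ?n = "\<lambda>j. norm (vsub nc {j} v)"
  have b: "norm (vsub nr {i} (A *v vsub nc {j} v)) \<le> C * ?n j" for i j
  proof -
    have "norm (vsub nr {i} (A *v vsub nc {j} (vsub nc {j} v))) \<le> C * ?n j"
      by (rule order_trans[OF norm_msub_mult_le mult_right_mono[OF block]]) simp
    then show ?thesis by (simp add: vsub_vsub)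
  qed
  have v: "v = (\<Sum>j\<in>UNIV. vsub nc {j} v)"
  proof -
    have "(\<Sum>j\<in>UNIV. vsub nc {j} v $ p) = v $ p" for p
      by (subst sum.remove[of _ "nc p"]) (auto intro!: sum.neutral)
    then show ?thesis
      by (simp only: vec_eq_iff sum_component) simp
  qed
  have "(norm (vsub nr {i} (A *v v)))\<^sup>2 \<le> C\<^sup>2 * N * (\<Sum>j\<in>{j. i \<in> R j}. (?n j)\<^sup>2)" for i
  proof -
    have "vsub nr {i} (A *v v) = (\<Sum>j\<in>UNIV. vsub nr {i} (A *v vsub nc {j} v))"
    proof -
      have "linear (vsub nr {i} \<circ> (*v) A)"
        by (intro linear_compose linear_vsub matrix_vector_mul_linear)
      from linear_sum[OF this, of "\<lambda>j. vsub nc {j} v" UNIV] show ?thesis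
        unfolding o_def v[symmetric] .
    qed
    also have "\<dots> = (\<Sum>j\<in>{j. i \<in> R j}. vsub nr {i} (A *v vsub nc {j} v))"
    proof (rule sum.mono_neutral_right)
      show "\<forall>j\<in>UNIV - {j. i \<in> R j}. vsub nr {i} (A *v vsub nc {j} v) = 0"
        using zero by (simp add: msub_mult[symmetric])
    qed auto
    finally have "norm (vsub nr {i} (A *v v)) \<le> (\<Sum>j\<in>{j. i \<in> R j}. C * ?n j)"
      by (metis (no_types, lifting) b sum_norm_le)
    then have "(norm (vsub nr {i} (A *v v)))\<^sup>2 \<le> (\<Sum>j\<in>{j. i \<in> R j}. C * ?n j)\<^sup>2"
      by (intro power_mono) auto
    also have "\<dots> = C\<^sup>2 * (\<Sum>j\<in>{j. i \<in> R j}. ?n j)\<^sup>2"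
      by (simp add: sum_distrib_left[symmetric] power_mult_distrib)
    also have "\<dots> \<le> C\<^sup>2 * (real (card {j. i \<in> R j}) * (\<Sum>j\<in>{j. i \<in> R j}. (?n j)\<^sup>2))"
      by (intro mult_left_mono sum_squared_le_card) simp
    also have "\<dots> \<le> C\<^sup>2 * (N * (\<Sum>j\<in>{j. i \<in> R j}. (?n j)\<^sup>2))"
      by (intro mult_left_mono mult_right_mono row sum_nonneg) auto
    finally show ?thesis by (simp add: mult.assoc)
  qed
  then have "(norm (A *v v))\<^sup>2 \<le> (\<Sum>i\<in>UNIV. C\<^sup>2 * N * (\<Sum>j\<in>{j. i \<in> R j}. (?n j)\<^sup>2))"
    by (subst sum_norm_vsub_node[symmetric, where nv = nr]) (intro sum_mono)
  also have "\<dots> = C\<^sup>2 * N * (\<Sum>i\<in>UNIV. \<Sum>j\<in>UNIV. if i \<in> R j then (?n j)\<^sup>2 else 0)"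
    by (simp add: sum_distrib_left sum.If_cases)
  also have "\<dots> = C\<^sup>2 * N * (\<Sum>j\<in>UNIV. real (card (R j)) * (?n j)\<^sup>2)"
    by (subst sum.swap) (simp add: sum.If_cases)
  also have "\<dots> \<le> C\<^sup>2 * N * (\<Sum>j\<in>UNIV. N * (?n j)\<^sup>2)"
    using C N by (intro mult_left_mono sum_mono mult_right_mono col) auto
  also have "\<dots> = (C * N * norm v)\<^sup>2"
    by (simp add: sum_distrib_left[symmetric] sum_norm_vsub_node power_mult_distrib) (simp add: power2_eq_square)
  finally show ?thesis
    by (rule power2_le_imp_le) (use C N in simp)
qed

subsection \<open>Exponential decay\<close>

lemma norm_diff_eq_power2: "(norm (u - a *\<^sub>R v))\<^sup>2 = (norm u)\<^sup>2 - 2 * a * (u \<bullet> v) + (norm (a *\<^sub>R v))\<^sup>2"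
  unfolding power2_norm_eq_inner by (simp add: inner_diff_left inner_diff_right inner_commute)

text \<open>Richardson iteration for \<open>K (K x) = K r\<close> with \<open>r = K x\<close>, started at zero: each step enlarges
  the support by four and contracts the error by \<open>sqrt (1 - (g / C)\<^sup>2)\<close>.\<close>

lemma richardson_decay:
  fixes K :: "'a::real_inner \<Rightarrow> 'a"
  assumes lin: "linear K" and self: "\<And>u v. K u \<bullet> v = u \<bullet> K v"
    and upper: "\<And>u. norm (K u) \<le> C * norm u" and lower: "\<And>u. g * norm u \<le> norm (K u)"
    and g: "0 \<le> g" "0 < C" and le1: "g \<le> C"
    and sub: "\<And>j. subspace (S j)" and mono: "\<And>i j. i \<le> j \<Longrightarrow> S i \<subseteq> S j"
    and band: "\<And>j u. u \<in> S j \<Longrightarrow> K u \<in> S (j + 2)"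
    and r: "K x \<in> S 0"
  shows "\<exists>u\<in>S (4 * n - 2). norm (x - u) \<le> (sqrt (1 - (g / C)\<^sup>2)) ^ n * norm x"
proof (induction n)
  case 0
  show ?case
    using subspace_0[OF sub] by (intro bexI[of _ 0]) auto
next
  case (Suc n)
  then obtain u where u: "u \<in> S (4 * n - 2)" "norm (x - u) \<le> (sqrt (1 - (g / C)\<^sup>2)) ^ n * norm x"
    and Ku: "K u \<in> S (4 * n)"
  \<comment> \<open>The radius \<open>4 * n - 2\<close> is a truncated subtraction. At
    \<open>n = 0\<close> it is \<open>0\<close>, and \<open>band\<close> would only place
    \<open>K u\<close> in \<open>S 2\<close>; therefore the iteration must start at the zero vector,
    whose image is again in \<open>S 0\<close>.\<close>
  proof (cases "n = 0")
    case True
    have "K 0 \<in> S 0"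
      using linear_0[OF lin] subspace_0[OF sub] by simp
    then show ?thesis
      using that[of 0] subspace_0[OF sub] True by simp
  next
    case False
    have "4 * n - 2 + 2 = 4 * n"
      using False by simp
    then show ?thesis
      using Suc that band by metis
  qed
  define e where "e = x - u"
  \<comment> \<open>The step length is the reciprocal of the bound \<open>C\<^sup>2\<close> on
    \<open>K \<circ> K\<close>. The step is computable from \<open>K x - K u\<close>, whose support
    is known although that of \<open>x\<close> is not.\<close>
  define u' where "u' = u + (1 / C\<^sup>2) *\<^sub>R K (K x - K u)"
  have "K x - K u \<in> S (4 * n)"
    using Ku mono[of 0 "4 * n"] r by (intro subspace_diff[OF sub]) auto
  then have "K (K x - K u) \<in> S (4 * Suc n - 2)"
    using band[of "K x - K u" "4 * n"] by simp
  then have u'S: "u' \<in> S (4 * Suc n - 2)"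
    unfolding u'_def using subsetD[OF mono u(1), of "4 * Suc n - 2"]
    by (intro subspace_add[OF sub] subspace_scale[OF sub]) auto
  have e': "x - u' = e - (1 / C\<^sup>2) *\<^sub>R K (K e)"
    by (simp add: u'_def e_def linear_diff[OF lin])
  have "(norm (x - u'))\<^sup>2 = (norm e)\<^sup>2 - 2 / C\<^sup>2 * (norm (K e))\<^sup>2 + (norm (K (K e)))\<^sup>2 / (C\<^sup>2)\<^sup>2"
  proof -
    have "e \<bullet> K (K e) = (norm (K e))\<^sup>2"
      by (simp only: self[symmetric] power2_norm_eq_inner)
    then show ?thesis
      unfolding e' norm_diff_eq_power2 by (simp add: power_divide)
  qed
  \<comment> \<open>The upper bound on \<open>K (K e)\<close> consumes one of the two copies of
    \<open>(norm (K e))\<^sup>2 / C\<^sup>2\<close>; the lower bound turns the other into the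
    contraction.\<close>
  also have "\<dots> \<le> (norm e)\<^sup>2 - 2 / C\<^sup>2 * (norm (K e))\<^sup>2 + (C * norm (K e))\<^sup>2 / (C\<^sup>2)\<^sup>2"
    by (intro add_left_mono divide_right_mono power_mono upper) auto
  also have "\<dots> = (norm e)\<^sup>2 - (norm (K e))\<^sup>2 / C\<^sup>2"
    using g by (simp add: field_simps power2_eq_square)
  also have "\<dots> \<le> (norm e)\<^sup>2 - (g * norm e)\<^sup>2 / C\<^sup>2"
    using g by (intro diff_left_mono divide_right_mono power_mono lower) auto
  also have "\<dots> = (1 - (g / C)\<^sup>2) * (norm e)\<^sup>2"
    by (simp add: field_simps)
  finally have "norm (x - u') \<le> sqrt ((1 - (g / C)\<^sup>2) * (norm e)\<^sup>2)"
    by (rule real_le_rsqrt)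
  also have "\<dots> = sqrt (1 - (g / C)\<^sup>2) * norm e"
    by (simp add: real_sqrt_mult)
  also have "\<dots> \<le> sqrt (1 - (g / C)\<^sup>2) * ((sqrt (1 - (g / C)\<^sup>2)) ^ n * norm x)"
    using u(2) g le1 by (intro mult_left_mono) (auto simp: e_def power_le_one)
  finally show ?case
    using u'S by (intro bexI[of _ u']) (auto simp: mult.assoc)
qed

subsection \<open>Lower bounds for saddle point systems\<close>

lemma inner_transpose_mult: "(transpose A *v u) \<bullet> v = u \<bullet> (A *v v)"
  for A :: "real^'n^'m"
  by (simp add: dot_lmul_matrix)

lemma inner_symmetric_mult: "transpose A = A \<Longrightarrow> (A *v u) \<bullet> v = u \<bullet> (A *v v)"
  for A :: "real^'n^'n"
  by (metis inner_transpose_mult)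

lemma norm_transpose_mult_le:
  fixes A :: "real^'n^'m"
  assumes "\<And>v. norm (A *v v) \<le> C * norm v"
  shows "norm (transpose A *v u) \<le> C * norm u"
proof -
  have "(norm (transpose A *v u))\<^sup>2 = u \<bullet> (A *v (transpose A *v u))"
    unfolding power2_norm_eq_inner inner_transpose_mult ..
  also have "\<dots> \<le> norm u * norm (A *v (transpose A *v u))"
    by (rule norm_cauchy_schwarz)
  also have "\<dots> \<le> norm u * (C * norm (transpose A *v u))"
    by (intro mult_left_mono assms) simp
  finally have "norm (transpose A *v u) * norm (transpose A *v u) \<le> (C * norm u) * norm (transpose A *v u)"
    by (simp add: power2_eq_square algebra_simps)
  moreover have "0 \<le> C * norm u"
  proof -
    have "0 \<le> C * norm (axis undefined 1 :: real^'n)"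
      using assms order_trans norm_ge_zero by blast
    then show ?thesis
      by (simp add: norm_axis_1)
  qed
  ultimately show ?thesis
    by (cases "transpose A *v u = 0") (auto simp: mult_le_cancel_right)
qed

text \<open>\<open>w\<close> is split orthogonally into \<open>u\<close> in the kernel of
  \<open>G\<close> and \<open>v\<close> in the range of \<open>transpose G\<close>.
  \<open>A1\<close> controls \<open>u\<close>, the penalty controls \<open>v\<close> because
  \<open>G *v v = G *v w\<close>, and the cross terms are absorbed by giving up half of the
  coercivity on the kernel. The result holds for every \<open>w\<close>, so it applies to vectors
  supported on any node set.\<close>

lemma penalized_coercive:
  fixes H :: "real^'p^'p" and G :: "real^'p^'d"
  assumes H: "\<And>v. norm (H *v v) \<le> U * norm v" and sym: "transpose H = H" and U: "1 \<le> U"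
    and gH: "0 < gH" "gH \<le> 1" and A1: "\<And>w. G *v w = 0 \<Longrightarrow> gH * (norm w)\<^sup>2 \<le> w \<bullet> (H *v w)"
    and gG: "0 < gG" and A2: "\<And>v. gG * (norm v)\<^sup>2 \<le> v \<bullet> ((G ** transpose G) *v v)"
    and k: "4 * U\<^sup>2 / (gG * gH) \<le> k"
  shows "gH / 2 * (norm w)\<^sup>2 \<le> w \<bullet> (H *v w) + k * (norm (G *v w))\<^sup>2"
proof -
  let ?M = "G ** transpose G"
  have "v = 0" if "?M *v v = 0" for v
  proof -
    have "gG * (norm v)\<^sup>2 \<le> 0" using A2[of v] that by simp
    then show "v = 0" using gG by (simp add: mult_le_0_iff)
  qed
  then have "inj ((*v) ?M)"
    by (simp add: linear_injective_0[OF matrix_vector_mul_linear])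
  then have "surj ((*v) ?M)"
    by (intro linear_injective_imp_surjective matrix_vector_mul_linear) auto
  \<comment> \<open>\<open>y\<close> is the inverse of \<open>?M\<close> applied to
    \<open>G *v w\<close>; thus \<open>v\<close> is the orthogonal projection of \<open>w\<close>
    onto the range of \<open>transpose G\<close>.\<close>
  then obtain y where y: "?M *v y = G *v w" by (metis surj_def)
  define v where "v = transpose G *v y"
  define u where "u = w - v"
  have w: "w = u + v" by (simp add: u_def)
  have Gv: "G *v v = G *v w"
    using y unfolding v_def matrix_vector_mul_assoc .
  then have Gu: "G *v u = 0"
    by (simp add: u_def matrix_vector_mult_diff_distrib)
  have orth: "u \<bullet> v = 0"
    unfolding v_def inner_commute[of u] inner_transpose_mult by (simp add: Gu)
  \<comment> \<open>The square of \<open>norm v\<close> equals \<open>y \<bullet> (G *v v)\<close>,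
    and \<open>A2\<close> bounds \<open>y\<close> by \<open>v\<close>. Squaring before combining the
    two keeps square roots of \<open>gG\<close> out.\<close>
  have GvGG: "gG * (norm v)\<^sup>2 \<le> (norm (G *v v))\<^sup>2"
  proof -
    have "(norm v)\<^sup>2 = y \<bullet> (G *v v)"
      unfolding power2_norm_eq_inner by (subst (1) v_def) (rule inner_transpose_mult)
    also have "\<dots> \<le> norm y * norm (G *v v)"
      by (rule norm_cauchy_schwarz)
    finally have "((norm v)\<^sup>2)\<^sup>2 \<le> (norm y)\<^sup>2 * (norm (G *v v))\<^sup>2"
      by (metis power_mono power_mult_distrib zero_le_power2)
    moreover have "gG * (norm y)\<^sup>2 \<le> (norm v)\<^sup>2"
      using A2[of y] unfolding v_def power2_norm_eq_inner inner_transpose_mult matrix_vector_mul_assoc .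
    ultimately have "gG * ((norm v)\<^sup>2)\<^sup>2 \<le> (norm v)\<^sup>2 * (norm (G *v v))\<^sup>2"
      using gG by (smt (verit) mult.assoc mult_left_mono mult_right_mono zero_le_power2)
    then have "(gG * (norm v)\<^sup>2) * (norm v)\<^sup>2 \<le> (norm (G *v v))\<^sup>2 * (norm v)\<^sup>2"
      by (simp add: power2_eq_square algebra_simps)
    then show ?thesis
      by (cases "v = 0") (auto simp: mult_le_cancel_right)
  qed
  define a where "a = norm u"
  define c where "c = norm v"
  have ac: "0 \<le> a" "0 \<le> c" by (auto simp: a_def c_def)
  have cross: "\<bar>v' \<bullet> (H *v u')\<bar> \<le> U * (norm v' * norm u')" for u' v'
    using Cauchy_Schwarz_ineq2[of v' "H *v u'"] mult_left_mono[OF H[of u'] norm_ge_zero[of v']]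
    by (simp add: algebra_simps)
  have "w \<bullet> (H *v w) = u \<bullet> (H *v u) + 2 * (u \<bullet> (H *v v)) + v \<bullet> (H *v v)"
    using inner_symmetric_mult[OF sym, of u v]
    by (simp add: w matrix_vector_right_distrib inner_add inner_commute)
  moreover have "gH * a\<^sup>2 \<le> u \<bullet> (H *v u)"
    using A1[OF Gu] by (simp add: a_def)
  moreover have "\<bar>u \<bullet> (H *v v)\<bar> \<le> U * (a * c)" "\<bar>v \<bullet> (H *v v)\<bar> \<le> U * (c * c)"
    unfolding a_def c_def by (rule cross)+
  ultimately have 1: "gH * a\<^sup>2 - 2 * (U * (a * c)) - U * (c * c) \<le> w \<bullet> (H *v w)"
    by linarith
  have "0 \<le> k" using k gG gH by (smt (verit) divide_nonneg_pos mult_pos_pos zero_le_power2)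
  then have "k * (gG * c\<^sup>2) \<le> k * (norm (G *v w))\<^sup>2"
    using GvGG unfolding c_def Gv by (rule mult_left_mono[rotated])
  moreover have "4 * U\<^sup>2 / gH * c\<^sup>2 \<le> k * (gG * c\<^sup>2)"
  proof -
    have "4 * U\<^sup>2 / gH \<le> k * gG"
      using k gG gH by (simp add: field_simps)
    then show ?thesis
      by (metis mult.assoc mult_right_mono zero_le_power2)
  qed
  ultimately have 2: "4 * U\<^sup>2 / gH * c\<^sup>2 \<le> k * (norm (G *v w))\<^sup>2" by simp
  \<comment> \<open>Young's inequality, weighted so that half of \<open>gH * a\<^sup>2\<close> is
    spent. It uses half of the multiple of \<open>c\<^sup>2\<close> supplied by the threshold on
    \<open>k\<close>; the fact labelled \<open>4\<close> uses the other half.\<close>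
  have 3: "2 * (U * (a * c)) \<le> gH / 2 * a\<^sup>2 + 2 * U\<^sup>2 / gH * c\<^sup>2"
  proof -
    have "0 \<le> (gH * a - 2 * U * c)\<^sup>2 / (2 * gH)"
      using gH by simp
    also have "\<dots> = gH / 2 * a\<^sup>2 + 2 * U\<^sup>2 / gH * c\<^sup>2 - 2 * (U * (a * c))"
      using gH by (simp add: field_simps power2_eq_square)
    finally show ?thesis by simp
  qed
  have UU: "U * U \<ge> U"
    using U by simp
  have 4: "U * (c * c) + gH / 2 * c\<^sup>2 \<le> 2 * U\<^sup>2 / gH * c\<^sup>2"
  proof -
    have "U + gH / 2 \<le> 2 * U\<^sup>2"
      using UU U gH unfolding power2_eq_square by linarith
    also have "\<dots> \<le> 2 * U\<^sup>2 / gH"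
      using gH mult_right_mono[of gH 1 "U\<^sup>2"] by (simp add: field_simps)
    finally have "(U + gH / 2) * c\<^sup>2 \<le> 2 * U\<^sup>2 / gH * c\<^sup>2"
      by (rule mult_right_mono) simp
    then show ?thesis by (simp add: power2_eq_square algebra_simps)
  qed
  have "(norm w)\<^sup>2 = a\<^sup>2 + c\<^sup>2"
    using orth by (simp add: w a_def c_def power2_norm_eq_inner inner_add inner_commute)
  with 1 2 3 4 show ?thesis
    by (simp add: algebra_simps)
qed

text \<open>Bounds the solution \<open>(x, y)\<close> of \<open>A x + B\<^sup>T y = f\<close>, \<open>B x = g\<close>; here \<open>Ax\<close> and \<open>By\<close> stand for
  \<open>A x\<close> and \<open>B\<^sup>T y\<close>.\<close>

lemma saddle_point_lower:
  fixes x Ax By :: "'a::real_inner" and y g :: "'b::real_inner"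
  assumes coer: "gH / 2 * (norm x)\<^sup>2 \<le> x \<bullet> Ax" and Ax: "norm Ax \<le> UK * norm x"
    and adj: "x \<bullet> By = y \<bullet> g" and inf: "gG * (norm y)\<^sup>2 \<le> (norm By)\<^sup>2"
    and gH: "0 < gH" "gH \<le> 1" and gG: "0 < gG" "gG \<le> 1" and UK: "1 \<le> UK"
  shows "gH * gG\<^sup>2 / (15 * UK\<^sup>2) * norm (x, y) \<le> norm (Ax + By, g)"
proof -
  define s where "s = norm (Ax + By, g)"
  define a where "a = norm x"
  define c where "c = norm y"
  have nn: "0 \<le> a" "0 \<le> c" "0 \<le> s" by (auto simp: a_def c_def s_def)
  have f: "norm (Ax + By) \<le> s" and g: "norm g \<le> s"
    unfolding s_def by (auto simp: norm_Pair)
  have "norm By \<le> s + UK * a"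
    using f norm_triangle_ineq4[of "Ax + By" Ax] Ax by (simp add: a_def)
  moreover have "gG * c \<le> norm By"
  proof -
    \<comment> \<open>\<open>gG \<le> 1\<close> replaces the square root of \<open>gG\<close> by
      \<open>gG\<close> itself, so that no root enters the constant.\<close>
    have "(gG * c)\<^sup>2 \<le> gG * c\<^sup>2"
    proof -
      have "gG * (gG * c\<^sup>2) \<le> 1 * (gG * c\<^sup>2)"
        using gG by (intro mult_right_mono) auto
      then show ?thesis by (simp add: power_mult_distrib power2_eq_square mult_ac)
    qed
    also have "\<dots> \<le> (norm By)\<^sup>2" using inf by (simp add: c_def)
    finally show ?thesis by (rule power2_le_imp_le) simp
  qed
  ultimately have c: "gG * c \<le> s + UK * a" by simp
  \<comment> \<open>Testing with \<open>(x, - y)\<close> cancels the coupling terms by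
    \<open>adj\<close>; the bound \<open>c\<close> on the multiplier then leaves a quadratic
    inequality in \<open>a\<close> alone.\<close>
  have "gH / 2 * a\<^sup>2 \<le> x \<bullet> (Ax + By) - y \<bullet> g"
    using coer adj by (simp add: a_def inner_add)
  also have "\<dots> \<le> a * s + c * s"
    using norm_cauchy_schwarz[of x "Ax + By"] Cauchy_Schwarz_ineq2[of y g]
      mult_left_mono[OF f, of a] mult_left_mono[OF g, of c] nn
    unfolding a_def c_def by linarith
  finally have "gG * (gH / 2 * a\<^sup>2) \<le> gG * (a * s + c * s)"
    using gG by (intro mult_left_mono) auto
  also have "\<dots> = gG * (a * s) + (gG * c) * s" by (simp add: algebra_simps)
  also have "\<dots> \<le> 1 * (a * s) + (s + UK * a) * s"
    using gG nn c by (intro add_mono mult_right_mono) auto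
  also have "\<dots> \<le> (2 * UK * a) * s + s * s"
  proof -
    have "a * s \<le> UK * (a * s)"
      using mult_right_mono[OF UK, of "a * s"] nn by simp
    then show ?thesis by (simp add: algebra_simps)
  qed
  finally have q: "gH * gG * a\<^sup>2 \<le> 4 * UK * a * s + 2 * s\<^sup>2"
    by (simp add: power2_eq_square algebra_simps)
  have a: "gH * gG * a \<le> 5 * UK * s"
  \<comment> \<open>If the bound fails, \<open>q\<close> leaves
    \<open>UK * a * s < 2 * s * s\<close>, whereas the negated claim makes \<open>a\<close> larger
    than \<open>2 * s\<close>.\<close>
  proof (rule ccontr)
    assume "\<not> ?thesis"
    then have h: "5 * UK * s < gH * gG * a" by simp
    have "gH * gG * a \<le> 1 * a"
      using gH gG nn by (intro mult_right_mono) (auto simp: mult_le_one)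
    then have sa: "5 * UK * s < a" using h by simp
    then have "a > 0" using nn UK by (smt (verit) mult_nonneg_nonneg)
    with h have "5 * UK * s * a < gH * gG * a * a" by simp
    moreover have "gH * gG * a\<^sup>2 = gH * gG * a * a" "4 * UK * a * s = 4 * (UK * a * s)"
      "5 * UK * s * a = 5 * (UK * a * s)" "2 * s\<^sup>2 = 2 * s * s"
      by (simp_all add: power2_eq_square mult_ac)
    ultimately have "UK * a * s < 2 * s * s" using q by linarith
    moreover have "2 * s * s \<le> UK * a * s"
    proof -
      have "2 * s \<le> 5 * UK * s" using UK nn by (intro mult_right_mono) auto
      also have "\<dots> \<le> a" using sa by simp
      also have "\<dots> \<le> UK * a" using mult_right_mono[OF UK, of a] nn by simp
      finally show ?thesis using nn by (intro mult_right_mono) auto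
    qed
    ultimately show False by simp
  qed
  have "gH * gG\<^sup>2 * (a + c) = gG * (gH * gG * a) + gH * gG * (gG * c)"
    by (simp add: power2_eq_square algebra_simps)
  also have "\<dots> \<le> 1 * (5 * UK * s) + gH * gG * (s + UK * a)"
  proof (rule add_mono)
    show "gG * (gH * gG * a) \<le> 1 * (5 * UK * s)"
      by (rule mult_mono) (use a gH gG nn in auto)
    show "gH * gG * (gG * c) \<le> gH * gG * (s + UK * a)"
      using c gH gG by (intro mult_left_mono) auto
  qed
  also have "\<dots> = 5 * UK * s + gH * gG * s + UK * (gH * gG * a)" by (simp add: algebra_simps)
  also have "\<dots> \<le> 5 * UK * s + 1 * s + UK * (5 * UK * s)"
    using a gH gG nn UK by (intro add_mono mult_left_mono mult_right_mono) (auto simp: mult_le_one)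
  also have "\<dots> \<le> 15 * UK\<^sup>2 * s"
  proof -
    have "1 * UK \<le> UK * UK" "1 \<le> UK * UK" using UK mult_mono[of 1 UK 1 UK] by (auto intro: mult_right_mono)
    then have "5 * UK + 1 + 5 * (UK * UK) \<le> 15 * (UK * UK)" by linarith
    from mult_right_mono[OF this nn(3)] show ?thesis
      by (simp add: power2_eq_square algebra_simps)
  qed
  finally have "gH * gG\<^sup>2 * (a + c) \<le> 15 * UK\<^sup>2 * s" .
  moreover have "norm (x, y) \<le> a + c"
    unfolding a_def c_def by (simp add: norm_Pair sqrt_sum_squares_le_sum)
  then have "gH * gG\<^sup>2 * norm (x, y) \<le> gH * gG\<^sup>2 * (a + c)"
    using gH by (intro mult_left_mono) auto
  ultimately show ?thesis
    using UK by (simp add: s_def field_simps)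
qed

subsection \<open>The penalised saddle point operator\<close>

lemma linear_vector_matrix_mult: "linear (\<lambda>x. x v* A)" for A :: "real^'n^'m"
  unfolding transpose_matrix_vector[symmetric] by (rule matrix_vector_mul_linear)

lemma band_mult:
  fixes A :: "real^'n^'m"
  assumes band: "\<And>p q. A $ p $ q \<noteq> 0 \<Longrightarrow> nr p \<in> nbhd E n {nc q}" and x: "vsub nc S x = x"
  shows "vsub nr (nbhd E n S) (A *v x) = A *v x"
  unfolding vsub_eq_self
proof (intro allI impI)
  fix p assume p: "nr p \<notin> nbhd E n S"
  have "A $ p $ q * x $ q = 0" for q
  proof (cases "nc q \<in> S")
    case True
    then have "nbhd E n {nc q} \<subseteq> nbhd E n S"
      by (intro nbhd_mono) auto
    then show ?thesis using p band[of p q] by auto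
  next
    case False
    then show ?thesis using x unfolding vsub_eq_self by auto
  qed
  then show "(A *v x) $ p = 0"
    unfolding matrix_vector_mult_def by (simp only: vec_lambda_beta sum.neutral_const)
qed

lemma vsub_mono_self: "vsub nv S v = v \<Longrightarrow> S \<subseteq> T \<Longrightarrow> vsub nv T v = v"
  unfolding vsub_eq_self by blast

lemma norm_vsub_le: "norm (vsub nv S v) \<le> norm v"
proof -
  have "(norm (vsub nv S v))\<^sup>2 \<le> (norm v)\<^sup>2"
    unfolding norm_vec_power2 by (rule sum_mono) simp
  then show ?thesis by (rule power2_le_imp_le) simp
qed

section \<open>Partition set, extension and complement; coordinate projections\<close>

lemma nbhd_avoid:
  assumes "sym E" "nbhd E b V \<subseteq> W" "j \<le> b"
  shows "V \<inter> nbhd E j (- W) = {}"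
proof (rule ccontr)
  assume "\<not> ?thesis"
  then obtain i k m where i: "i \<in> V" "k \<notin> W" "m \<le> j" "(i, k) \<in> E ^^ m"
    by (auto simp: nbhd_iff)
  then have "(k, i) \<in> E ^^ m" using relpow_sym[OF assms(1)] by blast
  then have "k \<in> nbhd E b V"
    unfolding nbhd_iff using i(1,3) assms(3) by (meson le_trans)
  with i(2) assms(2) show False by blast
qed

text \<open>A node outside \<open>W\<close> with a neighbour in \<open>W\<close> lies in
  \<open>nbhd_open E W\<close>, so all its neighbours in \<open>W\<close> belong to
  \<open>W_tilde E W\<close>. Consequently the constraints at \<open>W - W_tilde E W\<close> involve
  variables in \<open>W\<close> only, and cutting these rows of \<open>G\<close> to columns in
  \<open>W\<close> loses nothing.\<close>

lemma nbhd_interior: "sym E \<Longrightarrow> nbhd E 1 (W - W_tilde E W) \<subseteq> W"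
proof
  fix i assume E: "sym E" and i: "i \<in> nbhd E 1 (W - W_tilde E W)"
  show "i \<in> W"
  proof (rule ccontr)
    assume iW: "i \<notin> W"
    obtain j m where j: "j \<in> W" "j \<notin> W_tilde E W" "m \<le> 1" "(i, j) \<in> E ^^ m"
      using i by (auto simp: nbhd_iff)
    have "i \<in> nbhd E 1 W"
      unfolding nbhd_iff using j(1,3,4) by blast
    with iW have iN: "i \<in> nbhd_open E W"
      unfolding nbhd_open_def by blast
    have "(j, i) \<in> E ^^ m"
      using relpow_sym[OF E j(4)] .
    then have "j \<in> nbhd E 1 (nbhd_open E W)"
      unfolding nbhd_iff[of j] using iN j(3) by blast
    then have "j \<in> W_tilde E W"
      using j(1) unfolding W_tilde_def nbhd_open_def by blast
    with j(2) show False ..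
  qed
qed

lemma W_tilde_subset: "W_tilde E W \<subseteq> W \<inter> nbhd E 1 (- W)"
proof -
  have "nbhd_open E W \<subseteq> - W"
    unfolding nbhd_open_def by blast
  then have "nbhd E 1 (nbhd_open E W) \<subseteq> nbhd E 1 (- W)"
    by (rule nbhd_mono[OF order_refl])
  then show ?thesis
    unfolding W_tilde_def nbhd_open_def[of E "nbhd_open E W"] by blast
qed

lemma norm_Pair_0: "norm (x, 0) = norm x" "norm (0, y) = norm y"
  by (simp_all add: norm_Pair)

text \<open>Primal and dual components get separate node sets because a subproblem has variables on
  \<open>W\<close> but multipliers only on \<open>W - W_tilde E W\<close>.\<close>

definition proj ::
    "('p \<Rightarrow> 'v) \<Rightarrow> ('d \<Rightarrow> 'v) \<Rightarrow> 'v set \<Rightarrow> 'v set \<Rightarrow> (real^'p) \<times> (real^'d) \<Rightarrow> (real^'p) \<times> (real^'d)"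
where
  "proj np nd S T z = (vsub np S (fst z), vsub nd T (snd z))"

lemma linear_proj: "linear (proj np nd S T)"
  by (rule linearI) (auto simp: proj_def vsub_add vsub_scaleR)

lemma proj_proj: "proj np nd S T (proj np nd S' T' z) = proj np nd (S \<inter> S') (T \<inter> T') z"
  by (simp add: proj_def vsub_vsub)

lemma inner_proj: "proj np nd S T u \<bullet> v = u \<bullet> proj np nd S T v"
  by (simp add: proj_def inner_prod_def inner_vsub)

lemma norm_proj_pythagoras:
  "(norm z)\<^sup>2 = (norm (proj np nd S T z))\<^sup>2 + (norm (z - proj np nd S T z))\<^sup>2"
proof -
  have "proj np nd S T z \<bullet> (z - proj np nd S T z) = 0"
    by (simp add: inner_proj linear_diff[OF linear_proj] proj_proj)
  then have "orthogonal (proj np nd S T z) (z - proj np nd S T z)"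
    by (simp add: orthogonal_def)
  from norm_add_Pythagorean[OF this] show ?thesis by simp
qed

lemma norm_proj_le: "norm (proj np nd S T z) \<le> norm z"
  by (rule power2_le_imp_le) (simp_all add: norm_proj_pythagoras[of z np nd S T])

lemma proj_minus_commute:
  "proj np nd S T (z - proj np nd S' T' z) = proj np nd S T z - proj np nd S' T' (proj np nd S T z)"
  by (simp add: linear_diff[OF linear_proj] proj_proj Int_commute)

text \<open>The data of a single iterate, with constants common to all iterates. \<open>U\<close>
  stands for \<open>Ups_hat\<close>, and the last hypothesis is
  \<open>mu_hat \<le> mu\<close>.\<close>

locale penalized_kkt =
  fixes E :: "('v::finite \<times> 'v) set" and np :: "'p::finite \<Rightarrow> 'v" and nd :: "'d::finite \<Rightarrow> 'v"
    and H :: "real^'p^'p" and G :: "real^'p^'d" and U mu gH gG :: real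
  assumes sym_E: "sym E"
    and H_sym: "transpose H = H"
    and H_band: "\<And>p q. H $ p $ q \<noteq> 0 \<Longrightarrow> np p \<in> nbhd E 2 {np q}"
    and G_band: "\<And>r p. G $ r $ p \<noteq> 0 \<Longrightarrow> nd r \<in> nbhd E 1 {np p}"
    and H_norm: "\<And>v. norm (H *v v) \<le> U * norm v"
    and G_norm: "\<And>v. norm (G *v v) \<le> U * norm v"
    and U: "1 \<le> U"
    and gH: "0 < gH" "gH \<le> 1" and gG: "0 < gG" "gG \<le> 1"
    and A1: "\<And>w. G *v w = 0 \<Longrightarrow> gH * (norm w)\<^sup>2 \<le> w \<bullet> (H *v w)"
    and A2: "\<And>v. gG * (norm v)\<^sup>2 \<le> v \<bullet> ((G ** transpose G) *v v)"
    and mu: "4 * U\<^sup>2 / (gG * gH) \<le> mu"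
begin

abbreviation "pr \<equiv> proj np nd"

text \<open>The symmetric KKT matrix whose upper left block is the augmented Hessian
  \<open>H + mu G^T G\<close>.\<close>

definition Kmu :: "(real^'p) \<times> (real^'d) \<Rightarrow> (real^'p) \<times> (real^'d)" where
  "Kmu z = (H *v fst z + mu *\<^sub>R ((G *v fst z) v* G) + snd z v* G, G *v fst z)"

definition UK :: real where "UK = 1.5 * mu * U\<^sup>2"

text \<open>The lower bound delivered by \<open>saddle_point_lower\<close>. The prescribed
  \<open>gK\<close> is smaller at least by a factor five; this slack pays for the contraction rate
  later.\<close>

definition g0 :: real where "g0 = gH * gG\<^sup>2 / (15 * UK\<^sup>2)"

lemma mu_ge_4: "4 \<le> mu"
proof -
  have "gG * gH \<le> 1" using gH gG by (simp add: mult_le_one)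
  moreover have "1 \<le> U\<^sup>2" using U by simp
  ultimately have "4 * (gG * gH) \<le> 4 * U\<^sup>2" by linarith
  then have "4 \<le> 4 * U\<^sup>2 / (gG * gH)" using gH gG by (simp add: field_simps)
  with mu show ?thesis by simp
qed

text \<open>The origin of the factor 1.5: since \<open>4 \<le> mu\<close> and
  \<open>1 \<le> U\<close>, half of \<open>mu * U\<^sup>2\<close> pays for \<open>2 * U\<close>,
  once for the Hessian and once for the off-diagonal blocks.\<close>

lemma UK_ge: "mu * U\<^sup>2 + 2 * U \<le> UK" "1 \<le> UK"
proof -
  have "U * 1 \<le> U * U" using U by (intro mult_left_mono) auto
  then have "U \<le> U\<^sup>2" by (simp add: power2_eq_square)
  moreover have "4 * U\<^sup>2 \<le> mu * U\<^sup>2" by (intro mult_right_mono mu_ge_4) simp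
  ultimately have "2 * U \<le> (mu * U\<^sup>2) / 2" by linarith
  moreover have "UK = mu * U\<^sup>2 + (mu * U\<^sup>2) / 2" by (simp add: UK_def)
  ultimately show "mu * U\<^sup>2 + 2 * U \<le> UK" "1 \<le> UK"
    using U by linarith+
qed

lemma g0: "0 < g0" "g0 \<le> 1"
proof -
  show "0 < g0" using gH gG UK_ge by (simp add: g0_def)
  have "gG\<^sup>2 \<le> 1" using gG by (simp add: power_le_one)
  then have "gH * gG\<^sup>2 \<le> 1" using gH by (intro mult_le_one) auto
  also have "1 \<le> 15 * UK\<^sup>2" using power_mono[OF UK_ge(2), of 2] by simp
  finally show "g0 \<le> 1" using UK_ge by (simp add: g0_def)
qed

lemma GT_norm: "norm (u v* G) \<le> U * norm u"
  using norm_transpose_mult_le[of G U u, OF G_norm] by simp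

lemma linear_Kmu: "linear Kmu"
  unfolding Kmu_def
  by (rule linearI)
    (auto simp: matrix_vector_right_distrib linear_add[OF linear_vector_matrix_mult]
      linear_cmul[OF linear_vector_matrix_mult] matrix_vector_mult_scaleR scaleR_add_right)

lemma Kmu_self_adjoint: "Kmu u \<bullet> v = u \<bullet> Kmu v"
proof -
  have "(H *v fst u) \<bullet> fst v = fst u \<bullet> (H *v fst v)"
    by (rule inner_symmetric_mult[OF H_sym])
  moreover have "a \<bullet> (b v* G) = (G *v a) \<bullet> b" for a b
    using dot_lmul_matrix[of b G a] by (simp add: inner_commute)
  ultimately show ?thesis
    by (simp add: Kmu_def inner_prod_def inner_add_left inner_add_right dot_lmul_matrix)
qed

lemma norm_A_le: "norm (H *v x + mu *\<^sub>R ((G *v x) v* G)) \<le> (mu * U\<^sup>2 + U) * norm x"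
proof -
  have "norm ((G *v x) v* G) \<le> U * (U * norm x)"
    using GT_norm[of "G *v x"] mult_left_mono[OF G_norm[of x], of U] U by linarith
  then have "mu * norm ((G *v x) v* G) \<le> mu * (U * (U * norm x))"
    using mu_ge_4 by (intro mult_left_mono) auto
  then have "norm (mu *\<^sub>R ((G *v x) v* G)) \<le> mu * U\<^sup>2 * norm x"
    using mu_ge_4 by (simp add: power2_eq_square mult.assoc)
  then show ?thesis
    using norm_triangle_ineq[of "H *v x" "mu *\<^sub>R ((G *v x) v* G)"] H_norm[of x]
    by (simp add: algebra_simps)
qed

lemma Kmu_norm: "norm (Kmu z) \<le> UK * norm z"
proof -
  have 1: "norm (fst z) \<le> norm z"
    by (metis norm_fst_le prod.collapse)
  have "Kmu z = (H *v fst z + mu *\<^sub>R ((G *v fst z) v* G), 0) + (snd z v* G, G *v fst z)"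
    by (simp add: Kmu_def)
  then have "norm (Kmu z) \<le> norm (H *v fst z + mu *\<^sub>R ((G *v fst z) v* G)) + norm (snd z v* G, G *v fst z)"
    using norm_triangle_ineq[of "(H *v fst z + mu *\<^sub>R ((G *v fst z) v* G), 0::real^'d)" "(snd z v* G, G *v fst z)"]
    by (simp only: norm_Pair_0)
  moreover have "norm (snd z v* G, G *v fst z) \<le> U * norm z"
  proof -
    have "(norm (snd z v* G))\<^sup>2 + (norm (G *v fst z))\<^sup>2 \<le> (U * norm (snd z))\<^sup>2 + (U * norm (fst z))\<^sup>2"
      by (intro add_mono power_mono GT_norm G_norm) auto
    also have "\<dots> = (U * norm z)\<^sup>2"
      by (simp add: norm_prod_def power_mult_distrib algebra_simps)
    finally show ?thesis
      unfolding norm_Pair using U by (intro real_le_lsqrt) auto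
  qed
  moreover have "(mu * U\<^sup>2 + U) * norm (fst z) \<le> (mu * U\<^sup>2 + U) * norm z"
    using 1 mu_ge_4 U by (intro mult_left_mono) auto
  moreover have "(mu * U\<^sup>2 + U) * norm z + U * norm z \<le> UK * norm z"
    using mult_right_mono[OF UK_ge(1) norm_ge_zero[of z]] by (simp add: algebra_simps)
  ultimately show ?thesis
    using norm_A_le[of "fst z"] by linarith
qed

lemma GT_band:
  assumes "vsub nd S y = y"
  shows "vsub np (nbhd E 1 S) (y v* G) = y v* G"
proof -
  have "vsub np (nbhd E 1 S) (transpose G *v y) = transpose G *v y"
  proof (rule band_mult[OF _ assms])
    fix p q assume "transpose G $ p $ q \<noteq> 0"
    then have "nd q \<in> nbhd E 1 {np p}"
      by (intro G_band) (simp add: transpose_def)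
    then show "np p \<in> nbhd E 1 {nd q}"
      by (simp only: nbhd_singleton_sym[OF sym_E])
  qed
  then show ?thesis by simp
qed

text \<open>The multiplier may occupy one layer more than the primal part, since \<open>G^T\<close>
  reaches one edge and the Hessian block two. The error outside a subproblem has this shape, as
  multipliers are missing already on \<open>W_tilde E W\<close>.\<close>

lemma Kmu_band':
  assumes x: "vsub np S (fst z) = fst z" and y: "vsub nd (nbhd E 1 S) (snd z) = snd z"
  shows "pr (nbhd E 2 S) (nbhd E 2 S) (Kmu z) = Kmu z"
proof -
  have two: "nbhd E 1 (nbhd E 1 S) = nbhd E 2 S"
    using nbhd_add_eq[of E 1 1 S] by (simp only: one_add_one)
  have G: "vsub nd (nbhd E 1 S) (G *v fst z) = G *v fst z"
    by (rule band_mult[OF G_band x])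
  have "vsub np (nbhd E 2 S) (H *v fst z) = H *v fst z"
    by (rule band_mult[OF H_band x])
  moreover have "vsub np (nbhd E 2 S) ((G *v fst z) v* G) = (G *v fst z) v* G"
    using GT_band[OF G] unfolding two .
  moreover have "vsub np (nbhd E 2 S) (snd z v* G) = snd z v* G"
    using GT_band[OF y] unfolding two .
  moreover have "vsub nd (nbhd E 2 S) (G *v fst z) = G *v fst z"
    by (rule vsub_mono_self[OF G]) (rule nbhd_mono, auto)
  ultimately show ?thesis
    by (simp add: proj_def Kmu_def vsub_add vsub_scaleR)
qed

lemma Kmu_band:
  assumes "pr S S z = z"
  shows "pr (nbhd E 2 S) (nbhd E 2 S) (Kmu z) = Kmu z"
proof (rule Kmu_band')
  show "vsub np S (fst z) = fst z"
    using assms by (metis proj_def fst_conv)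
  have "vsub nd S (snd z) = snd z"
    using assms by (metis proj_def snd_conv)
  then show "vsub nd (nbhd E 1 S) (snd z) = snd z"
    by (rule vsub_mono_self) (rule nbhd_superset)
qed

subsection \<open>Restriction to an overlapping node set\<close>

definition Q :: "'v set \<Rightarrow> (real^'p) \<times> (real^'d) \<Rightarrow> (real^'p) \<times> (real^'d)" where
  "Q W = pr W (W - W_tilde E W)"

lemma linear_Q: "linear (Q W)" unfolding Q_def by (rule linear_proj)

lemma Q_Q: "Q W (Q W z) = Q W z" unfolding Q_def by (simp add: proj_proj)

text \<open>Neither bound deteriorates under restriction. Coercivity is only tested with a vector on
  \<open>W\<close>, and for \<open>y\<close> on \<open>W - W_tilde E W\<close> the vector
  \<open>y v* G\<close> already lies on \<open>W\<close>, so the inf-sup bound is that of the full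
  Jacobian.\<close>

lemma Kmu_lower:
  assumes z: "Q W z = z"
  shows "g0 * norm z \<le> norm (Q W (Kmu z))"
proof -
  let ?D = "W - W_tilde E W"
  obtain x y where xy: "z = (x, y)" by fastforce
  have x: "vsub np W x = x" and y: "vsub nd ?D y = y"
    using z by (auto simp: xy Q_def proj_def)
  let ?A = "H *v x + mu *\<^sub>R ((G *v x) v* G)"
  have GTy: "vsub np W (y v* G) = y v* G"
    by (rule vsub_mono_self[OF GT_band[OF y] nbhd_interior[OF sym_E]])
  have "gH * gG\<^sup>2 / (15 * UK\<^sup>2) * norm (x, y) \<le> norm (vsub np W ?A + y v* G, vsub nd ?D (G *v x))"
  proof (rule saddle_point_lower[OF _ _ _ _ gH gG UK_ge(2)])
    have "x \<bullet> vsub np W ?A = x \<bullet> ?A"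
      by (simp only: inner_vsub[symmetric] x)
    also have "\<dots> = x \<bullet> (H *v x) + mu * (norm (G *v x))\<^sup>2"
      by (simp add: inner_add_right power2_norm_eq_inner inner_commute[of x "_ v* G"] dot_lmul_matrix)
    finally show "gH / 2 * (norm x)\<^sup>2 \<le> x \<bullet> vsub np W ?A"
      using penalized_coercive[OF H_norm H_sym U gH A1 gG(1) A2 mu, of x] by simp
    have "norm (vsub np W ?A) \<le> (mu * U\<^sup>2 + U) * norm x"
      by (rule order_trans[OF norm_vsub_le norm_A_le])
    also have "\<dots> \<le> UK * norm x"
      using UK_ge(1) U by (intro mult_right_mono) auto
    finally show "norm (vsub np W ?A) \<le> UK * norm x" .
    have "x \<bullet> (y v* G) = vsub nd ?D y \<bullet> (G *v x)"
      by (simp add: y inner_commute[of x] dot_lmul_matrix)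
    then show "x \<bullet> (y v* G) = y \<bullet> vsub nd ?D (G *v x)"
      by (simp only: inner_vsub)
    have "(norm (y v* G))\<^sup>2 = y \<bullet> (G *v (y v* G))"
      by (simp add: power2_norm_eq_inner dot_lmul_matrix)
    also have "\<dots> = y \<bullet> ((G ** transpose G) *v y)"
      unfolding matrix_vector_mul_assoc[symmetric] transpose_matrix_vector ..
    finally show "gG * (norm y)\<^sup>2 \<le> (norm (y v* G))\<^sup>2"
      using A2[of y] by simp
  qed
  moreover have "Q W (Kmu z) = (vsub np W ?A + y v* G, vsub nd ?D (G *v x))"
    by (simp add: Q_def proj_def Kmu_def xy vsub_add GTy)
  ultimately show ?thesis
    by (simp add: g0_def xy)
qed

text \<open>\<open>Q W \<circ> Kmu\<close> on the range of \<open>Q W\<close>, extended by the identity on the orthogonal complement to an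
  operator on the whole space.\<close>

definition KQ :: "'v set \<Rightarrow> (real^'p) \<times> (real^'d) \<Rightarrow> (real^'p) \<times> (real^'d)" where
  "KQ W z = Q W (Kmu (Q W z)) + (z - Q W z)"

lemma linear_KQ: "linear (KQ W)"
  unfolding KQ_def
  by (intro linear_compose_add linear_compose_sub linear_compose[unfolded o_def, OF _ linear_Q]
      linear_compose[unfolded o_def, OF linear_Q linear_Kmu] linear_Q) (auto simp: linear_id[unfolded id_def])

lemma KQ_self_adjoint: "KQ W u \<bullet> v = u \<bullet> KQ W v"
  by (simp add: KQ_def inner_add_left inner_add_right inner_diff_left inner_diff_right
      Q_def inner_proj Kmu_self_adjoint)

lemma KQ_norm2: "(norm (KQ W z))\<^sup>2 = (norm (Q W (Kmu (Q W z))))\<^sup>2 + (norm (z - Q W z))\<^sup>2"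
proof -
  have "Q W (KQ W z) = Q W (Kmu (Q W z))"
    by (simp add: KQ_def linear_add[OF linear_Q] linear_diff[OF linear_Q] Q_Q)
  then show ?thesis
    using norm_proj_pythagoras[of "KQ W z" np nd W "W - W_tilde E W"]
    by (simp add: Q_def[symmetric]) (simp add: KQ_def)
qed

lemma norm2_Q: "(norm z)\<^sup>2 = (norm (Q W z))\<^sup>2 + (norm (z - Q W z))\<^sup>2"
  unfolding Q_def by (rule norm_proj_pythagoras)

lemma KQ_upper: "norm (KQ W z) \<le> UK * norm z"
proof -
  have "norm (Q W (Kmu (Q W z))) \<le> UK * norm (Q W z)"
    unfolding Q_def by (rule order_trans[OF norm_proj_le Kmu_norm])
  then have "(norm (KQ W z))\<^sup>2 \<le> (UK * norm (Q W z))\<^sup>2 + (1 * norm (z - Q W z))\<^sup>2"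
    unfolding KQ_norm2 by (intro add_mono power_mono) auto
  also have "\<dots> \<le> (UK * norm (Q W z))\<^sup>2 + (UK * norm (z - Q W z))\<^sup>2"
    using UK_ge by (intro add_left_mono power_mono mult_right_mono) auto
  also have "\<dots> = (UK * norm z)\<^sup>2"
    unfolding power_mult_distrib norm2_Q[of z W] by (simp add: algebra_simps)
  finally show ?thesis
    by (rule power2_le_imp_le) (use UK_ge in simp)
qed

lemma KQ_lower: "g0 * norm z \<le> norm (KQ W z)"
proof -
  have "(g0 * norm z)\<^sup>2 = (g0 * norm (Q W z))\<^sup>2 + (g0 * norm (z - Q W z))\<^sup>2"
    unfolding power_mult_distrib norm2_Q[of z W] by (simp add: algebra_simps)
  also have "\<dots> \<le> (norm (Q W (Kmu (Q W z))))\<^sup>2 + (1 * norm (z - Q W z))\<^sup>2"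
    using g0 by (intro add_mono power_mono mult_right_mono Kmu_lower Q_Q) auto
  also have "\<dots> = (norm (KQ W z))\<^sup>2" by (simp add: KQ_norm2)
  finally show ?thesis by (rule power2_le_imp_le) simp
qed

lemma KQ_solve: "\<exists>z. KQ W z = r \<and> norm z \<le> norm r / g0"
proof -
  have "inj (KQ W)"
  proof (subst linear_injective_0[OF linear_KQ], intro allI impI)
    fix z assume "KQ W z = 0"
    then have "g0 * norm z \<le> 0" using KQ_lower[of z W] by simp
    then show "z = 0" using g0 by (simp add: mult_le_0_iff)
  qed
  then have "surj (KQ W)"
    by (rule linear_injective_imp_surjective[OF linear_KQ]) simp
  then obtain z where "KQ W z = r" by (metis surj_def)
  moreover have "norm z \<le> norm r / g0"
    using KQ_lower[of z W] g0 \<open>KQ W z = r\<close> by (simp add: field_simps)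
  ultimately show ?thesis by blast
qed

lemma KQ_band:
  assumes "pr S S z = z"
  shows "pr (nbhd E 2 S) (nbhd E 2 S) (KQ W z) = KQ W z"
proof -
  have sub: "pr T T (Q W u) = Q W u" if "pr T T u = u" for T u
  proof -
    have "pr T T (Q W u) = Q W (pr T T u)"
      unfolding Q_def proj_proj by (simp add: Int_commute)
    then show ?thesis using that by simp
  qed
  have "pr (nbhd E 2 S) (nbhd E 2 S) z = pr (nbhd E 2 S) (nbhd E 2 S) (pr S S z)"
    using assms by simp
  also have "\<dots> = z"
    unfolding proj_proj using assms nbhd_superset[of S E 2] by (simp add: Int_absorb1)
  finally have z: "pr (nbhd E 2 S) (nbhd E 2 S) z = z" .
  show ?thesis
    unfolding KQ_def linear_add[OF linear_proj] linear_diff[OF linear_proj] z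
      sub[OF z] sub[OF Kmu_band[OF sub[OF assms]]] ..
qed

end

subsection \<open>Optimality conditions of the subproblem\<close>

lemma grad_eq_0_imp:
  fixes g :: "'a::euclidean_space \<Rightarrow> real"
  assumes "(g has_derivative g') (at x)" "grad g x = 0"
  shows "g' h = 0"
proof -
  interpret g': bounded_linear g'
    using assms(1) by (rule has_derivative_bounded_linear)
  have g: "grad g x = (\<Sum>e\<in>Basis. g' e *\<^sub>R e)"
    unfolding grad_def frechet_derivative_at[OF assms(1), symmetric] ..
  have "g' h = (\<Sum>e\<in>Basis. g' ((h \<bullet> e) *\<^sub>R e))"
    by (subst euclidean_representation[of h, symmetric]) (rule g'.sum)
  also have "\<dots> = grad g x \<bullet> h"
    unfolding g inner_sum_left by (simp add: g'.scaleR inner_commute[of h] mult.commute)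
  finally show ?thesis using assms(2) by simp
qed

lemma inner_vsub_vsub: "vsub nv S u \<bullet> vsub nv S v = vsub nv S u \<bullet> v"
  by (simp add: inner_vsub vsub_vsub)

lemma sub_obj_has_derivative:
  fixes H :: "real^'p^'p" and G :: "real^'p^'d"
  assumes "transpose H = H"
  shows "((\<lambda>u. sub_obj E np nd mu W H g cv G u + z \<bullet> sub_con E np nd W cv G u) has_derivative
    (\<lambda>h. (H *v vsub np W w) \<bullet> vsub np W h + g \<bullet> vsub np W h
       + mu * (vsub nd (W_hat E W) (cv + G *v vsub np W w) \<bullet> (G *v vsub np W h))
       + vsub nd (W - W_tilde E W) z \<bullet> (G *v vsub np W h))) (at w)"
proof -
  have lin: "bounded_linear (\<lambda>u. A *v vsub np S u)" for A :: "real^'p^'q" and S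
    by (rule linear_linear[THEN iffD2, OF linear_compose[unfolded o_def, OF linear_vsub matrix_vector_mul_linear]])
  note d = bounded_linear.has_derivative[OF lin has_derivative_ident]
  have d2: "((\<lambda>u. vsub nd S cv + vsub nd S (G *v vsub np W u)) has_derivative (\<lambda>h. vsub nd S (G *v vsub np W h))) (at w)" for S
    by (intro has_derivative_eq_rhs[OF has_derivative_add[OF has_derivative_const
        linear_imp_has_derivative[OF linear_compose[unfolded o_def, OF linear_compose[unfolded o_def, OF linear_vsub matrix_vector_mul_linear] linear_vsub]]]]) simp
  have d3: "((\<lambda>u. (vsub nd S cv + vsub nd S (G *v vsub np W u)) \<bullet> (vsub nd S cv + vsub nd S (G *v vsub np W u)))
     has_derivative (\<lambda>h. 2 * (vsub nd S (cv + G *v vsub np W w) \<bullet> (G *v vsub np W h)))) (at w)" for S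
    by (rule has_derivative_eq_rhs[OF has_derivative_inner[OF d2 d2]])
      (simp only: fun_eq_iff vsub_add[symmetric] inner_commute[of "vsub nd S (G *v vsub np W _)"] inner_vsub_vsub, simp add: inner_vsub)
  have d4: "((\<lambda>u. vsub np W u \<bullet> (H *v vsub np W u)) has_derivative (\<lambda>h. 2 * ((H *v vsub np W w) \<bullet> vsub np W h))) (at w)"
  proof (rule has_derivative_eq_rhs[OF has_derivative_inner[OF linear_imp_has_derivative[OF linear_vsub] d]])
    have "vsub np W w \<bullet> (H *v vsub np W h) + vsub np W h \<bullet> (H *v vsub np W w) = 2 * ((H *v vsub np W w) \<bullet> vsub np W h)" for h
      unfolding inner_symmetric_mult[OF assms, of "vsub np W w", symmetric] inner_commute[of "vsub np W h"] by simp
    then show "(\<lambda>h. vsub np W w \<bullet> (H *v vsub np W h) + vsub np W h \<bullet> (H *v vsub np W w)) =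
        (\<lambda>h. 2 * ((H *v vsub np W w) \<bullet> vsub np W h))" by simp
  qed
  have eq: "sub_obj E np nd mu W H g cv G u + z \<bullet> sub_con E np nd W cv G u =
      1 / 2 * (vsub np W u \<bullet> (H *v vsub np W u)) + vsub np W u \<bullet> g
      + mu / 2 * ((vsub nd (W_hat E W) cv + vsub nd (W_hat E W) (G *v vsub np W u)) \<bullet> (vsub nd (W_hat E W) cv + vsub nd (W_hat E W) (G *v vsub np W u)))
      + z \<bullet> (vsub nd (W - W_tilde E W) cv + vsub nd (W - W_tilde E W) (G *v vsub np W u))" for u
    by (simp only: sub_obj_def sub_con_def msub_mult inner_vsub[symmetric] power2_norm_eq_inner)
  show ?thesis
    unfolding eq
    by (rule has_derivative_eq_rhs[OF has_derivative_add[OF has_derivative_add[OF has_derivative_add[OF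
        has_derivative_mult_right[OF d4] has_derivative_inner_left[OF linear_imp_has_derivative[OF linear_vsub]]]
        has_derivative_mult_right[OF d3]] has_derivative_inner_right[OF d2]]])
      (auto simp: fun_eq_iff inner_commute[of g] inner_vsub)
qed

context penalized_kkt
begin

text \<open>The penalty covers only \<open>W_hat E W\<close>, but variables on \<open>W\<close> act
  on constraints in \<open>nbhd E 1 W\<close> only, and on the remaining nodes
  \<open>W - W_tilde E W\<close> the linearised constraints hold exactly. Hence the gradient of the
  penalty on \<open>W\<close> is that of the full penalty, and the optimality system is the
  restriction of \<open>Kmu\<close>.\<close>

lemma sub_pd_solution_kkt:
  assumes sol: "sub_pd_solution E np nd mu W H g cv G w z"
  shows "Q W (w, z) = (w, z)" and "Q W (Kmu (w, z)) = - Q W (g + mu *\<^sub>R (cv v* G), cv)"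
proof -
  let ?D = "W - W_tilde E W"
  have w: "vsub np W w = w" and z: "vsub nd ?D z = z"
    and feas: "vsub nd ?D (cv + G *v w) = 0"
    using sol by (auto simp: sub_pd_solution_def sub_con_def msub_mult vsub_add)
  show "Q W (w, z) = (w, z)"
    using w z by (simp add: Q_def proj_def)
  have stat: "(H *v w) \<bullet> vsub np W h + g \<bullet> vsub np W h
       + mu * (vsub nd (W_hat E W) (cv + G *v w) \<bullet> (G *v vsub np W h)) + z \<bullet> (G *v vsub np W h) = 0" for h
    using grad_eq_0_imp[OF sub_obj_has_derivative[OF H_sym], of E np nd mu W g cv G z w h] sol
    unfolding sub_pd_solution_def by (simp add: w z)
  let ?r = "H *v w + g + mu *\<^sub>R ((cv + G *v w) v* G) + z v* G"
  have "?r \<bullet> vsub np W h = 0" for h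
  proof -
    let ?c = "cv + G *v w"
    have G1: "vsub nd (nbhd E 1 W) (G *v vsub np W h) = G *v vsub np W h"
      by (rule band_mult[OF G_band], assumption) (simp only: vsub_vsub Int_absorb)
    have "nbhd E 1 W = W_hat E W \<union> ?D"
      using nbhd_superset[of W E 1] W_tilde_subset[of E W] unfolding W_hat_def nbhd_open_def[of E W] by blast
    then have N: "vsub nd (nbhd E 1 W) ?c = vsub nd (W_hat E W) ?c"
      using feas unfolding vec_eq_iff vsub_nth by (metis UnE UnI1 zero_index)
    have "?c \<bullet> (G *v vsub np W h) = vsub nd (W_hat E W) ?c \<bullet> (G *v vsub np W h)"
      unfolding N[symmetric] inner_vsub G1 ..
    then show ?thesis
      using stat[of h] by (simp add: inner_add_left dot_lmul_matrix)
  qed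
  then have "vsub np W ?r \<bullet> vsub np W ?r = 0"
    by (simp only: inner_vsub vsub_vsub Int_absorb)
  then have "vsub np W ?r = 0" by simp
  then have 1: "vsub np W (H *v w + mu *\<^sub>R ((G *v w) v* G) + z v* G) = - vsub np W (g + mu *\<^sub>R (cv v* G))"
    by (simp add: linear_add[OF linear_vector_matrix_mult] scaleR_add_right vsub_add add_eq_0_iff algebra_simps)
  have 2: "vsub nd ?D (G *v w) = - vsub nd ?D cv"
    using feas by (simp add: vsub_add add_eq_0_iff)
  show "Q W (Kmu (w, z)) = - Q W (g + mu *\<^sub>R (cv v* G), cv)"
    using 1 2 by (simp add: Q_def proj_def Kmu_def)
qed

subsection \<open>Error of the subproblem solution\<close>

text \<open>What the restriction of \<open>e\<close> misses is supported off \<open>W\<close> in the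
  primal and off \<open>W - W_tilde E W\<close> in the dual, so it is felt only in a layer of width
  two inside \<open>W\<close>. That the norm bound sees \<open>e\<close> on
  \<open>nbhd E 2 W\<close> only is what later lets the block errors be summed with bounded
  multiplicity.\<close>

lemma boundary_term:
  fixes e :: "(real^'p) \<times> (real^'d)" and W :: "'v set"
  defines "r \<equiv> Q W (Kmu (e - Q W e))"
  shows "pr (W \<inter> nbhd E 2 (- W)) (W \<inter> nbhd E 2 (- W)) r = r"
    and "norm r \<le> UK * norm (pr (nbhd E 2 W) (nbhd E 2 W) e)"
proof -
  let ?D = "W - W_tilde E W"
  let ?N = "nbhd E 2 (- W)"
  let ?e = "e - Q W e"
  have x: "vsub np (- W) (fst ?e) = fst ?e"
    unfolding vsub_eq_self by (simp add: Q_def proj_def)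
  have "- ?D \<subseteq> nbhd E 1 (- W)"
    using nbhd_superset[of "- W" E 1] W_tilde_subset[of E W] by blast
  then have y: "vsub nd (nbhd E 1 (- W)) (snd ?e) = snd ?e"
    unfolding vsub_eq_self by (auto simp: Q_def proj_def)
  have N: "pr ?N ?N (Kmu ?e) = Kmu ?e"
    by (rule Kmu_band'[OF x y])
  have r: "r = pr W ?D (pr ?N ?N (Kmu ?e))"
    unfolding r_def N by (simp add: Q_def)
  show "pr (W \<inter> ?N) (W \<inter> ?N) r = r"
    unfolding r proj_proj by (intro arg_cong2[of _ _ _ _ "\<lambda>S T. pr S T _"]) auto
  let ?M = "nbhd E 2 W"
  \<comment> \<open>The part of the error beyond \<open>nbhd E 2 W\<close> is mapped outside
    \<open>W\<close> and drops out.\<close>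
  let ?y = "?e - pr ?M ?M ?e" and ?S = "nbhd E 2 (- ?M)"
  have "W \<inter> ?S = {}"
    by (rule nbhd_avoid[OF sym_E order_refl order_refl])
  then have disj: "W \<inter> ?S = {}" "?D \<inter> ?S = {}" by blast+
  have "pr (- ?M) (- ?M) ?y = ?y"
    by (simp add: proj_def prod_eq_iff vsub_eq_self)
  then have "pr ?S ?S (Kmu ?y) = Kmu ?y"
    by (rule Kmu_band)
  then have "Q W (Kmu ?y) = pr W ?D (pr ?S ?S (Kmu ?y))"
    by (simp add: Q_def)
  also have "\<dots> = 0"
    unfolding proj_proj disj by (simp add: proj_def vsub_eq_0 zero_prod_def)
  finally have "Q W (Kmu ?y) = 0" .
  then have "r = Q W (Kmu (pr ?M ?M ?e))"
    unfolding r_def by (simp add: linear_diff[OF linear_Kmu] linear_diff[OF linear_Q])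
  then have "norm r \<le> UK * norm (pr ?M ?M ?e)"
    unfolding Q_def by (simp only:) (rule order_trans[OF norm_proj_le Kmu_norm])
  also have "norm (pr ?M ?M ?e) \<le> norm (pr ?M ?M e)"
  proof -
    \<comment> \<open>The two coordinate projections commute, so removing \<open>Q W\<close> after
      cutting to \<open>?M\<close> can only shorten the vector.\<close>
    have "(norm (pr ?M ?M e))\<^sup>2 = (norm (Q W (pr ?M ?M e)))\<^sup>2 + (norm (pr ?M ?M ?e))\<^sup>2"
      unfolding norm2_Q[of "pr ?M ?M e" W] Q_def proj_minus_commute ..
    then have "(norm (pr ?M ?M ?e))\<^sup>2 \<le> (norm (pr ?M ?M e))\<^sup>2"
      by simp
    then show ?thesis
      by (rule power2_le_imp_le) simp
  qed
  finally show "norm r \<le> UK * norm (pr ?M ?M e)"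
    using UK_ge by simp
qed

text \<open>With the right-hand side in the layer along the boundary, the Richardson iterate after
  \<open>b div 4\<close> steps still vanishes on \<open>V\<close>; there the solution coincides with
  the iteration error.\<close>

lemma decay_from_boundary:
  assumes V: "nbhd E b V \<subseteq> W" and r: "pr (W \<inter> nbhd E 2 (- W)) (W \<inter> nbhd E 2 (- W)) (KQ W x) = KQ W x"
  shows "norm (pr V V x) \<le> sqrt (1 - (g0 / UK)\<^sup>2) ^ (b div 4) * norm x"
proof (cases "b div 4 = 0")
  case True
  then show ?thesis by (simp add: norm_proj_le)
next
  case False
  define R where "R = W \<inter> nbhd E 2 (- W)"
  define S where "S j = {z. pr (nbhd E j R) (nbhd E j R) z = z}" for j
  have sub: "subspace (S j)" for j
    unfolding S_def subspace_def
    by (auto simp: linear_add[OF linear_proj] linear_cmul[OF linear_proj] linear_0[OF linear_proj])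
  have mono: "S i \<subseteq> S j" if "i \<le> j" for i j
  proof
    fix z assume "z \<in> S i"
    then have z: "pr (nbhd E i R) (nbhd E i R) z = z" by (simp add: S_def)
    have "nbhd E j R \<inter> nbhd E i R = nbhd E i R"
      using nbhd_mono[OF that, of R R] by blast
    then have "pr (nbhd E j R) (nbhd E j R) (pr (nbhd E i R) (nbhd E i R) z) = pr (nbhd E i R) (nbhd E i R) z"
      by (simp only: proj_proj)
    then show "z \<in> S j"
      by (simp add: S_def z)
  qed
  have band: "KQ W u \<in> S (j + 2)" if "u \<in> S j" for u j
  proof -
    have "nbhd E (j + 2) R = nbhd E 2 (nbhd E j R)"
      using nbhd_add_eq[of E 2 j R] by (simp add: add.commute)
    then show ?thesis
      using that KQ_band unfolding S_def by simp
  qed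
  have KQx: "KQ W x \<in> S 0"
  proof -
    have "nbhd E 0 R = R"
      using nbhd_superset[of R E 0] by (auto simp: nbhd_iff)
    then show ?thesis using r by (simp add: S_def R_def)
  qed
  have "0 \<le> g0" "0 < UK" "g0 \<le> UK"
    using g0 UK_ge by auto
  from richardson_decay[OF linear_KQ KQ_self_adjoint KQ_upper KQ_lower this sub mono band KQx, of "b div 4"]
  obtain u where u: "u \<in> S (4 * (b div 4) - 2)"
      "norm (x - u) \<le> sqrt (1 - (g0 / UK)\<^sup>2) ^ (b div 4) * norm x"
    by blast
  \<comment> \<open>The \<open>- 2\<close> in the support radius of the iterate pays for the width
    two of the layer, so that \<open>4 * (b div 4) \<le> b\<close> edges suffice.\<close>
  have "V \<inter> nbhd E (4 * (b div 4) - 2) R = {}"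
  proof -
    have "nbhd E (4 * (b div 4) - 2) R \<subseteq> nbhd E (4 * (b div 4) - 2) (nbhd E 2 (- W))"
      by (rule nbhd_mono) (auto simp: R_def)
    also have "\<dots> = nbhd E (4 * (b div 4)) (- W)"
    proof -
      have "4 * (b div 4) - 2 + 2 = 4 * (b div 4)" using False by linarith
      then show ?thesis using nbhd_add_eq[of E "4 * (b div 4) - 2" 2 "- W"] by (simp only:)
    qed
    finally show ?thesis
      using nbhd_avoid[OF sym_E V, of "4 * (b div 4)"] by force
  qed
  moreover have "pr V V u = pr V V (pr (nbhd E (4 * (b div 4) - 2) R) (nbhd E (4 * (b div 4) - 2) R) u)"
    using u(1) by (simp add: S_def)
  ultimately have "pr V V u = 0"
    unfolding proj_proj by (simp add: proj_def vsub_eq_0 zero_prod_def)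
  then have "pr V V x = pr V V (x - u)"
    by (simp add: linear_diff[OF linear_proj])
  then show ?thesis
    using norm_proj_le[of np nd V V "x - u"] u(2) by simp
qed

text \<open>\<open>(w, z) + Q W e\<close> solves the restricted system with two right-hand sides:
  the boundary term, whose effect decays on the way to \<open>V\<close>, and the residual of
  \<open>- e\<close> as a Newton step, which does not decay but is small in the application. By
  linearity the two are estimated separately; \<open>a\<close> is the solution for the boundary
  term.\<close>

lemma subproblem_error:
  assumes sol: "sub_pd_solution E np nd mu W H g cv G w z"
    and V: "nbhd E b V \<subseteq> W" and b: "1 \<le> b"
  shows "norm (pr V V ((w, z) + e))
    \<le> sqrt (1 - (g0 / UK)\<^sup>2) ^ (b div 4) * (UK / g0) * norm (pr (nbhd E 2 W) (nbhd E 2 W) e)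
      + (1 + mu * U) / g0 * norm (g - (H *v fst e + snd e v* G), cv - G *v fst e)"
proof -
  let ?D = "W - W_tilde E W"
  define q where "q = sqrt (1 - (g0 / UK)\<^sup>2) ^ (b div 4)"
  define s where "s = (g - (H *v fst e + snd e v* G), cv - G *v fst e)"
  define s' where "s' = (fst s + mu *\<^sub>R (snd s v* G), snd s)"
  define x where "x = (w, z) + Q W e"
  have q0: "0 \<le> q"
    using g0 UK_ge unfolding q_def by (intro zero_le_power real_sqrt_ge_zero) (simp add: power_le_one)
  have Qx: "Q W x = x"
    by (simp add: x_def linear_add[OF linear_Q] Q_Q sub_pd_solution_kkt(1)[OF sol])
  \<comment> \<open>The subproblem data are \<open>Kmu e\<close> up to the residual; its constraint
    part enters the first row a second time through the penalty.\<close>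
  have rhs: "(g + mu *\<^sub>R (cv v* G), cv) = Kmu e + s'"
    by (simp add: Kmu_def s'_def s_def prod_eq_iff linear_diff[OF linear_vector_matrix_mult] algebra_simps)
  have "KQ W x = Q W (Kmu x)"
    by (simp add: KQ_def Qx)
  also have "\<dots> = - Q W (Kmu (e - Q W e)) - Q W s'"
    unfolding x_def linear_add[OF linear_Kmu] linear_add[OF linear_Q] sub_pd_solution_kkt(2)[OF sol] rhs
    by (simp add: linear_diff[OF linear_Kmu] linear_diff[OF linear_Q])
  finally have KQx: "KQ W x = - Q W (Kmu (e - Q W e)) - Q W s'" .
  obtain a where a: "KQ W a = - Q W (Kmu (e - Q W e))" "norm a \<le> norm (Q W (Kmu (e - Q W e))) / g0"
    using KQ_solve[of W "- Q W (Kmu (e - Q W e))"] by auto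
  have xa: "g0 * norm (x - a) \<le> norm s'"
  proof -
    have "KQ W (x - a) = - Q W s'"
      by (simp add: linear_diff[OF linear_KQ] KQx a(1))
    then have "norm (KQ W (x - a)) \<le> norm s'"
      unfolding Q_def by (simp add: norm_proj_le)
    with KQ_lower[of "x - a" W] show ?thesis by simp
  qed
  have s': "norm s' \<le> (1 + mu * U) * norm s"
  proof -
    have "s' = s + (mu *\<^sub>R (snd s v* G), 0)"
      by (simp add: s'_def prod_eq_iff)
    then have "norm s' \<le> norm s + mu * norm (snd s v* G)"
      using norm_triangle_ineq[of s "(mu *\<^sub>R (snd s v* G), 0)"] mu_ge_4 by (simp add: norm_Pair_0)
    moreover have "mu * norm (snd s v* G) \<le> mu * (U * norm s)"
    proof -
      have "norm (snd s) \<le> norm s" by (metis norm_snd_le prod.collapse)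
      then have "U * norm (snd s) \<le> U * norm s" using U by (intro mult_left_mono) auto
      then show ?thesis using GT_norm[of "snd s"] mu_ge_4 by (intro mult_left_mono) auto
    qed
    ultimately show ?thesis by (simp add: algebra_simps)
  qed
  have "norm (pr V V a) \<le> q * norm a"
    unfolding q_def
  proof (rule decay_from_boundary[OF V])
    show "pr (W \<inter> nbhd E 2 (- W)) (W \<inter> nbhd E 2 (- W)) (KQ W a) = KQ W a"
      unfolding a(1) linear_neg[OF linear_proj] boundary_term(1) ..
  qed
  also have "\<dots> \<le> q * (UK * norm (pr (nbhd E 2 W) (nbhd E 2 W) e) / g0)"
  proof (rule mult_left_mono[OF _ q0])
    show "norm a \<le> UK * norm (pr (nbhd E 2 W) (nbhd E 2 W) e) / g0"
      by (rule order_trans[OF a(2) divide_right_mono[OF boundary_term(2)]]) (use g0 in simp)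
  qed
  finally have 1: "norm (pr V V a) \<le> q * (UK / g0) * norm (pr (nbhd E 2 W) (nbhd E 2 W) e)"
    by (simp add: mult.assoc)
  have "norm (pr V V (x - a)) \<le> norm s' / g0"
    using order_trans[OF norm_proj_le[of np nd V V "x - a"], of "norm s' / g0"] xa g0 by (simp add: field_simps)
  also have "\<dots> \<le> (1 + mu * U) / g0 * norm s"
    using s' g0 by (simp add: field_simps)
  finally have 2: "norm (pr V V (x - a)) \<le> (1 + mu * U) / g0 * norm s" .
  \<comment> \<open>\<open>1 \<le> b\<close> keeps \<open>V\<close> off \<open>W_tilde E W\<close>,
    so the multipliers on \<open>V\<close> are among those of the subproblem.\<close>
  have "V \<subseteq> W" "V \<subseteq> ?D"
    using V nbhd_superset[of V E b] nbhd_avoid[OF sym_E V b] W_tilde_subset[of E W] by blast+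
  then have "pr V V ((w, z) + e) = pr V V x"
    unfolding x_def Q_def linear_add[OF linear_proj] proj_proj by (simp add: Int_absorb2)
  also have "\<dots> = pr V V a + pr V V (x - a)"
    by (simp add: linear_diff[OF linear_proj])
  finally have "norm (pr V V ((w, z) + e)) \<le> norm (pr V V a) + norm (pr V V (x - a))"
    by (simp add: norm_triangle_ineq)
  with 1 2 show ?thesis
    unfolding q_def s_def by linarith
qed

end

lemma norm2_vsub_nodes:
  fixes nv :: "'n::finite \<Rightarrow> 'v::finite"
  shows "(norm (vsub nv S v))\<^sup>2 = (\<Sum>i\<in>S. (norm (vsub nv {i} v))\<^sup>2)"
  using sum_norm_vsub[of S "\<lambda>i. {i}" nv v] by (simp add: disjoint_family_on_def)

section \<open>The decay rate per edge\<close>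

context penalized_kkt
begin

definition gK :: real where "gK = gH ^ 3 * gG\<^sup>2 / (75 * UK ^ 6)"

definition rho :: real where "rho = ((UK\<^sup>2 - gK\<^sup>2) / (UK\<^sup>2 + gK\<^sup>2)) powr (1 / 4)"

lemma gK: "0 < gK" "2 * gK \<le> g0" "gK < 1"
proof -
  show "0 < gK" using gH gG UK_ge by (simp add: gK_def)
  have "gH ^ 3 \<le> gH ^ 1" using gH by (intro power_decreasing) auto
  moreover have "UK ^ 2 \<le> UK ^ 6" using UK_ge by (intro power_increasing) auto
  ultimately have "gH ^ 3 * gG\<^sup>2 / (75 * UK ^ 6) \<le> gH * gG\<^sup>2 / (75 * UK\<^sup>2)"
    using gH UK_ge by (intro frac_le mult_right_mono) auto
  then have "gK \<le> g0 / 5"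
    by (simp add: gK_def g0_def)
  then show "2 * gK \<le> g0" "gK < 1" using g0 by auto
qed

lemma rho: "0 < rho" "rho < 1" "rho ^ 4 = (UK\<^sup>2 - gK\<^sup>2) / (UK\<^sup>2 + gK\<^sup>2)"
proof -
  have "gK\<^sup>2 < UK\<^sup>2" using gK UK_ge by (intro power_strict_mono) auto
  moreover have "0 < (a - c) / (a + c) \<and> (a - c) / (a + c) < 1" if "0 < c" "c < a" for a c :: real
    using that by (simp add: field_simps)
  moreover define R where "R = (UK\<^sup>2 - gK\<^sup>2) / (UK\<^sup>2 + gK\<^sup>2)"
  ultimately have r: "0 < R" "R < 1"
    using zero_less_power[OF gK(1), of 2] by blast+
  have rho_R: "rho = R powr (1 / 4)"
    by (simp add: rho_def R_def)
  then show "0 < rho" using r(1) by simp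
  have r4: "rho ^ 4 = R"
    unfolding rho_R using r(1) by (simp add: powr_power)
  then show "rho ^ 4 = (UK\<^sup>2 - gK\<^sup>2) / (UK\<^sup>2 + gK\<^sup>2)"
    by (simp add: R_def)
  show "rho < 1"
  proof (rule ccontr)
    assume "\<not> rho < 1"
    then have "1 \<le> rho ^ 4" by simp
    with r r4 show False by simp
  qed
qed

text \<open>One Richardson step covers four edges, hence the fourth power. With \<open>t\<close> as
  below, \<open>rho ^ 4 = (1 - t) / (1 + t)\<close>, and the square of this is at least
  \<open>1 - 4 * t\<close>, while \<open>2 * gK \<le> g0\<close> gives
  \<open>4 * t \<le> (g0 / UK)\<^sup>2\<close>.\<close>

lemma contraction_le: "sqrt (1 - (g0 / UK)\<^sup>2) \<le> rho ^ 4"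
proof -
  define t where "t = (gK / UK)\<^sup>2"
  have t: "0 \<le> t" "t \<le> 1" using gK UK_ge by (auto simp: t_def power_le_one)
  have "rho ^ 4 = (1 - t) / (1 + t)"
  proof -
    have "UK \<noteq> 0" using UK_ge by simp
    then have "UK\<^sup>2 - gK\<^sup>2 = UK\<^sup>2 * (1 - t)" "UK\<^sup>2 + gK\<^sup>2 = UK\<^sup>2 * (1 + t)"
      by (simp_all add: t_def power_divide distrib_left right_diff_distrib)
    then show ?thesis unfolding rho(3) using \<open>UK \<noteq> 0\<close> by simp
  qed
  moreover have "1 - 4 * t \<le> ((1 - t) / (1 + t))\<^sup>2"
  proof -
    have "(1 - t)\<^sup>2 - (1 - 4 * t) * (1 + t)\<^sup>2 = 8 * t\<^sup>2 + 4 * t ^ 3"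
      by (simp add: power2_eq_square power3_eq_cube algebra_simps)
    also have "\<dots> \<ge> 0" using t by simp
    finally have "(1 - 4 * t) * (1 + t)\<^sup>2 \<le> (1 - t)\<^sup>2" by simp
    then show ?thesis using t by (simp add: power_divide le_divide_eq)
  qed
  moreover have "4 * t \<le> (g0 / UK)\<^sup>2"
  proof -
    have "(2 * gK / UK)\<^sup>2 \<le> (g0 / UK)\<^sup>2"
      using gK UK_ge by (intro power_mono divide_right_mono) auto
    then show ?thesis by (simp add: t_def power_divide power_mult_distrib)
  qed
  ultimately have "1 - (g0 / UK)\<^sup>2 \<le> (rho ^ 4)\<^sup>2" by simp
  then show ?thesis using rho(1,2) by (intro real_le_lsqrt) auto
qed

text \<open>The factor \<open>rho ^ 3\<close> accounts for rounding \<open>b\<close> down to a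
  multiple of four, and \<open>2 * gK\<close> replaces the sharper bound \<open>g0\<close>.\<close>

definition kappa :: real where "kappa = UK / (2 * gK * rho ^ 3)"

lemma kappa_pos: "0 < kappa"
  using UK_ge gK rho(1,2) by (simp add: kappa_def)

lemma decay_le: "sqrt (1 - (g0 / UK)\<^sup>2) ^ (b div 4) * (UK / g0) \<le> kappa * rho ^ b"
proof -
  have "(g0 / UK)\<^sup>2 \<le> 1"
    using g0 UK_ge by (intro power_le_one) auto
  then have "sqrt (1 - (g0 / UK)\<^sup>2) ^ (b div 4) \<le> (rho ^ 4) ^ (b div 4)"
    by (intro power_mono contraction_le) simp
  also have "\<dots> = rho ^ (4 * (b div 4) + 3) / rho ^ 3"
    using rho(1) unfolding power_mult[symmetric] power_add by simp
  also have "\<dots> \<le> rho ^ b / rho ^ 3"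
    using rho(1,2) by (intro divide_right_mono power_decreasing) auto
  finally have 1: "sqrt (1 - (g0 / UK)\<^sup>2) ^ (b div 4) \<le> rho ^ b / rho ^ 3" .
  have 2: "UK / g0 \<le> UK / (2 * gK)"
    using gK UK_ge by (intro divide_left_mono) auto
  have "sqrt (1 - (g0 / UK)\<^sup>2) ^ (b div 4) * (UK / g0) \<le> (rho ^ b / rho ^ 3) * (UK / (2 * gK))"
    using rho(1,2) g0 UK_ge by (intro mult_mono 1 2) auto
  then show ?thesis by (simp add: kappa_def field_simps)
qed

subsection \<open>Error of the search direction\<close>

lemma norm2_pr_nodes: "(norm (pr S S e))\<^sup>2 = (\<Sum>i\<in>S. (node_norm np nd i e)\<^sup>2)"
  by (simp add: proj_def node_norm_def norm_Pair sum.distrib norm2_vsub_nodes[of _ S] sum_nonneg)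

lemma norm_pr_le_Max:
  assumes "\<And>i. node_norm np nd i e \<le> P" "real (card S) \<le> m"
  shows "norm (pr S S e) \<le> sqrt m * P"
proof -
  have P: "0 \<le> P"
    using assms(1)[of undefined] unfolding node_norm_def by (rule order_trans[rotated]) simp
  have "(norm (pr S S e))\<^sup>2 \<le> (\<Sum>i\<in>S. P\<^sup>2)"
    unfolding norm2_pr_nodes by (intro sum_mono power_mono assms) (simp add: node_norm_def)
  also have "\<dots> = real (card S) * P\<^sup>2" by simp
  also have "\<dots> \<le> m * P\<^sup>2" using assms(2) by (rule mult_right_mono) simp
  finally have "norm (pr S S e) \<le> sqrt (m * P\<^sup>2)" by (rule real_le_rsqrt)
  then show ?thesis using P by (simp add: real_sqrt_mult)
qed

text \<open>\<open>m\<close> has two roles: the size of an extended set, for the nodewise estimate,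
  and the number of extended sets through a node, for the Euclidean one. Indices with
  \<open>V k = {}\<close> are left out, since the partition may repeat the empty set and such
  indices own no node by which they could be counted.\<close>

context
  fixes M b :: nat and V W :: "nat \<Rightarrow> 'v set" and m :: real
    and g dx :: "real^'p" and cv dl :: "real^'d" and w :: "nat \<Rightarrow> real^'p" and z :: "nat \<Rightarrow> real^'d"
  assumes partition: "disjoint_family_on V {1..M}" "(\<Union>k\<in>{1..M}. V k) = UNIV"
    and overlap: "1 \<le> b" "\<And>k. k \<in> {1..M} \<Longrightarrow> nbhd E b (V k) \<subseteq> W k"
    and sol: "\<And>k. k \<in> {1..M} \<Longrightarrow> sub_pd_solution E np nd mu (W k) H g cv G (w k) (z k)"
    and dx: "\<And>k p. k \<in> {1..M} \<Longrightarrow> np p \<in> V k \<Longrightarrow> dx $ p = w k $ p"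
    and dl: "\<And>k q. k \<in> {1..M} \<Longrightarrow> nd q \<in> V k \<Longrightarrow> dl $ q = z k $ q"
    and card_W: "\<And>k. k \<in> {1..M} \<Longrightarrow> V k \<noteq> {} \<Longrightarrow> real (card (nbhd E 2 (W k))) \<le> m"
    and multiplicity: "\<And>i. real (card {k \<in> {1..M}. V k \<noteq> {} \<and> i \<in> nbhd E 2 (W k)}) \<le> m"
begin

abbreviation residual :: "(real^'p) \<times> (real^'d) \<Rightarrow> real" where
  "residual e \<equiv> norm (g - (H *v fst e + snd e v* G), cv - G *v fst e)"

lemma block_error:
  assumes k: "k \<in> {1..M}"
  shows "norm (pr (V k) (V k) ((dx, dl) + e))
    \<le> kappa * rho ^ b * norm (pr (nbhd E 2 (W k)) (nbhd E 2 (W k)) e) + (1 + mu * U) / g0 * residual e"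
proof -
  have "pr (V k) (V k) ((dx, dl) + e) = pr (V k) (V k) ((w k, z k) + e)"
    using dx[OF k] dl[OF k] by (auto simp: proj_def vec_eq_iff)
  then have "norm (pr (V k) (V k) ((dx, dl) + e))
    \<le> sqrt (1 - (g0 / UK)\<^sup>2) ^ (b div 4) * (UK / g0) * norm (pr (nbhd E 2 (W k)) (nbhd E 2 (W k)) e)
      + (1 + mu * U) / g0 * residual e"
    using subproblem_error[OF sol[OF k] overlap(2)[OF k] overlap(1), of e] by simp
  also have "\<dots> \<le> kappa * rho ^ b * norm (pr (nbhd E 2 (W k)) (nbhd E 2 (W k)) e) + (1 + mu * U) / g0 * residual e"
    by (intro add_right_mono mult_right_mono decay_le) simp
  finally show ?thesis .
qed

lemma direction_error_node:
  assumes "\<And>i. node_norm np nd i e \<le> P"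
  shows "node_norm np nd i ((dx, dl) + e) \<le> kappa * sqrt m * rho ^ b * P + (1 + mu * U) / g0 * residual e"
proof -
  obtain k where k: "k \<in> {1..M}" "i \<in> V k"
    using partition(2) by blast
  have "(node_norm np nd i ((dx, dl) + e))\<^sup>2 \<le> (norm (pr (V k) (V k) ((dx, dl) + e)))\<^sup>2"
    unfolding norm2_pr_nodes by (rule member_le_sum) (use k in auto)
  then have "node_norm np nd i ((dx, dl) + e) \<le> norm (pr (V k) (V k) ((dx, dl) + e))"
    by (rule power2_le_imp_le) simp
  also note block_error[OF k(1)]
  also have "kappa * rho ^ b * norm (pr (nbhd E 2 (W k)) (nbhd E 2 (W k)) e) \<le> kappa * rho ^ b * (sqrt m * P)"
    using kappa_pos rho(1,2) k by (intro mult_left_mono norm_pr_le_Max assms card_W) auto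
  finally show ?thesis by (simp add: mult_ac)
qed

text \<open>Minkowski's inequality over the nonempty blocks separates decay and residual. The decay
  part is summed by multiplicity. The residual is charged in full to every block and costs
  \<open>sqrt (real M)\<close>, harmless because in the application it is of smaller order than
  \<open>e\<close>.\<close>

lemma direction_error_norm:
  "norm ((dx, dl) + e) \<le> kappa * sqrt m * rho ^ b * norm e + sqrt (real M) * ((1 + mu * U) / g0) * residual e"
proof -
  define K where "K = {k \<in> {1..M}. V k \<noteq> {}}"
  have finK: "finite K"
    by (simp add: K_def)
  have "K \<subseteq> {1..M}"
    by (auto simp: K_def)
  from card_mono[OF finite_atLeastAtMost this] have KM: "card K \<le> M"
    by simp
  define A where "A k = kappa * rho ^ b * norm (pr (nbhd E 2 (W k)) (nbhd E 2 (W k)) e)" for k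
  define B where "B = (1 + mu * U) / g0 * residual e"
  have AB: "0 \<le> A k" "0 \<le> B" for k
    using kappa_pos rho(1,2) mu_ge_4 U g0 by (auto simp: A_def B_def)
  have "(\<Union>k\<in>K. V k) = (\<Union>k\<in>{1..M}. V k)"
    by (auto simp: K_def)
  then have UK: "(\<Union>k\<in>K. V k) = UNIV"
    using partition(2) by simp
  have "disjoint_family_on V K"
    using disjoint_family_on_mono[OF \<open>K \<subseteq> {1..M}\<close> partition(1)] .
  note part = sum_norm_vsub[OF finK this, unfolded UK vsub_UNIV]
  have "(norm ((dx, dl) + e))\<^sup>2 = (\<Sum>k\<in>K. (norm (pr (V k) (V k) ((dx, dl) + e)))\<^sup>2)"
    by (simp add: proj_def norm_prod_def sum.distrib part)
  also have "\<dots> \<le> (\<Sum>k\<in>K. (A k + B)\<^sup>2)"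
    using block_error unfolding A_def B_def K_def by (intro sum_mono power_mono) auto
  finally have "norm ((dx, dl) + e) \<le> L2_set (\<lambda>k. A k + B) K"
    unfolding L2_set_def by (rule real_le_rsqrt)
  also have "\<dots> \<le> L2_set A K + L2_set (\<lambda>k. B) K"
    by (rule L2_set_triangle_ineq)
  also have "L2_set (\<lambda>k. B) K \<le> sqrt (real M) * B"
    unfolding L2_set_def using AB KM by (simp add: real_sqrt_mult mult_right_mono)
  also have "L2_set A K \<le> kappa * sqrt m * rho ^ b * norm e"
  proof -
    have "(\<Sum>k\<in>K. (norm (pr (nbhd E 2 (W k)) (nbhd E 2 (W k)) e))\<^sup>2)
        = (\<Sum>k\<in>K. \<Sum>i\<in>UNIV. if i \<in> nbhd E 2 (W k) then (node_norm np nd i e)\<^sup>2 else 0)"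
      unfolding norm2_pr_nodes by (simp add: sum.If_cases)
    also have "\<dots> = (\<Sum>i\<in>UNIV. real (card {k \<in> K. i \<in> nbhd E 2 (W k)}) * (node_norm np nd i e)\<^sup>2)"
      by (subst sum.swap) (simp add: sum.If_cases finK Int_def)
    also have "\<dots> \<le> (\<Sum>i\<in>UNIV. m * (node_norm np nd i e)\<^sup>2)"
    proof (intro sum_mono mult_right_mono)
      fix i
      have "{k \<in> K. i \<in> nbhd E 2 (W k)} = {k \<in> {1..M}. V k \<noteq> {} \<and> i \<in> nbhd E 2 (W k)}"
        by (auto simp: K_def)
      then show "real (card {k \<in> K. i \<in> nbhd E 2 (W k)}) \<le> m"
        using multiplicity[of i] by simp
    qed simp
    also have "\<dots> = m * (norm e)\<^sup>2"
      using norm2_pr_nodes[of UNIV e] by (simp add: sum_distrib_left[symmetric] proj_def)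
    finally have "(\<Sum>k\<in>K. (norm (pr (nbhd E 2 (W k)) (nbhd E 2 (W k)) e))\<^sup>2) \<le> m * (norm e)\<^sup>2" .
    then have "L2_set (\<lambda>k. norm (pr (nbhd E 2 (W k)) (nbhd E 2 (W k)) e)) K \<le> sqrt m * norm e"
      unfolding L2_set_def using real_sqrt_le_mono by (fastforce simp: real_sqrt_mult)
    then have "kappa * rho ^ b * L2_set (\<lambda>k. norm (pr (nbhd E 2 (W k)) (nbhd E 2 (W k)) e)) K
        \<le> kappa * rho ^ b * (sqrt m * norm e)"
      using kappa_pos rho(1,2) by (intro mult_left_mono) auto
    then show ?thesis
      unfolding A_def using kappa_pos rho(1,2) by (subst (asm) L2_set_right_distrib) (auto simp: mult_ac)
  qed
  finally show ?thesis by (simp add: B_def mult.assoc)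
qed

end

end

subsection \<open>Derivatives of the Lagrangian\<close>

lemma grad_eqI:
  fixes g :: "'a::euclidean_space \<Rightarrow> real"
  assumes "(g has_derivative (\<lambda>h. v \<bullet> h)) (at x)"
  shows "grad g x = v"
  unfolding grad_def frechet_derivative_at[OF assms, symmetric] by (rule euclidean_representation)

lemma jacobian_eqI:
  fixes g :: "real^'n \<Rightarrow> real^'m"
  assumes "(g has_derivative (\<lambda>h. A *v h)) (at x)"
  shows "jacobian g (at x) = A"
  unfolding jacobian_def frechet_derivative_at[OF assms, symmetric]
  by (rule matrix_of_matrix_vector_mul)

lemma has_derivative_vecI:
  fixes g :: "'a::real_normed_vector \<Rightarrow> real^'m"
  assumes "\<And>k. ((\<lambda>x. g x $ k) has_derivative (\<lambda>h. g' h $ k)) (at x)"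
  shows "(g has_derivative g') (at x)"
  unfolding has_derivative_componentwise_within[of g]
  using assms by (auto simp: Basis_vec_def inner_axis)

text \<open>First and second partial derivatives are carried as explicit functions, so that
  Jacobian, gradient and Hessian become concrete sums, and representations can be added over the
  nodes.\<close>

definition C2_rep ::
    "(real^'n \<Rightarrow> real) \<Rightarrow> ('n \<Rightarrow> real^'n \<Rightarrow> real) \<Rightarrow> ('n \<Rightarrow> 'n \<Rightarrow> real^'n \<Rightarrow> real) \<Rightarrow> (real^'n) set \<Rightarrow> bool"
where
  "C2_rep g D1 D2 S \<longleftrightarrow>
     (\<forall>x\<in>S. (g has_derivative (\<lambda>h. \<Sum>p\<in>UNIV. h $ p * D1 p x)) (at x)) \<and>
     (\<forall>p. \<forall>x\<in>S. (D1 p has_derivative (\<lambda>h. \<Sum>q\<in>UNIV. h $ q * D2 p q x)) (at x)) \<and>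
     (\<forall>p q. continuous_on S (D2 p q))"

lemma has_derivative_partials:
  fixes g :: "real^'n \<Rightarrow> real"
  assumes "g differentiable (at x)"
  shows "(g has_derivative (\<lambda>h. \<Sum>p\<in>UNIV. h $ p * frechet_derivative g (at x) (axis p 1))) (at x)"
proof -
  let ?D = "frechet_derivative g (at x)"
  have D: "(g has_derivative ?D) (at x)"
    using assms unfolding frechet_derivative_works .
  then interpret D: bounded_linear ?D by (rule has_derivative_bounded_linear)
  have "?D h = (\<Sum>p\<in>UNIV. h $ p * ?D (axis p 1))" for h
  proof -
    have "h = (\<Sum>p\<in>UNIV. h $ p *\<^sub>R axis p 1)"
      using basis_expansion[of h] by (simp add: scalar_mult_eq_scaleR)
    then have "?D h = ?D (\<Sum>p\<in>UNIV. h $ p *\<^sub>R axis p 1)" by simp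
    also have "\<dots> = (\<Sum>p\<in>UNIV. h $ p * ?D (axis p 1))"
      by (simp add: D.sum D.scaleR)
    finally show ?thesis .
  qed
  with D show ?thesis by (metis (no_types, lifting) ext)
qed

lemma Ck_on_3_imp_C2_rep:
  fixes g :: "real^'n \<Rightarrow> real"
  assumes "Ck_on 3 g S"
  shows "\<exists>D1 D2. C2_rep g D1 D2 S"
proof -
  define D1 where "D1 p x = frechet_derivative g (at x) (axis p 1)" for p x
  define D2 where "D2 p q x = frechet_derivative (D1 p) (at x) (axis q 1)" for p q x
  have B: "(axis p 1 :: real^'n) \<in> Basis" for p
    by simp
  have 1: "\<forall>x\<in>S. g differentiable (at x)" and "\<forall>p. Ck_on 2 (D1 p) S"
    using assms B unfolding D1_def by (auto simp: numeral_3_eq_3 numeral_2_eq_2)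
  then have 2: "\<forall>x\<in>S. D1 p differentiable (at x)" and "\<forall>q. Ck_on 1 (D2 p q) S" for p
    using B unfolding D2_def by (auto simp: numeral_2_eq_2)
  then have "\<forall>x\<in>S. D2 p q differentiable (at x)" for p q
    by auto
  then have "continuous_on S (D2 p q)" for p q
    by (meson continuous_at_imp_continuous_on differentiable_imp_continuous_within)
  then have "C2_rep g D1 D2 S"
    unfolding C2_rep_def using has_derivative_partials[OF 1[rule_format]]
      has_derivative_partials[OF 2[rule_format]]
    unfolding D1_def[symmetric] D2_def[symmetric] by blast
  then show ?thesis by blast
qed

lemma C2_rep_sum:
  assumes "\<And>i. C2_rep (g i) (D1 i) (D2 i) S"
  shows "C2_rep (\<lambda>x. \<Sum>i\<in>I. g i x) (\<lambda>p x. \<Sum>i\<in>I. D1 i p x) (\<lambda>p q x. \<Sum>i\<in>I. D2 i p q x) S"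
proof -
  have swap: "(\<Sum>p\<in>UNIV. h $ p * (\<Sum>i\<in>I. D i p)) = (\<Sum>i\<in>I. \<Sum>p\<in>UNIV. h $ p * D i p)"
    for h :: "real^'b" and D :: "'a \<Rightarrow> 'b \<Rightarrow> real"
    by (simp add: sum_distrib_left) (rule sum.swap)
  show ?thesis
    using assms unfolding C2_rep_def swap
    by (intro conjI ballI allI has_derivative_sum continuous_on_sum) blast+
qed

locale smooth_problem =
  fixes f :: "'v::finite \<Rightarrow> real^'p::finite \<Rightarrow> real" and c :: "real^'p \<Rightarrow> real^'d::finite"
    and S :: "(real^'p) set"
    and DF :: "'p \<Rightarrow> real^'p \<Rightarrow> real" and D2F :: "'p \<Rightarrow> 'p \<Rightarrow> real^'p \<Rightarrow> real"
    and Dc :: "'d \<Rightarrow> 'p \<Rightarrow> real^'p \<Rightarrow> real" and D2c :: "'d \<Rightarrow> 'p \<Rightarrow> 'p \<Rightarrow> real^'p \<Rightarrow> real"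
  assumes S: "open S" and F: "C2_rep (total_obj f) DF D2F S"
    and c: "\<And>r. C2_rep (\<lambda>x. c x $ r) (Dc r) (D2c r) S"
begin

abbreviation "gx \<equiv> grad_x f c"

lemma c_has_derivative: "x \<in> S \<Longrightarrow> (c has_derivative (\<lambda>h. (\<chi> r p. Dc r p x) *v h)) (at x)"
  using c unfolding C2_rep_def
  by (intro has_derivative_vecI) (simp add: matrix_vector_mult_def mult.commute)

lemma Gjac_eq: "x \<in> S \<Longrightarrow> Gjac c x = (\<chi> r p. Dc r p x)"
  unfolding Gjac_def by (rule jacobian_eqI[OF c_has_derivative])

lemma Gjac_has_derivative: "x \<in> S \<Longrightarrow> (c has_derivative (\<lambda>h. Gjac c x *v h)) (at x)"
  using c_has_derivative Gjac_eq by simp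

lemma F_has_derivative: "x \<in> S \<Longrightarrow> (total_obj f has_derivative (\<lambda>h. (\<chi> p. DF p x) \<bullet> h)) (at x)"
  using F unfolding C2_rep_def by (simp add: inner_vec_def mult.commute)

lemma grad_x_eq': "x \<in> S \<Longrightarrow> gx x l = (\<chi> p. DF p x) + l v* Gjac c x"
  unfolding grad_x_def
proof (rule grad_eqI)
  assume x: "x \<in> S"
  have "((\<lambda>y. total_obj f y + l \<bullet> c y) has_derivative (\<lambda>h. (\<chi> p. DF p x) \<bullet> h + l \<bullet> (Gjac c x *v h))) (at x)"
    by (intro has_derivative_add F_has_derivative has_derivative_inner_right Gjac_has_derivative x)
  then show "((\<lambda>y. lagr f c y l) has_derivative (\<lambda>h. ((\<chi> p. DF p x) + l v* Gjac c x) \<bullet> h)) (at x)"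
    by (simp add: lagr_def inner_add_left dot_lmul_matrix)
qed

lemma grad_x_nth: "x \<in> S \<Longrightarrow> gx x l $ p = DF p x + (\<Sum>r\<in>UNIV. l $ r * Dc r p x)"
  by (simp add: grad_x_eq' Gjac_eq vector_matrix_mult_def)

lemma grad_l_eq: "grad_l f c x l = c x"
  unfolding grad_l_def
proof (rule grad_eqI)
  have "((\<lambda>y. total_obj f x + y \<bullet> c x) has_derivative (\<lambda>h. 0 + h \<bullet> c x)) (at l)"
    by (intro has_derivative_add has_derivative_const has_derivative_inner_left has_derivative_ident)
  then show "((\<lambda>y. lagr f c x y) has_derivative (\<lambda>h. c x \<bullet> h)) (at l)"
    by (simp add: lagr_def inner_commute)
qed

text \<open>The Hessian of the Lagrangian in terms of second partial derivatives.
  \<open>Hess\<close> is the Jacobian of a gradient and is identified with this formula on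
  \<open>S\<close>.\<close>

definition HH :: "real^'p \<Rightarrow> real^'d \<Rightarrow> real^'p^'p" where
  "HH x l = (\<chi> p q. D2F p q x + (\<Sum>r\<in>UNIV. l $ r * D2c r p q x))"

lemma grad_x_has_derivative':
  assumes x: "x \<in> S"
  shows "((\<lambda>z. gx (fst z) (snd z)) has_derivative (\<lambda>h. HH x l *v fst h + snd h v* Gjac c x)) (at (x, l))"
proof (rule has_derivative_vecI)
  fix p
  have fst: "((\<lambda>z. g (fst z)) has_derivative (\<lambda>h. g' (fst h))) (at (x, l))"
    if "(g has_derivative g') (at x)" for g :: "real^'p \<Rightarrow> real" and g'
    by (rule has_derivative_compose[OF has_derivative_fst[OF has_derivative_ident]]) (use that in simp)
  have snd: "((\<lambda>z. snd z $ r) has_derivative (\<lambda>h. snd h $ r)) (at (x, l))" for r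
    by (intro bounded_linear.has_derivative[OF bounded_linear_vec_nth] has_derivative_snd has_derivative_ident)
  have "((\<lambda>z. DF p (fst z) + (\<Sum>r\<in>UNIV. snd z $ r * Dc r p (fst z))) has_derivative
     (\<lambda>h. (\<Sum>q\<in>UNIV. fst h $ q * D2F p q x) + (\<Sum>r\<in>UNIV. snd (x, l) $ r * (\<Sum>q\<in>UNIV. fst h $ q * D2c r p q x) + snd h $ r * Dc r p (fst (x, l))))) (at (x, l))"
    using F c x unfolding C2_rep_def
    by (intro has_derivative_add has_derivative_sum has_derivative_mult fst snd) auto
  moreover have "(\<Sum>q\<in>UNIV. fst h $ q * D2F p q x) + (\<Sum>r\<in>UNIV. snd (x, l) $ r * (\<Sum>q\<in>UNIV. fst h $ q * D2c r p q x) + snd h $ r * Dc r p (fst (x, l)))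
      = (HH x l *v fst h + snd h v* Gjac c x) $ p" for h
  proof -
    have "(\<Sum>r\<in>UNIV. l $ r * (\<Sum>q\<in>UNIV. fst h $ q * D2c r p q x)) = (\<Sum>q\<in>UNIV. (\<Sum>r\<in>UNIV. l $ r * D2c r p q x) * fst h $ q)"
      unfolding sum_distrib_left sum_distrib_right by (subst sum.swap) (simp add: mult_ac)
    then show ?thesis
      by (simp add: HH_def Gjac_eq[OF x] matrix_vector_mult_def vector_matrix_mult_def sum.distrib distrib_left mult.commute)
  qed
  ultimately have "((\<lambda>z. DF p (fst z) + (\<Sum>r\<in>UNIV. snd z $ r * Dc r p (fst z))) has_derivative
     (\<lambda>h. (HH x l *v fst h + snd h v* Gjac c x) $ p)) (at (x, l))"
    by simp
  \<comment> \<open>The explicit formula for the gradient is available on \<open>S\<close>, hence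
    the transfer along the open set \<open>S \<times> UNIV\<close>.\<close>
  then show "((\<lambda>z. gx (fst z) (snd z) $ p) has_derivative (\<lambda>h. (HH x l *v fst h + snd h v* Gjac c x) $ p)) (at (x, l))"
    by (rule has_derivative_transform_within_open[OF _ open_Times[OF S open_UNIV]]) (auto simp: x grad_x_nth)
qed

lemma Hess_eq: "x \<in> S \<Longrightarrow> Hess f c x l = HH x l"
  unfolding Hess_def
proof (rule jacobian_eqI)
  assume x: "x \<in> S"
  have "((\<lambda>y. (y, l)) has_derivative (\<lambda>h. (h, 0))) (at x)"
    by (intro has_derivative_Pair has_derivative_ident has_derivative_const)
  from has_derivative_compose[OF this grad_x_has_derivative'[OF x]]
  show "((\<lambda>y. gx y l) has_derivative (\<lambda>h. HH x l *v h)) (at x)"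
    by simp
qed

lemma grad_x_has_derivative:
  "x \<in> S \<Longrightarrow> ((\<lambda>z. gx (fst z) (snd z)) has_derivative (\<lambda>h. Hess f c x l *v fst h + snd h v* Gjac c x)) (at (x, l))"
  using grad_x_has_derivative' by (simp add: Hess_eq)

lemma lagr_has_derivative:
  assumes x: "x \<in> S"
  shows "((\<lambda>z. lagr f c (fst z) (snd z)) has_derivative (\<lambda>h. (gx x l, c x) \<bullet> h)) (at (x, l))"
proof -
  have d: "((\<lambda>z. c (fst z)) has_derivative (\<lambda>h. Gjac c x *v fst h)) (at (x, l))"
    by (rule has_derivative_compose[OF has_derivative_fst[OF has_derivative_ident]]) (use Gjac_has_derivative[OF x] in simp)
  have "((\<lambda>z. total_obj f (fst z)) has_derivative (\<lambda>h. (\<chi> p. DF p x) \<bullet> fst h)) (at (x, l))"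
    by (rule has_derivative_compose[OF has_derivative_fst[OF has_derivative_ident]]) (use F_has_derivative[OF x] in simp)
  from has_derivative_add[OF this has_derivative_inner[OF has_derivative_snd[OF has_derivative_ident] d]]
  have "((\<lambda>z. lagr f c (fst z) (snd z)) has_derivative
      (\<lambda>h. (\<chi> p. DF p x) \<bullet> fst h + (snd (x, l) \<bullet> (Gjac c x *v fst h) + snd h \<bullet> c (fst (x, l))))) (at (x, l))"
    by (simp add: lagr_def)
  then show ?thesis
    by (rule has_derivative_eq_rhs)
      (simp add: fun_eq_iff grad_x_eq'[OF x] inner_prod_def inner_add_left dot_lmul_matrix inner_commute[of "c x"])
qed

text \<open>The filter is arbitrary because the limit is taken both along the iterates and at a
  point, the latter for the product rule.\<close>

lemma Hess_tendsto:
  assumes "x \<in> S" "(xx \<longlongrightarrow> x) A" "(ll \<longlongrightarrow> l) A"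
  shows "((\<lambda>t. Hess f c (xx t) (ll t)) \<longlongrightarrow> Hess f c x l) A"
proof -
  have "((\<lambda>t. HH (xx t) (ll t)) \<longlongrightarrow> HH x l) A"
  proof (rule vec_tendstoI, rule vec_tendstoI)
    fix p q
    have D: "((\<lambda>t. D (xx t)) \<longlongrightarrow> D x) A" if "continuous_on S D" for D :: "real^'p \<Rightarrow> real"
      using that assms(1,2) S by (metis continuous_on_eq_continuous_at isCont_tendsto_compose)
    have "((\<lambda>t. D2F p q (xx t) + (\<Sum>r\<in>UNIV. ll t $ r * D2c r p q (xx t))) \<longlongrightarrow> D2F p q x + (\<Sum>r\<in>UNIV. l $ r * D2c r p q x)) A"
      using F c unfolding C2_rep_def by (intro tendsto_intros D assms(3)) auto
    then show "((\<lambda>t. HH (xx t) (ll t) $ p $ q) \<longlongrightarrow> HH x l $ p $ q) A"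
      by (simp add: HH_def)
  qed
  moreover have "\<forall>\<^sub>F t in A. xx t \<in> S"
    using topological_tendstoD[OF assms(2) S assms(1)] .
  ultimately show ?thesis
    using assms(1) by (subst tendsto_cong[where g = "\<lambda>t. HH (xx t) (ll t)"]) (auto simp: Hess_eq elim: eventually_mono)
qed

lemma Gjac_tendsto:
  assumes "x \<in> S" "(xx \<longlongrightarrow> x) A"
  shows "((\<lambda>t. Gjac c (xx t)) \<longlongrightarrow> Gjac c x) A"
proof -
  have "((\<lambda>t. \<chi> r p. Dc r p (xx t)) \<longlongrightarrow> (\<chi> r p. Dc r p x)) A"
  proof (rule vec_tendstoI, rule vec_tendstoI, simp)
    fix r p
    have "isCont (Dc r p) x"
      using c assms(1) unfolding C2_rep_def by (meson has_derivative_continuous)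
    then show "((\<lambda>t. Dc r p (xx t)) \<longlongrightarrow> Dc r p x) A"
      using assms(2) by (rule isCont_tendsto_compose)
  qed
  moreover have "\<forall>\<^sub>F t in A. xx t \<in> S"
    using topological_tendstoD[OF assms(2) S assms(1)] .
  ultimately show ?thesis
    using assms(1) by (subst tendsto_cong[where g = "\<lambda>t. \<chi> r p. Dc r p (xx t)"]) (auto simp: Gjac_eq elim: eventually_mono)
qed

end

subsection \<open>Acceptance of the unit step\<close>

text \<open>The gradient is known to be differentiable at \<open>zs\<close> alone. The mean value
  theorem, applied along a segment to \<open>L\<close> minus its quadratic model, reduces the claim
  to the first order expansion of \<open>g\<close> at \<open>zs\<close>.\<close>

lemma quadratic_expansion:
  fixes L :: "'a::real_inner \<Rightarrow> real"
  assumes r: "0 < r" and L: "\<And>z. norm (z - zs) < r \<Longrightarrow> (L has_derivative (\<lambda>h. g z \<bullet> h)) (at z)"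
    and g: "(g has_derivative M) (at zs)" "g zs = 0" and eps: "0 < eps"
  shows "\<exists>d>0. \<forall>e. norm e < d \<longrightarrow> \<bar>L (zs + e) - L zs - 1 / 2 * (M e \<bullet> e)\<bar> \<le> eps * (norm e)\<^sup>2"
proof -
  interpret M: bounded_linear M
    using g(1) by (rule has_derivative_bounded_linear)
  obtain d where d: "0 < d" "\<And>y. norm (y - zs) < d \<Longrightarrow> norm (g y - g zs - M (y - zs)) \<le> eps * norm (y - zs)"
    using g(1) eps unfolding has_derivative_at_alt by blast
  show ?thesis
  proof (intro exI[of _ "min d r"] conjI allI impI)
    show "0 < min d r" using d r by simp
    fix e :: 'a assume e: "norm e < min d r"
    define h where "h s = L (zs + s *\<^sub>R e) - s\<^sup>2 / 2 * (M e \<bullet> e)" for s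
    have se: "norm (s *\<^sub>R e) < min d r" if "0 \<le> s" "s \<le> 1" for s
    proof -
      have "\<bar>s\<bar> * norm e \<le> 1 * norm e" using that by (intro mult_right_mono) auto
      then show ?thesis using e by simp
    qed
    have "(h has_real_derivative (g (zs + s *\<^sub>R e) \<bullet> e - s * (M e \<bullet> e))) (at s)" if s: "0 \<le> s" "s \<le> 1" for s
    proof -
      have 1: "((\<lambda>s. zs + s *\<^sub>R e) has_derivative (\<lambda>t. t *\<^sub>R e)) (at s)"
        by (rule has_derivative_eq_rhs[OF has_derivative_add[OF has_derivative_const has_derivative_scaleR_left[OF has_derivative_ident]]]) simp
      have "(L has_derivative (\<lambda>h. g (zs + s *\<^sub>R e) \<bullet> h)) (at (zs + s *\<^sub>R e))"
        using se[OF s] by (intro L) simp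
      from has_derivative_compose[OF 1 this]
      have "((\<lambda>s. L (zs + s *\<^sub>R e)) has_derivative (\<lambda>t. (g (zs + s *\<^sub>R e) \<bullet> e) * t)) (at s)"
        by (simp add: mult.commute)
      then have 2: "((\<lambda>s. L (zs + s *\<^sub>R e)) has_real_derivative (g (zs + s *\<^sub>R e) \<bullet> e)) (at s)"
        by (simp add: has_field_derivative_def)
      have 3: "((\<lambda>s. s\<^sup>2 / 2 * (M e \<bullet> e)) has_real_derivative (s * (M e \<bullet> e))) (at s)"
        by (auto intro!: derivative_eq_intros)
      show ?thesis
        unfolding h_def by (rule DERIV_diff[OF 2 3])
    qed
    then obtain s where s: "0 < s" "s < 1" "h 1 - h 0 = (1 - 0) * (g (zs + s *\<^sub>R e) \<bullet> e - s * (M e \<bullet> e))"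
      using MVT2[of 0 1 h "\<lambda>s. g (zs + s *\<^sub>R e) \<bullet> e - s * (M e \<bullet> e)"] by auto
    have "\<bar>h 1 - h 0\<bar> = \<bar>(g (zs + s *\<^sub>R e) - M (s *\<^sub>R e)) \<bullet> e\<bar>"
      using s(3) by (simp add: inner_diff_left M.scaleR)
    also have "\<dots> \<le> norm (g (zs + s *\<^sub>R e) - M (s *\<^sub>R e)) * norm e"
      by (rule Cauchy_Schwarz_ineq2)
    also have "\<dots> \<le> (eps * norm (s *\<^sub>R e)) * norm e"
      using d(2)[of "zs + s *\<^sub>R e"] se[of s] s g(2) by (intro mult_right_mono) auto
    also have "\<dots> \<le> (eps * norm e) * norm e"
      using s eps by (intro mult_right_mono mult_left_mono) (auto simp: mult_left_le_one_le)
    finally show "\<bar>L (zs + e) - L zs - 1 / 2 * (M e \<bullet> e)\<bar> \<le> eps * (norm e)\<^sup>2"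
      by (simp add: h_def power2_eq_square algebra_simps)
  qed
qed

text \<open>With \<open>e\<close> the current error and \<open>e' = d t + e\<close> the next one,
  \<open>M e \<bullet> d t = M e \<bullet> e' - M e \<bullet> e\<close>. To leading order the Armijo
  inequality thus compares \<open>(1 / 2 - beta) * (M e \<bullet> e)\<close> with terms carrying a
  factor \<open>del\<close>. This is \<open>small\<close>, which is strict to leave room for the
  expansion errors.\<close>

lemma unit_step_armijo:
  fixes L :: "'a::real_inner \<Rightarrow> real"
  assumes r: "0 < r" and L: "\<And>z. norm (z - zs) < r \<Longrightarrow> (L has_derivative (\<lambda>h. g z \<bullet> h)) (at z)"
    and g: "(g has_derivative M) (at zs)" "g zs = 0"
    and coer: "\<And>e. a * (norm e)\<^sup>2 \<le> M e \<bullet> e" and bd: "\<And>u v. \<bar>M u \<bullet> v\<bar> \<le> B * norm u * norm v"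
    and z: "z \<longlonglongrightarrow> zs" and d: "\<forall>\<^sub>F t in sequentially. norm (d t + (z t - zs)) \<le> del * norm (z t - zs)"
    and del: "0 \<le> del" "del \<le> 1" and beta: "0 < beta" "beta < 1 / 2"
    and small: "(del\<^sup>2 / 2 + beta * del) * B < (1 / 2 - beta) * a" and B: "0 \<le> B"
  shows "\<forall>\<^sub>F t in sequentially. L (z t + d t) \<le> L (z t) + beta * (g (z t) \<bullet> d t)"
proof -
  \<comment> \<open>A quarter of the slack in \<open>small\<close>: the two expansions of
    \<open>L\<close> use one \<open>eps\<close> each, the gradient term at most another, since
    \<open>2 * beta \<le> 1\<close>.\<close>
  define eps where "eps = ((1 / 2 - beta) * a - (del\<^sup>2 / 2 + beta * del) * B) / 4"
  have eps: "0 < eps" using small by (simp add: eps_def)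
  obtain d1 where d1: "0 < d1" "\<And>e. norm e < d1 \<Longrightarrow> \<bar>L (zs + e) - L zs - 1 / 2 * (M e \<bullet> e)\<bar> \<le> eps * (norm e)\<^sup>2"
    using quadratic_expansion[OF r L g eps] by blast
  obtain d2 where d2: "0 < d2" "\<And>y. norm (y - zs) < d2 \<Longrightarrow> norm (g y - g zs - M (y - zs)) \<le> eps * norm (y - zs)"
    using g(1) eps unfolding has_derivative_at_alt by blast
  have "\<forall>\<^sub>F t in sequentially. dist (z t) zs < min d1 d2"
    using z d1 d2 by (intro tendstoD) auto
  with d show ?thesis
  proof eventually_elim
    case (elim t)
    define e where "e = z t - zs"
    define e' where "e' = d t + e"
    define n where "n = norm e"
    have n0: "0 \<le> n" by (simp add: n_def)
    have n: "norm e < d1" "norm e < d2" and e': "norm e' \<le> del * n"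
      using elim by (auto simp: e_def e'_def dist_norm n_def)
    have e'n: "norm e' \<le> n"
      using e' mult_right_mono[OF del(2) n0] by simp
    have dn: "norm (d t) \<le> 2 * n"
      using norm_triangle_ineq4[of e' e] e'n by (simp add: e'_def n_def)
    have 1: "L (zs + e') \<le> L zs + 1 / 2 * (M e' \<bullet> e') + eps * n\<^sup>2"
    proof -
      have "norm e' < d1" using e'n n by (simp add: n_def)
      then have "\<bar>L (zs + e') - L zs - 1 / 2 * (M e' \<bullet> e')\<bar> \<le> eps * (norm e')\<^sup>2" by (rule d1)
      also have "\<dots> \<le> eps * n\<^sup>2" using eps e'n by (intro mult_left_mono power_mono) auto
      finally show ?thesis by linarith
    qed
    have 2: "L zs + 1 / 2 * (M e \<bullet> e) - eps * n\<^sup>2 \<le> L (zs + e)"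
      using d1(2)[OF n(1)] by (simp add: n_def abs_le_iff)
    have 3: "M e \<bullet> d t - eps * (2 * n\<^sup>2) \<le> g (z t) \<bullet> d t"
    proof -
      have "norm (g (z t) - M e) \<le> eps * n"
        using d2(2)[of "z t"] n g(2) by (simp add: e_def n_def)
      then have "norm (g (z t) - M e) * norm (d t) \<le> (eps * n) * (2 * n)"
        using dn eps n0 by (intro mult_mono) auto
      moreover have "\<bar>(g (z t) - M e) \<bullet> d t\<bar> \<le> norm (g (z t) - M e) * norm (d t)"
        by (rule Cauchy_Schwarz_ineq2)
      ultimately have "\<bar>(g (z t) - M e) \<bullet> d t\<bar> \<le> eps * (2 * n\<^sup>2)"
        by (simp add: power2_eq_square)
      then show ?thesis by (simp add: inner_diff_left)
    qed
    have 4: "M e' \<bullet> e' \<le> B * del\<^sup>2 * n\<^sup>2"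
    proof -
      have "M e' \<bullet> e' \<le> B * norm e' * norm e'" using bd[of e' e'] by linarith
      also have "\<dots> = B * (norm e')\<^sup>2" by (simp add: power2_eq_square)
      also have "\<dots> \<le> B * (del * n)\<^sup>2" using B e' by (intro mult_left_mono power_mono) auto
      finally show ?thesis by (simp add: power_mult_distrib)
    qed
    have 5: "- (B * del * n\<^sup>2) \<le> M e \<bullet> e'"
    proof -
      have "B * n * norm e' \<le> B * n * (del * n)" using B n0 e' by (intro mult_left_mono) auto
      then show ?thesis using bd[of e e'] by (simp add: n_def power2_eq_square mult_ac)
    qed
    have 6: "a * n\<^sup>2 \<le> M e \<bullet> e"
      using coer[of e] by (simp add: n_def)
    have Md: "M e \<bullet> d t = M e \<bullet> e' - M e \<bullet> e"
      by (simp add: e'_def inner_add_right)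
    have "(1 / 2 - beta) * (a * n\<^sup>2) \<le> (1 / 2 - beta) * (M e \<bullet> e)"
      using 6 beta by (intro mult_left_mono) auto
    moreover have "beta * (- (B * del * n\<^sup>2) - M e \<bullet> e - eps * (2 * n\<^sup>2)) \<le> beta * (g (z t) \<bullet> d t)"
      using 3 5 Md beta by (intro mult_left_mono) auto
    moreover have "beta * (eps * (2 * n\<^sup>2)) \<le> eps * n\<^sup>2"
      using beta eps mult_right_mono[of "beta * 2" 1 "eps * n\<^sup>2"] by (simp add: mult_ac)
    moreover have "4 * (eps * n\<^sup>2) = (1 / 2 - beta) * (a * n\<^sup>2) - B * del\<^sup>2 * n\<^sup>2 / 2 - beta * (B * del * n\<^sup>2)"
    proof -
      have "4 * (eps * n\<^sup>2) = (4 * eps) * n\<^sup>2" by simp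
      also have "4 * eps = (1 / 2 - beta) * a - (del\<^sup>2 / 2 + beta * del) * B" by (simp add: eps_def)
      finally have "4 * (eps * n\<^sup>2) = ((1 / 2 - beta) * a - (del\<^sup>2 / 2 + beta * del) * B) * n\<^sup>2" .
      moreover have "((1 / 2 - beta) * a - (del\<^sup>2 / 2 + beta * del) * B) * n\<^sup>2
          = (1 / 2 - beta) * (a * n\<^sup>2) - B * del\<^sup>2 * n\<^sup>2 / 2 - beta * (B * del * n\<^sup>2)"
        by (simp add: algebra_simps)
      ultimately show ?thesis by (rule trans)
    qed
    moreover have "0 \<le> eps * n\<^sup>2"
      using eps by simp
    moreover have "zs + e' = z t + d t" "zs + e = z t"
      by (simp_all add: e_def e'_def)
    ultimately show ?case
      using 1 2 4 by (simp add: algebra_simps)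
  qed
qed

subsection \<open>The Hessian of the augmented Lagrangian at a solution\<close>

text \<open>With \<open>s = eta2 * gG\<close>, the bound \<open>9 / s \<le> eta1\<close> is split as
  \<open>5 / s + 4 / s\<close>. The first share exceeds the penalty threshold because
  \<open>eta2 * U\<^sup>2 \<le> gH / 7\<close>; the second absorbs the cross term in
  \<open>v\<close> and \<open>G *v u\<close>. The \<open>eta2\<close> term supplies
  \<open>s / 2\<close> in \<open>v\<close> at the price of \<open>gH / 7\<close> in
  \<open>u\<close>, and at least \<open>s / 4\<close> remains in both.\<close>

lemma augmented_coercive:
  fixes H :: "real^'p^'p" and G :: "real^'p^'d"
  assumes pen: "\<And>k u. 4 * U\<^sup>2 / (gG * gH) \<le> k \<Longrightarrow> gH / 2 * (norm u)\<^sup>2 \<le> u \<bullet> (H *v u) + k * (norm (G *v u))\<^sup>2"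
    and H: "\<And>u. norm (H *v u) \<le> U * norm u" and G: "\<And>v. gG * (norm v)\<^sup>2 \<le> (norm (v v* G))\<^sup>2"
    and U: "1 \<le> U" and gH: "0 < gH" "gH \<le> 1" and gG: "0 < gG" "gG \<le> 1"
    and eta: "0 < eta2" "9 / (eta2 * gG) \<le> eta1" "eta2 \<le> gH / (7 * U\<^sup>2)"
  shows "eta2 * gG / 4 * ((norm u)\<^sup>2 + (norm v)\<^sup>2)
    \<le> u \<bullet> (H *v u) + 2 * (v \<bullet> (G *v u)) + eta2 * (norm (H *v u + v v* G))\<^sup>2 + eta1 * (norm (G *v u))\<^sup>2"
proof -
  define s where "s = eta2 * gG"
  have s: "0 < s" using eta gG by (simp add: s_def)
  have U2: "1 \<le> U\<^sup>2" using U by simp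
  have etaU: "eta2 * U\<^sup>2 \<le> gH / 7"
    using eta(3) U2 U pos_le_divide_eq[of "7 * U\<^sup>2" eta2 gH] by (simp add: mult_ac)
  have "eta2 * 1 \<le> eta2 * U\<^sup>2"
    using eta U2 by (intro mult_left_mono) auto
  then have eta7: "eta2 \<le> gH / 7" using etaU by simp
  have "s \<le> eta2 * 1"
    unfolding s_def using eta gG by (intro mult_left_mono) auto
  then have s7: "s \<le> gH / 7" using eta7 by simp
  have "4 * U\<^sup>2 / (gG * gH) \<le> 5 / s"
  proof -
    have "4 * (eta2 * U\<^sup>2) * gG \<le> 5 * gH * gG"
      using etaU gG gH by (intro mult_right_mono) auto
    then have "4 * U\<^sup>2 * s \<le> 5 * (gG * gH)"
      by (simp add: s_def mult_ac)
    moreover have "a / b \<le> c / d" if "a * d \<le> c * b" "0 < b" "0 < d" for a b c d :: real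
      using that by (simp add: field_simps)
    ultimately show ?thesis
      using s gG gH by simp
  qed
  moreover have "5 / s \<le> eta1 - 4 / s"
    using eta(2) by (simp add: s_def)
  ultimately have 1: "gH / 2 * (norm u)\<^sup>2 \<le> u \<bullet> (H *v u) + (eta1 - 4 / s) * (norm (G *v u))\<^sup>2"
    by (intro pen) linarith
  have 2: "- (2 * (v \<bullet> (G *v u))) \<le> s / 4 * (norm v)\<^sup>2 + 4 / s * (norm (G *v u))\<^sup>2"
  proof -
    have "(norm ((s / 2) *\<^sub>R v + 2 *\<^sub>R (G *v u)))\<^sup>2
        = (s / 2) * (s / 2) * (v \<bullet> v) + 4 * ((G *v u) \<bullet> (G *v u)) + 2 * s * (v \<bullet> (G *v u))"
      unfolding power2_norm_eq_inner
      by (simp add: inner_add_left inner_add_right inner_commute[of "G *v u" v] distrib_left)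
    also have "\<dots> = s * (s / 4 * (norm v)\<^sup>2 + 4 / s * (norm (G *v u))\<^sup>2 + 2 * (v \<bullet> (G *v u)))"
    proof -
      have "(s / 2) * (s / 2) * a + 4 * b + 2 * s * c = s * (s / 4 * a + 4 / s * b + 2 * c)" for a b c :: real
        using s by (simp add: field_simps)
      then show ?thesis
        unfolding power2_norm_eq_inner .
    qed
    finally have "0 \<le> s * (s / 4 * (norm v)\<^sup>2 + 4 / s * (norm (G *v u))\<^sup>2 + 2 * (v \<bullet> (G *v u)))"
      by (metis zero_le_power2)
    then have "0 \<le> s / 4 * (norm v)\<^sup>2 + 4 / s * (norm (G *v u))\<^sup>2 + 2 * (v \<bullet> (G *v u))"
      using s by (simp only: zero_le_mult_iff) auto
    then show ?thesis by linarith
  qed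
  have 3: "s / 2 * (norm v)\<^sup>2 - gH / 7 * (norm u)\<^sup>2 \<le> eta2 * (norm (H *v u + v v* G))\<^sup>2"
  proof -
    \<comment> \<open>Expanded, this is the inequality
      \<open>|p + q|^2 \<ge> |q|^2 / 2 - |p|^2\<close> with \<open>p = H *v u\<close> and
      \<open>q = v v* G\<close>.\<close>
    have "0 \<le> (norm ((v v* G) + 2 *\<^sub>R (H *v u)))\<^sup>2"
      by simp
    also have "\<dots> = 2 * ((norm (H *v u + v v* G))\<^sup>2 + (norm (H *v u))\<^sup>2) - (norm (v v* G))\<^sup>2"
      unfolding power2_norm_eq_inner
      by (simp add: inner_add_left inner_add_right inner_commute[of "H *v u" "v v* G"])
    finally have "(norm (v v* G))\<^sup>2 / 2 - (norm (H *v u))\<^sup>2 \<le> (norm (H *v u + v v* G))\<^sup>2"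
      by simp
    moreover have "(norm (H *v u))\<^sup>2 \<le> U\<^sup>2 * (norm u)\<^sup>2"
      unfolding power_mult_distrib[symmetric] by (intro power_mono H) simp
    moreover note G[of v]
    ultimately have "gG * (norm v)\<^sup>2 / 2 - U\<^sup>2 * (norm u)\<^sup>2 \<le> (norm (H *v u + v v* G))\<^sup>2"
      by linarith
    then have "eta2 * (gG * (norm v)\<^sup>2 / 2 - U\<^sup>2 * (norm u)\<^sup>2) \<le> eta2 * (norm (H *v u + v v* G))\<^sup>2"
      using eta by (intro mult_left_mono) auto
    moreover have "(eta2 * U\<^sup>2) * (norm u)\<^sup>2 \<le> gH / 7 * (norm u)\<^sup>2"
      using etaU by (rule mult_right_mono) simp
    ultimately show ?thesis by (simp add: s_def algebra_simps)
  qed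
  have 4: "s / 4 * (norm u)\<^sup>2 \<le> (gH / 2 - gH / 7) * (norm u)\<^sup>2"
    using s7 gH by (intro mult_right_mono) auto
  show ?thesis
    using 1 2 3 4 unfolding s_def[symmetric] by (simp add: algebra_simps)
qed

text \<open>Here \<open>norm A\<close> is the Frobenius norm, which fits the convergence of
  matrices; uniform bounds use \<open>spec_norm\<close> blockwise instead.\<close>

lemma norm_matrix_vector_le: "norm (A *v v) \<le> norm A * norm v"
  for A :: "real^'n^'m"
proof -
  have "norm (A *v v) \<le> L2_set (\<lambda>i. norm (A $ i) * norm v) UNIV"
    unfolding norm_vec_def[of "A *v v"]
  proof (rule L2_set_mono)
    fix i
    have "(A *v v) $ i = A $ i \<bullet> v"
      by (simp add: matrix_vector_mul_component)
    then show "norm ((A *v v) $ i) \<le> norm (A $ i) * norm v"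
      using Cauchy_Schwarz_ineq2[of "A $ i" v] by simp
  qed simp
  also have "\<dots> = norm A * norm v"
    unfolding norm_vec_def[of A] by (simp add: L2_set_left_distrib)
  finally show ?thesis .
qed

text \<open>Since \<open>u\<close> vanishes at \<open>x\<close>, continuity of \<open>A\<close> suffices for the product rule.\<close>

lemma has_derivative_matrix_mult_zero:
  fixes A :: "'a::real_normed_vector \<Rightarrow> real^'n^'m"
  assumes A: "(A \<longlongrightarrow> A x) (at x)" and u: "(u has_derivative u') (at x)" "u x = 0"
  shows "((\<lambda>z. A z *v u z) has_derivative (\<lambda>h. A x *v u' h)) (at x)"
  unfolding has_derivative_at_alt
proof (intro conjI allI impI)
  interpret u': bounded_linear u'
    using u(1) by (rule has_derivative_bounded_linear)
  show "bounded_linear (\<lambda>h. A x *v u' h)"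
    by (rule bounded_linear_compose[OF matrix_vector_mul_bounded_linear u'.bounded_linear_axioms])
  obtain C where C: "0 < C" "\<And>h. norm (u' h) \<le> norm h * C"
    using u'.pos_bounded by blast
  fix e :: real assume e: "0 < e"
  \<comment> \<open>\<open>a\<close> limits the variation of \<open>A\<close> and \<open>c\<close>
    the remainder of \<open>u\<close>, each for half of \<open>e\<close>. The cap
    \<open>c \<le> 1\<close> yields the factor \<open>C + 1\<close> in the bound on
    \<open>u y\<close>.\<close>
  define a where "a = e / (2 * (C + 1))"
  define c where "c = min 1 (e / (2 * (norm (A x) + 1)))"
  have nA: "0 < norm (A x) + 1" using norm_ge_zero[of "A x"] by linarith
  have a: "0 < a" "a * (C + 1) \<le> e / 2" using e C by (auto simp: a_def field_simps)
  have "0 < c" using e nA by (simp add: c_def)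
  have "norm (A x) * c \<le> (norm (A x) + 1) * (e / (2 * (norm (A x) + 1)))"
    using \<open>0 < c\<close> by (intro mult_mono) (auto simp: c_def)
  also have "\<dots> = e / 2"
  proof -
    have "n * (e / (2 * n)) = e / 2" if "0 < n" for n :: real
      using that by simp
    then show ?thesis using nA .
  qed
  finally have c: "0 < c" "c \<le> 1" "norm (A x) * c \<le> e / 2"
    using \<open>0 < c\<close> by (auto simp: c_def)
  obtain d1 where d1: "0 < d1" "\<And>y. y \<noteq> x \<Longrightarrow> dist y x < d1 \<Longrightarrow> dist (A y) (A x) < a"
    using tendstoD[OF A a(1)] unfolding eventually_at by blast
  obtain d2 where d2: "0 < d2" "\<And>y. norm (y - x) < d2 \<Longrightarrow> norm (u y - u x - u' (y - x)) \<le> c * norm (y - x)"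
    using u(1) c(1) unfolding has_derivative_at_alt by blast
  show "\<exists>d>0. \<forall>y. norm (y - x) < d \<longrightarrow> norm (A y *v u y - A x *v u x - A x *v u' (y - x)) \<le> e * norm (y - x)"
  proof (intro exI[of _ "min d1 d2"] conjI allI impI)
    show "0 < min d1 d2" using d1 d2 by simp
    fix y assume y: "norm (y - x) < min d1 d2"
    let ?n = "norm (y - x)"
    have r: "norm (u y - u' (y - x)) \<le> c * ?n"
      using d2(2)[of y] y u(2) by simp
    have "norm (u y) \<le> norm (u y - u' (y - x)) + norm (u' (y - x))"
      using norm_triangle_ineq[of "u y - u' (y - x)" "u' (y - x)"] by simp
    also have "\<dots> \<le> 1 * ?n + ?n * C"
      using r C(2)[of "y - x"] mult_right_mono[OF c(2) norm_ge_zero[of "y - x"]] by linarith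
    finally have uy: "norm (u y) \<le> (C + 1) * ?n" by (simp add: algebra_simps)
    have Ay: "norm (A y - A x) \<le> a"
      using d1(2)[of y] y a(1) by (cases "y = x") (auto simp: dist_norm)
    have "A y *v u y - A x *v u x - A x *v u' (y - x) = (A y - A x) *v u y + A x *v (u y - u' (y - x))"
      by (simp add: u(2) matrix_vector_mult_diff_distrib matrix_vector_mult_diff_rdistrib)
    then have "norm (A y *v u y - A x *v u x - A x *v u' (y - x))
        \<le> norm ((A y - A x) *v u y) + norm (A x *v (u y - u' (y - x)))"
      by (simp only: norm_triangle_ineq)
    also have "\<dots> \<le> norm (A y - A x) * norm (u y) + norm (A x) * norm (u y - u' (y - x))"
      by (intro add_mono norm_matrix_vector_le)
    also have "\<dots> \<le> a * ((C + 1) * ?n) + norm (A x) * (c * ?n)"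
      using Ay uy r a C by (intro add_mono mult_mono) auto
    also have "\<dots> = (a * (C + 1)) * ?n + (norm (A x) * c) * ?n" by simp
    also have "\<dots> \<le> e / 2 * ?n + e / 2 * ?n"
      using a c by (intro add_mono mult_right_mono) auto
    finally show "norm (A y *v u y - A x *v u x - A x *v u' (y - x)) \<le> e * ?n" by simp
  qed
qed

subsection \<open>Sparsity and limits of matrices\<close>

text \<open>Moving a coordinate outside the neighbourhood of the node of \<open>r\<close> leaves
  component \<open>r\<close> of \<open>c\<close> constant, so the derivative in that direction is
  zero.\<close>

lemma Gjac_band:
  assumes E: "sym E" and str: "graph_structured E np nd f c"
    and d: "(c has_derivative (\<lambda>h. G *v h)) (at x)" and nz: "G $ r $ p \<noteq> 0"
  shows "nd r \<in> nbhd E 1 {np p}"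
proof (rule ccontr)
  assume "nd r \<notin> nbhd E 1 {np p}"
  then have np: "np p \<notin> nbhd E 1 {nd r}"
    by (simp only: nbhd_singleton_sym[OF E, of "np p"]) simp
  have const: "c (x + s *\<^sub>R axis p 1) $ r = c x $ r" for s
  proof -
    have "vsub np (nbhd E 1 {nd r}) (x + s *\<^sub>R axis p 1) = vsub np (nbhd E 1 {nd r}) x"
      using np by (auto simp: vec_eq_iff axis_def)
    then have "vsub nd {nd r} (c (x + s *\<^sub>R axis p 1)) = vsub nd {nd r} (c x)"
      using str unfolding graph_structured_def by blast
    then show ?thesis
      unfolding vec_eq_iff by (metis singletonI vsub_nth)
  qed
  have 1: "((\<lambda>s. x + s *\<^sub>R axis p 1) has_derivative (\<lambda>t. t *\<^sub>R axis p 1)) (at 0)"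
    by (rule has_derivative_eq_rhs[OF has_derivative_add[OF has_derivative_const has_derivative_scaleR_left[OF has_derivative_ident]]]) simp
  have "(c has_derivative (\<lambda>h. G *v h)) (at (x + 0 *\<^sub>R axis p 1))"
    using d by simp
  from bounded_linear.has_derivative[OF bounded_linear_vec_nth has_derivative_compose[OF 1 this], of r]
  have "((\<lambda>s. c x $ r) has_derivative (\<lambda>t. (G *v (t *\<^sub>R axis p 1)) $ r)) (at (0::real))"
    by (simp add: const)
  then have "(\<lambda>t. (G *v (t *\<^sub>R axis p 1)) $ r) = (\<lambda>t. 0)"
    using has_derivative_const by (rule has_derivative_unique)
  from fun_cong[OF this, of 1] have "(G *v axis p 1) $ r = 0" by simp
  then show False
    using nz by (simp add: matrix_vector_mult_basis column_def)
qed

lemma not_nbhd_imp_gdist: "i \<notin> nbhd E n {j} \<Longrightarrow> enat n < gdist E i j"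
  using gdist_le_iff[of E i j n] by (auto simp: nbhd_iff)

lemma entry_le_spec_norm: "\<bar>A $ p $ q\<bar> \<le> spec_norm A"
proof -
  have "\<bar>A $ p $ q\<bar> = \<bar>(A *v axis q 1) $ p\<bar>"
    by (simp add: matrix_vector_mult_basis column_def)
  also have "\<dots> \<le> norm (A *v axis q 1)"
    by (rule component_le_norm_cart)
  also have "\<dots> \<le> spec_norm A * norm (axis q 1 :: real^'a)"
    unfolding spec_norm_def by (rule onorm) simp
  finally show ?thesis by (simp add: norm_axis_1)
qed

lemma tendsto_matrix_vector_mult:
  fixes A :: "'a \<Rightarrow> real^'n^'m"
  assumes "(A \<longlongrightarrow> a) F" "(u \<longlongrightarrow> v) F"
  shows "((\<lambda>t. A t *v u t) \<longlongrightarrow> a *v v) F"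
  unfolding matrix_vector_mult_def
  by (intro vec_tendstoI) (simp, intro tendsto_intros tendsto_vec_nth assms)

lemma tendsto_transpose:
  fixes A :: "'a \<Rightarrow> real^'n^'m"
  assumes "(A \<longlongrightarrow> a) F"
  shows "((\<lambda>t. transpose (A t)) \<longlongrightarrow> transpose a) F"
  unfolding transpose_def
  by (intro vec_tendstoI) (simp, intro tendsto_vec_nth assms)

lemma tendsto_vector_matrix_mult:
  fixes A :: "'a \<Rightarrow> real^'n^'m"
  assumes "(A \<longlongrightarrow> a) F" "(u \<longlongrightarrow> v) F"
  shows "((\<lambda>t. u t v* A t) \<longlongrightarrow> v v* a) F"
  unfolding transpose_matrix_vector[symmetric]
  by (intro tendsto_matrix_vector_mult tendsto_transpose assms)

lemma norm_vector_matrix_le: "norm (u v* A) \<le> norm A * norm u" for A :: "real^'n^'m"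
  using norm_transpose_mult_le[of A "norm A" u, OF norm_matrix_vector_le] by simp

subsection \<open>The exact augmented Lagrangian\<close>

text \<open>The KKT matrix without penalty: the derivative of \<open>(grad_x, c)\<close> in the
  primal-dual variable, as opposed to \<open>Kmu\<close>.\<close>

definition KKT :: "real^'p^'p \<Rightarrow> real^'p^'d \<Rightarrow> (real^'p) \<times> (real^'d) \<Rightarrow> (real^'p) \<times> (real^'d)" where
  "KKT H G h = (H *v fst h + snd h v* G, G *v fst h)"

text \<open>The gradient of the augmented Lagrangian as a linear function of \<open>u\<close>, the
  gradient of the Lagrangian. At a solution \<open>u\<close> vanishes, so the Hessian there is
  \<open>aug_grad\<close> composed with \<open>KKT\<close>.\<close>

definition aug_grad ::
    "real \<Rightarrow> real \<Rightarrow> real^'p^'p \<Rightarrow> real^'p^'d \<Rightarrow> (real^'p) \<times> (real^'d) \<Rightarrow> (real^'p) \<times> (real^'d)"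
where
  "aug_grad eta1 eta2 H G u =
     (fst u + eta2 *\<^sub>R (fst u v* H) + eta1 *\<^sub>R (snd u v* G), snd u + eta2 *\<^sub>R (G *v fst u))"

lemma inner_vmm: "u \<bullet> (v v* A) = (A *v u) \<bullet> v" for A :: "real^'n^'m"
  by (simp add: inner_commute[of u] dot_lmul_matrix inner_commute[of v])

lemma inner_aug_grad:
  "aug_grad eta1 eta2 H G u \<bullet> h
    = u \<bullet> h + eta2 * (fst u \<bullet> fst (KKT H G h)) + eta1 * (snd u \<bullet> snd (KKT H G h))"
  by (simp add: aug_grad_def KKT_def inner_prod_def inner_add_left inner_add_right dot_lmul_matrix inner_vmm distrib_left)

lemma norm_KKT_le:
  assumes H: "\<And>u. norm (H *v u) \<le> U * norm u" and G: "\<And>u. norm (G *v u) \<le> U * norm u" and U: "0 \<le> U"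
  shows "(norm (KKT H G h))\<^sup>2 \<le> 3 * U\<^sup>2 * (norm h)\<^sup>2"
proof -
  define a where "a = norm (fst h)"
  define b where "b = norm (snd h)"
  have "norm (H *v fst h + snd h v* G) \<le> U * a + U * b"
    using norm_triangle_ineq[of "H *v fst h" "snd h v* G"] H[of "fst h"]
      norm_transpose_mult_le[of G U "snd h", OF G] by (simp add: a_def b_def)
  then have "(norm (H *v fst h + snd h v* G))\<^sup>2 \<le> (U * a + U * b)\<^sup>2"
    by (rule power_mono) simp
  moreover have "(norm (G *v fst h))\<^sup>2 \<le> (U * a)\<^sup>2"
    unfolding a_def by (rule power_mono[OF G]) simp
  ultimately have "(norm (KKT H G h))\<^sup>2 \<le> (U * a + U * b)\<^sup>2 + (U * a)\<^sup>2"
    by (simp add: KKT_def norm_Pair)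
  also have "\<dots> = U\<^sup>2 * ((a + b)\<^sup>2 + a\<^sup>2)"
    by (simp add: power2_eq_square algebra_simps)
  also have "\<dots> \<le> U\<^sup>2 * (3 * (a\<^sup>2 + b\<^sup>2))"
  proof (rule mult_left_mono)
    have "0 \<le> (a - b)\<^sup>2 + b\<^sup>2" by simp
    then show "(a + b)\<^sup>2 + a\<^sup>2 \<le> 3 * (a\<^sup>2 + b\<^sup>2)"
      by (simp add: power2_eq_square algebra_simps)
  qed simp
  also have "a\<^sup>2 + b\<^sup>2 = (norm h)\<^sup>2"
    by (simp add: a_def b_def norm_prod_def)
  finally show ?thesis by (simp add: mult_ac)
qed

text \<open>The first summand comes from the KKT matrix itself with \<open>sqrt 3 \<le> 2\<close>.
  In the quadratic part \<open>eta2 \<le> eta1\<close> merges both terms into \<open>eta1\<close>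
  times a product of two KKT norms, each contributing \<open>sqrt 3 * U\<close>.\<close>

lemma aug_Hessian_bound:
  assumes H: "\<And>u. norm (H *v u) \<le> U * norm u" and G: "\<And>u. norm (G *v u) \<le> U * norm u" and U: "0 \<le> U"
    and eta: "0 \<le> eta2" "eta2 \<le> eta1"
  shows "\<bar>aug_grad eta1 eta2 H G (KKT H G u) \<bullet> v\<bar> \<le> (2 * U + 3 * eta1 * U\<^sup>2) * norm u * norm v"
proof -
  let ?K = "KKT H G"
  have K: "norm (?K h) \<le> sqrt 3 * U * norm h" for h
  proof (rule power2_le_imp_le)
    show "(norm (?K h))\<^sup>2 \<le> (sqrt 3 * U * norm h)\<^sup>2"
      using norm_KKT_le[OF H G U, of h] by (simp add: power_mult_distrib)
  qed (use U in simp)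
  have "\<bar>?K u \<bullet> v\<bar> \<le> (2 * U * norm u) * norm v"
  proof -
    have "sqrt 3 \<le> (2 :: real)" by (rule real_le_lsqrt) simp_all
    then have "sqrt 3 * U * norm u \<le> 2 * U * norm u"
      using U by (intro mult_right_mono) auto
    then have "norm (?K u) * norm v \<le> (2 * U * norm u) * norm v"
      using K[of u] by (intro mult_right_mono) auto
    then show ?thesis using Cauchy_Schwarz_ineq2[of "?K u" v] by linarith
  qed
  moreover have "\<bar>eta2 * (fst (?K u) \<bullet> fst (?K v)) + eta1 * (snd (?K u) \<bullet> snd (?K v))\<bar>
      \<le> 3 * eta1 * U\<^sup>2 * norm u * norm v"
  proof -
    define p p' q q' where "p = norm (fst (?K u))" "p' = norm (fst (?K v))" "q = norm (snd (?K u))" "q' = norm (snd (?K v))"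
    have nn: "0 \<le> p" "0 \<le> p'" "0 \<le> q" "0 \<le> q'" by (auto simp: p_p'_q_q'_def)
    have "\<bar>fst (?K u) \<bullet> fst (?K v)\<bar> \<le> p * p'" "\<bar>snd (?K u) \<bullet> snd (?K v)\<bar> \<le> q * q'"
      unfolding p_p'_q_q'_def by (rule Cauchy_Schwarz_ineq2)+
    then have "eta2 * \<bar>fst (?K u) \<bullet> fst (?K v)\<bar> \<le> eta1 * (p * p')" "eta1 * \<bar>snd (?K u) \<bullet> snd (?K v)\<bar> \<le> eta1 * (q * q')"
      using eta by (auto intro: mult_mono mult_left_mono)
    moreover have "\<bar>eta2 * (fst (?K u) \<bullet> fst (?K v)) + eta1 * (snd (?K u) \<bullet> snd (?K v))\<bar>
        \<le> eta2 * \<bar>fst (?K u) \<bullet> fst (?K v)\<bar> + eta1 * \<bar>snd (?K u) \<bullet> snd (?K v)\<bar>"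
      using eta abs_triangle_ineq[of "eta2 * (fst (?K u) \<bullet> fst (?K v))" "eta1 * (snd (?K u) \<bullet> snd (?K v))"]
      by (simp add: abs_mult)
    moreover have "p * p' + q * q' \<le> norm (?K u) * norm (?K v)"
      using norm_cauchy_schwarz[of "(p, q)" "(p', q')"]
      by (simp add: p_p'_q_q'_def inner_prod_def norm_prod_def)
    then have "eta1 * (p * p' + q * q') \<le> eta1 * (norm (?K u) * norm (?K v))"
      using eta by (intro mult_left_mono) auto
    moreover have "norm (?K u) * norm (?K v) \<le> (sqrt 3 * U * norm u) * (sqrt 3 * U * norm v)"
      using U by (intro mult_mono K) auto
    then have "eta1 * (norm (?K u) * norm (?K v)) \<le> eta1 * ((sqrt 3 * U * norm u) * (sqrt 3 * U * norm v))"
      using eta by (intro mult_left_mono) auto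
    moreover have "eta1 * ((sqrt 3 * U * norm u) * (sqrt 3 * U * norm v)) = (sqrt 3 * sqrt 3) * eta1 * U\<^sup>2 * norm u * norm v"
      by (simp add: power2_eq_square)
    moreover have "sqrt 3 * sqrt 3 = (3::real)" by simp
    ultimately show ?thesis by (simp only: distrib_left)
  qed
  moreover have "\<bar>aug_grad eta1 eta2 H G (?K u) \<bullet> v\<bar> \<le> \<bar>?K u \<bullet> v\<bar> +
      \<bar>eta2 * (fst (?K u) \<bullet> fst (?K v)) + eta1 * (snd (?K u) \<bullet> snd (?K v))\<bar>"
    unfolding inner_aug_grad by linarith
  ultimately show ?thesis by (simp add: algebra_simps)
qed

lemma aug_Hessian_diag:
  assumes "transpose H = H"
  shows "aug_grad eta1 eta2 H G (KKT H G e) \<bullet> e = fst e \<bullet> (H *v fst e) + 2 * (snd e \<bullet> (G *v fst e))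
    + eta2 * (norm (H *v fst e + snd e v* G))\<^sup>2 + eta1 * (norm (G *v fst e))\<^sup>2"
proof -
  have "(H *v fst e) \<bullet> fst e = fst e \<bullet> (H *v fst e)"
    by (rule inner_commute)
  then show ?thesis
    unfolding inner_aug_grad
    by (simp add: KKT_def inner_prod_def inner_add_left dot_lmul_matrix inner_commute[of "G *v fst e" "snd e"] power2_norm_eq_inner)
qed

context smooth_problem
begin

definition Phi :: "(real^'p) \<times> (real^'d) \<Rightarrow> (real^'p) \<times> (real^'d)" where
  "Phi z = (gx (fst z) (snd z), c (fst z))"

abbreviation "HL z \<equiv> Hess f c (fst z) (snd z)"
abbreviation "GL z \<equiv> Gjac c (fst z)"

lemma Phi_has_derivative:
  assumes "fst z \<in> S"
  shows "(Phi has_derivative KKT (HL z) (GL z)) (at z)"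
proof -
  obtain x l where z: "z = (x, l)" by fastforce
  have x: "x \<in> S" using assms z by simp
  have "((\<lambda>z. c (fst z)) has_derivative (\<lambda>h. Gjac c x *v fst h)) (at (x, l))"
    by (rule has_derivative_compose[OF has_derivative_fst[OF has_derivative_ident]]) (use Gjac_has_derivative[OF x] in simp)
  from has_derivative_Pair[OF grad_x_has_derivative[OF x] this] show ?thesis
    by (simp add: z Phi_def[abs_def] KKT_def[abs_def])
qed

lemma aug_lagr_has_derivative:
  assumes z: "fst z \<in> S"
  shows "(aug_lagr f c eta1 eta2 has_derivative (\<lambda>h. aug_grad eta1 eta2 (HL z) (GL z) (Phi z) \<bullet> h)) (at z)"
proof -
  note P = Phi_has_derivative[OF z]
  note P1 = has_derivative_fst[OF P] and P2 = has_derivative_snd[OF P]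
  have L: "((\<lambda>z. lagr f c (fst z) (snd z)) has_derivative (\<lambda>h. Phi z \<bullet> h)) (at z)"
    using lagr_has_derivative[OF z, of "snd z"] by (simp add: Phi_def)
  have eq: "aug_lagr f c eta1 eta2 = (\<lambda>z. lagr f c (fst z) (snd z)
      + eta1 / 2 * (snd (Phi z) \<bullet> snd (Phi z)) + eta2 / 2 * (fst (Phi z) \<bullet> fst (Phi z)))"
    by (simp add: fun_eq_iff aug_lagr_def Phi_def grad_l_eq power2_norm_eq_inner)
  show ?thesis
    unfolding eq
    by (rule has_derivative_eq_rhs[OF has_derivative_add[OF has_derivative_add[OF L
        has_derivative_mult_right[OF has_derivative_inner[OF P2 P2]]] has_derivative_mult_right[OF has_derivative_inner[OF P1 P1]]]])
      (simp add: fun_eq_iff inner_aug_grad inner_commute[of "snd (KKT _ _ _)" "snd (Phi z)"] inner_commute[of "fst (KKT _ _ _)" "fst (Phi z)"])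
qed

lemma aug_grad_has_derivative:
  assumes z: "fst z \<in> S" and 0: "Phi z = 0"
  shows "((\<lambda>y. aug_grad eta1 eta2 (HL y) (GL y) (Phi y)) has_derivative
     (\<lambda>h. aug_grad eta1 eta2 (HL z) (GL z) (KKT (HL z) (GL z) h))) (at z)"
proof -
  note P = Phi_has_derivative[OF z]
  note P1 = has_derivative_fst[OF P] and P2 = has_derivative_snd[OF P]
  have P0: "fst (Phi z) = 0" "snd (Phi z) = 0" using 0 by simp_all
  have H: "((\<lambda>y. HL y) \<longlongrightarrow> HL z) (at z)"
    by (rule Hess_tendsto[OF z]) (intro tendsto_intros)+
  have G: "((\<lambda>y. GL y) \<longlongrightarrow> GL z) (at z)"
    by (rule Gjac_tendsto[OF z]) (intro tendsto_intros)
  have 1: "((\<lambda>y. fst (Phi y) v* HL y) has_derivative (\<lambda>h. fst (KKT (HL z) (GL z) h) v* HL z)) (at z)"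
    using has_derivative_matrix_mult_zero[OF tendsto_transpose[OF H] P1 P0(1)] by simp
  have 2: "((\<lambda>y. snd (Phi y) v* GL y) has_derivative (\<lambda>h. snd (KKT (HL z) (GL z) h) v* GL z)) (at z)"
    using has_derivative_matrix_mult_zero[OF tendsto_transpose[OF G] P2 P0(2)] by simp
  have 3: "((\<lambda>y. GL y *v fst (Phi y)) has_derivative (\<lambda>h. GL z *v fst (KKT (HL z) (GL z) h))) (at z)"
    by (rule has_derivative_matrix_mult_zero[OF G P1 P0(1)])
  show ?thesis
    unfolding aug_grad_def
    by (intro has_derivative_Pair has_derivative_add has_derivative_scaleR_right P1 P2 1 2 3)
qed

end

text \<open>Half of \<open>eps\<close> goes to the linearisation of \<open>Phi\<close> at
  \<open>zs\<close>; the other half, in three shares of \<open>eps / 6\<close>, to replacing the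
  limit matrices by those of the iterate in the Hessian block and the two Jacobian blocks.\<close>

lemma inexact_residual:
  fixes Phi :: "(real^'p) \<times> (real^'d) \<Rightarrow> (real^'p) \<times> (real^'d)"
  assumes P: "(Phi has_derivative KKT H G) (at zs)" "Phi zs = 0" and z: "z \<longlonglongrightarrow> zs"
    and Hh: "Hh \<longlonglongrightarrow> H" and Gt: "Gt \<longlonglongrightarrow> G" and eps: "0 < eps"
  shows "\<forall>\<^sub>F t in sequentially. norm (Phi (z t) - KKT (Hh t) (Gt t) (z t - zs)) \<le> eps * norm (z t - zs)"
proof -
  obtain d where d: "0 < d" "\<And>y. norm (y - zs) < d \<Longrightarrow> norm (Phi y - Phi zs - KKT H G (y - zs)) \<le> eps / 2 * norm (y - zs)"
    using P(1) eps unfolding has_derivative_at_alt by (meson half_gt_zero)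
  have "\<forall>\<^sub>F t in sequentially. dist (z t) zs < d" "\<forall>\<^sub>F t in sequentially. dist (Hh t) H < eps / 6"
    "\<forall>\<^sub>F t in sequentially. dist (Gt t) G < eps / 6"
    using tendstoD[OF z d(1)] tendstoD[OF Hh, of "eps / 6"] tendstoD[OF Gt, of "eps / 6"] eps by simp_all
  then show ?thesis
  proof eventually_elim
    case (elim t)
    let ?e = "z t - zs" and ?n = "norm (z t - zs)"
    have n: "norm (fst ?e) \<le> ?n" "norm (snd ?e) \<le> ?n"
      by (metis norm_fst_le prod.collapse) (metis norm_snd_le prod.collapse)
    have 1: "norm (Phi (z t) - KKT H G ?e) \<le> eps / 2 * ?n"
      using d(2)[of "z t"] elim(1) P(2) by (simp add: dist_norm)
    have "KKT H G ?e - KKT (Hh t) (Gt t) ?e = ((H - Hh t) *v fst ?e + snd ?e v* (G - Gt t), 0) + (0, (G - Gt t) *v fst ?e)"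
      by (simp add: KKT_def matrix_vector_mult_diff_rdistrib transpose_matrix_vector[symmetric] transpose_def vec_eq_iff
          matrix_vector_mult_def vector_matrix_mult_def left_diff_distrib right_diff_distrib sum_subtractf)
    then have "norm (KKT H G ?e - KKT (Hh t) (Gt t) ?e)
        \<le> norm ((H - Hh t) *v fst ?e + snd ?e v* (G - Gt t)) + norm ((G - Gt t) *v fst ?e)"
      using norm_triangle_ineq[of "((H - Hh t) *v fst ?e + snd ?e v* (G - Gt t), 0::real^'d)" "(0::real^'p, (G - Gt t) *v fst ?e)"]
      by (simp only: norm_Pair_0)
    moreover have "norm ((H - Hh t) *v fst ?e + snd ?e v* (G - Gt t)) \<le> norm ((H - Hh t) *v fst ?e) + norm (snd ?e v* (G - Gt t))"
      by (rule norm_triangle_ineq)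
    moreover have "norm ((H - Hh t) *v fst ?e) \<le> eps / 6 * ?n"
      using order_trans[OF norm_matrix_vector_le mult_mono[OF _ n(1)], of "H - Hh t" "eps / 6"] elim(2) eps
      by (simp add: dist_norm norm_minus_commute)
    moreover have "norm ((G - Gt t) *v fst ?e) \<le> eps / 6 * ?n"
      using order_trans[OF norm_matrix_vector_le mult_mono[OF _ n(1)], of "G - Gt t" "eps / 6"] elim(3) eps
      by (simp add: dist_norm norm_minus_commute)
    moreover have "norm (snd ?e v* (G - Gt t)) \<le> eps / 6 * ?n"
      using order_trans[OF norm_vector_matrix_le mult_mono[OF _ n(2)], of "G - Gt t" "eps / 6"] elim(3) eps
      by (simp add: dist_norm norm_minus_commute)
    moreover have "norm (Phi (z t) - KKT (Hh t) (Gt t) ?e) \<le> norm (Phi (z t) - KKT H G ?e) + norm (KKT H G ?e - KKT (Hh t) (Gt t) ?e)"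
      using norm_triangle_ineq[of "Phi (z t) - KKT H G ?e" "KKT H G ?e - KKT (Hh t) (Gt t) ?e"] by simp
    ultimately show ?case using 1 by linarith
  qed
qed

subsection \<open>Constants\<close>

text \<open>The parameter bounds force \<open>eta2 * gG \<le> 1 / 7\<close> and
  \<open>63 \<le> eta1\<close>, so with \<open>N = eta1 * U\<^sup>2\<close> the Hessian bound is at
  most \<open>3.04 * N\<close> and \<open>del\<close> is tiny. Since
  \<open>8.5 * (del * N) \<le> g * s\<close>, the product \<open>0.501 * 3.04\<close> stays well
  below the admissible \<open>8.5 / 4\<close>.\<close>

lemma small_delta:
  fixes U gH gG beta eta1 eta2 del :: real
  assumes beta: "0 < beta" "beta < 1 / 2" and U: "1 \<le> U" and gH: "0 < gH" "gH \<le> 1" and gG: "0 < gG" "gG \<le> 1"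
    and eta: "0 < eta2" "9 / (eta2 * gG) \<le> eta1" "eta2 \<le> gH / (7 * U\<^sup>2)"
    and del: "0 \<le> del" "del \<le> (0.5 - beta) / (1.5 - beta) * (eta2 * gG / (8.5 * eta1 * U\<^sup>2))"
  shows "del \<le> 1" "eta2 \<le> eta1"
    and "(del\<^sup>2 / 2 + beta * del) * (2 * U + 3 * eta1 * U\<^sup>2) < (1 / 2 - beta) * (eta2 * gG / 4)"
proof -
  define s where "s = eta2 * gG"
  define N where "N = eta1 * U\<^sup>2"
  define g where "g = 1 / 2 - beta"
  have U2: "1 \<le> U\<^sup>2" "U \<le> U\<^sup>2"
    using U self_le_power[OF U, of 2] by (auto intro: one_le_power)
  have "gH / (7 * U\<^sup>2) \<le> 1 / 7"
    using gH U2 by (intro frac_le) auto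
  then have eta7: "eta2 \<le> 1 / 7" using eta(3) by simp
  have s: "0 < s" "s \<le> 1 / 7"
    using mult_pos_pos[OF eta(1) gG(1)] mult_left_mono[OF gG(2), of eta2] eta7 eta(1) unfolding s_def by linarith+
  have "63 \<le> 9 / s"
    using s by (simp add: field_simps)
  then have eta1: "63 \<le> eta1"
    using eta(2) by (simp add: s_def)
  then show "eta2 \<le> eta1" using eta7 by simp
  have "eta1 * 1 \<le> eta1 * U\<^sup>2"
    using eta1 U2 by (intro mult_left_mono) auto
  then have N: "63 \<le> N"
    using eta1 unfolding N_def by linarith
  have "63 * U\<^sup>2 \<le> N"
    unfolding N_def using eta1 by (intro mult_right_mono) auto
  then have B: "2 * U + 3 * eta1 * U\<^sup>2 \<le> 3.04 * N"
    using U2 by (simp add: N_def)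
  have g: "0 < g" "g < 1 / 2" using beta by (auto simp: g_def)
  have "(0.5 - beta) / (1.5 - beta) = g / (1 + g)" "8.5 * eta1 * U\<^sup>2 = 8.5 * N"
    by (simp_all add: g_def N_def)
  then have "del \<le> g / (1 + g) * (s / (8.5 * N))"
    using del(2) by (simp only: s_def)
  also have "\<dots> \<le> g * (s / (8.5 * N))"
    using g s N by (intro mult_right_mono) (auto simp: field_simps)
  finally have dN: "8.5 * (del * N) \<le> g * s"
  proof -
    assume *: "del \<le> g * (s / (8.5 * N))"
    have "8.5 * N * del \<le> 8.5 * N * (g * (s / (8.5 * N)))"
      using N by (intro mult_left_mono *) auto
    also have "\<dots> = g * s" using N by simp
    finally show ?thesis by (simp add: mult_ac)
  qed
  have "g * s \<le> 1 / 2 * (1 / 7)"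
    using g s by (intro mult_mono) auto
  moreover have "63 * del \<le> del * N"
    using N del(1) mult_left_mono[of 63 N del] by simp
  ultimately have d: "del \<le> 1 / 1000" using dN by simp
  then show "del \<le> 1" by simp
  have "(del\<^sup>2 / 2 + beta * del) * (2 * U + 3 * eta1 * U\<^sup>2) \<le> (del\<^sup>2 / 2 + beta * del) * (3.04 * N)"
    using B beta del by (intro mult_left_mono) auto
  also have "\<dots> = (del / 2 + beta) * (3.04 * (del * N))"
    by (simp add: power2_eq_square algebra_simps)
  also have "\<dots> \<le> 0.501 * (3.04 * (del * N))"
    using d beta del N by (intro mult_right_mono) auto
  also have "\<dots> < g * s / 4"
  proof -
    have "0.501 * (3.04 * u) < v / 4" if "8.5 * u \<le> v" "0 < v" for u v :: real
      using that by simp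
    from this[OF dN mult_pos_pos[OF g(1) s(1)]] show ?thesis .
  qed
  finally show "(del\<^sup>2 / 2 + beta * del) * (2 * U + 3 * eta1 * U\<^sup>2) < (1 / 2 - beta) * (eta2 * gG / 4)"
    by (simp add: g_def s_def)
qed

text \<open>With \<open>a\<close> and \<open>w\<close> as the ball bounds,
  \<open>a\<^sup>2 * w\<close> is the overlap count, and its root is at most \<open>UK * w\<close>.
  This turns the left-hand side into \<open>UK\<^sup>2 * w / (gK * rho ^ 3)\<close>; the prescribed
  constants exceed it because they carry higher powers of \<open>gK < 1\<close> in the denominator
  and further factors at least one.\<close>

lemma (in penalized_kkt) rate_constants:
  assumes a: "0 \<le> a" "a \<le> U" and w: "1 \<le> w" "w \<le> w'" and p: "1 \<le> p"
  shows "2 * (kappa * sqrt (a\<^sup>2 * w)) \<le> sqrt 2 * (UK / (gK\<^sup>2 * rho\<^sup>2)) * UK / (rho * sqrt (1 - rho\<^sup>2)) * w * sqrt p"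
    and "2 * (kappa * sqrt (a\<^sup>2 * w)) \<le> (UK / (gK\<^sup>2 * rho\<^sup>2) * w')\<^sup>2"
proof -
  note r = rho(1,2)
  have UKU: "U \<le> UK" using UK_ge(1) mu_ge_4 U by (smt (verit) mult_nonneg_nonneg zero_le_power2)
  have "w * 1 \<le> w * w" using w by (intro mult_left_mono) auto
  then have "sqrt w \<le> w" using w by (intro real_le_lsqrt) (auto simp: power2_eq_square)
  then have "a * sqrt w \<le> UK * w"
    using a UKU w by (intro mult_mono) auto
  then have "2 * (kappa * sqrt (a\<^sup>2 * w)) \<le> 2 * (kappa * (UK * w))"
    using kappa_pos a by (simp add: real_sqrt_mult)
  also have "\<dots> = UK\<^sup>2 * w / (gK * rho ^ 3)"
    using gK r by (simp add: kappa_def power2_eq_square)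
  finally have X: "2 * (kappa * sqrt (a\<^sup>2 * w)) \<le> UK\<^sup>2 * w / (gK * rho ^ 3)" .
  have gK2: "gK\<^sup>2 \<le> gK" "gK ^ 4 \<le> gK"
    using gK power_decreasing[of 1 2 gK] power_decreasing[of 1 4 gK] by auto
  have r43: "rho ^ 4 \<le> rho ^ 3"
    using r by (intro power_decreasing) auto
  have rho2: "0 < 1 - rho\<^sup>2"
    using r by (simp add: power_less_one_iff)
  have "UK\<^sup>2 * w / (gK * rho ^ 3) \<le> UK\<^sup>2 * w / (gK\<^sup>2 * rho ^ 3)"
    using gK gK2 r w by (intro divide_left_mono mult_right_mono) auto
  also have "\<dots> = UK\<^sup>2 * w / (gK\<^sup>2 * rho ^ 3) * (1 * 1 * 1)" by simp
  also have "\<dots> \<le> UK\<^sup>2 * w / (gK\<^sup>2 * rho ^ 3) * (sqrt 2 * (1 / sqrt (1 - rho\<^sup>2)) * sqrt p)"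
  proof (intro mult_left_mono mult_mono)
    show "1 \<le> 1 / sqrt (1 - rho\<^sup>2)"
      using rho2 by simp
  qed (use p gK r w rho2 in auto)
  also have "\<dots> = sqrt 2 * (UK / (gK\<^sup>2 * rho\<^sup>2)) * UK / (rho * sqrt (1 - rho\<^sup>2)) * w * sqrt p"
    by (simp add: power2_eq_square power3_eq_cube mult_ac)
  finally show "2 * (kappa * sqrt (a\<^sup>2 * w)) \<le> sqrt 2 * (UK / (gK\<^sup>2 * rho\<^sup>2)) * UK / (rho * sqrt (1 - rho\<^sup>2)) * w * sqrt p"
    using X by simp
  have "w \<le> w' ^ 2"
    using w mult_mono[of 1 w' w w'] by (simp add: power2_eq_square)
  then have "UK\<^sup>2 * w / (gK * rho ^ 3) \<le> UK\<^sup>2 * w'\<^sup>2 / (gK ^ 4 * rho ^ 4)"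
    using gK gK2 r r43 w by (intro frac_le mult_left_mono mult_mono) auto
  also have "\<dots> = (UK / (gK\<^sup>2 * rho\<^sup>2) * w')\<^sup>2"
    by (simp add: power_divide power_mult_distrib power_mult[symmetric])
  finally show "2 * (kappa * sqrt (a\<^sup>2 * w)) \<le> (UK / (gK\<^sup>2 * rho\<^sup>2) * w')\<^sup>2"
    using X by simp
qed

subsection \<open>Counting overlaps\<close>

lemma card_extended_block:
  fixes E :: "('v::finite \<times> 'v) set"
  assumes N: "\<And>i. real (card (nbhd E 1 {i})) \<le> a" and D: "\<And>i. i \<in> W \<Longrightarrow> W \<subseteq> nbhd E D {i}"
    and w: "\<And>i. real (card (nbhd E D {i})) \<le> w"
  shows "real (card (nbhd E 2 W)) \<le> a\<^sup>2 * w"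
proof (cases "W = {}")
  case True
  have "0 \<le> w"
    using w[of undefined] by (rule order_trans[rotated]) simp
  moreover have "nbhd E 2 W = {}"
    using True by (auto simp: nbhd_iff)
  ultimately show ?thesis by simp
next
  case False
  then obtain i where "i \<in> W" by blast
  then have "real (card W) \<le> w"
    using card_mono[OF finite D[of i]] w[of i] by simp
  then have "real (card W) * a\<^sup>2 \<le> w * a\<^sup>2"
    by (rule mult_right_mono) simp
  then show ?thesis
    using card_nbhd_le[OF card_nbhd_2_le[OF N], of W] by (simp add: mult.commute)
qed

text \<open>A node chosen from each nonempty partition set identifies its index by disjointness. If
  the extended set contains \<open>i\<close>, that node lies within distance \<open>D + 2\<close> of
  \<open>i\<close>, so indices are counted by nodes of a ball.\<close>

lemma overlap_multiplicity:
  fixes E :: "('v::finite \<times> 'v) set"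
  assumes E: "sym E" and N: "\<And>i. real (card (nbhd E 1 {i})) \<le> a"
    and disj: "disjoint_family_on V L" and VW: "\<And>k. k \<in> L \<Longrightarrow> V k \<subseteq> W k"
    and D: "\<And>k i. k \<in> L \<Longrightarrow> i \<in> W k \<Longrightarrow> W k \<subseteq> nbhd E D {i}"
    and w: "\<And>i. real (card (nbhd E D {i})) \<le> w"
  shows "real (card {k \<in> L. V k \<noteq> {} \<and> i \<in> nbhd E 2 (W k)}) \<le> a\<^sup>2 * w"
proof -
  define T where "T = {k \<in> L. V k \<noteq> {} \<and> i \<in> nbhd E 2 (W k)}"
  define v where "v k = (SOME j. j \<in> V k)" for k
  have v: "v k \<in> V k" if "k \<in> T" for k
    using that unfolding T_def v_def by (auto intro: someI)
  have "inj_on v T"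
  proof (rule inj_onI)
    fix k k' assume "k \<in> T" "k' \<in> T" "v k = v k'"
    then have "v k \<in> V k \<inter> V k'" "k \<in> L" "k' \<in> L"
      using v[of k] v[of k'] by (auto simp: T_def)
    then show "k = k'"
      using disj unfolding disjoint_family_on_def by blast
  qed
  moreover have "v ` T \<subseteq> nbhd E D (nbhd E 2 {i})"
  proof safe
    fix k assume k: "k \<in> T"
    then obtain j m where j: "j \<in> W k" "m \<le> 2" "(i, j) \<in> E ^^ m"
      unfolding T_def nbhd_iff by blast
    have "(j, i) \<in> E ^^ m"
      using relpow_sym[OF E j(3)] .
    then have ji: "j \<in> nbhd E 2 {i}"
      unfolding nbhd_iff using j(2) by blast
    have "v k \<in> nbhd E D {j}"
      using v[OF k] VW[of k] D[of k j] j(1) k by (auto simp: T_def)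
    then show "v k \<in> nbhd E D (nbhd E 2 {i})"
      using nbhd_mono[of D D "{j}" "nbhd E 2 {i}" E] ji by blast
  qed
  ultimately have "card T \<le> card (nbhd E D (nbhd E 2 {i}))"
    by (metis card_image card_mono finite)
  then have "real (card T) \<le> real (card (nbhd E 2 {i})) * w"
    using card_nbhd_le[OF w, of "nbhd E 2 {i}"] by linarith
  also have "\<dots> \<le> a\<^sup>2 * w"
  proof (rule mult_right_mono[OF card_nbhd_2_le[OF N]])
    show "0 \<le> w"
      using w[of undefined] by (rule order_trans[rotated]) simp
  qed
  finally show ?thesis unfolding T_def .
qed

theorem theorem5p4:
  fixes E :: "('v::{finite,linorder} \<times> 'v) set"
    and np :: "'p::finite \<Rightarrow> 'v" and nd :: "'d::finite \<Rightarrow> 'v"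
    and f :: "'v \<Rightarrow> real^'p \<Rightarrow> real" and c :: "real^'p \<Rightarrow> real^'d"
    and M b :: nat and V W :: "nat \<Rightarrow> 'v set"
    and mu eta1 eta2 beta nu gH gG Ups UpsL :: real
    and pW pG :: "real poly"
    and Hh :: "nat \<Rightarrow> real^'p^'p"
    and x dx :: "nat \<Rightarrow> real^'p" and l dl :: "nat \<Rightarrow> real^'d" and alpha :: "nat \<Rightarrow> real"
    and xs :: "real^'p" and ls :: "real^'d"
    and X :: "(real^'p) set" and Lam :: "(real^'d) set"
  assumes graph: "sym E"
    and structured: "graph_structured E np nd f c"
    and Hh_sym: "\<And>t. transpose (Hh t) = Hh t"
    and Hh_structure: "\<And>t i j. gdist E i j > 2 \<Longrightarrow> msub np np {i} {j} (Hh t) = 0"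
    and partition: "disjoint_family_on V {1..M}" "(\<Union>k\<in>{1..M}. V k) = UNIV"
    and overlap: "b \<ge> 1" "\<And>k. k \<in> {1..M} \<Longrightarrow> nbhd E b (V k) \<subseteq> W k"
    and parameters: "mu > 0" "eta1 > 0" "eta2 > 0" "0 < beta" "beta < 0.5" "0 < nu" "nu < 1"
    and iterates: "fogd_iterates E np nd f c M V W mu eta1 eta2 beta nu Hh x l dx dl alpha"
    and solution: "strict_local_solution f c xs ls"
    and convergence: "x \<longlonglongrightarrow> xs" "l \<longlonglongrightarrow> ls"
    and A1: "0 < gH" "gH \<le> 1"
      "\<And>t w. Gjac c (x t) *v w = 0 \<Longrightarrow> w \<bullet> (Hh t *v w) \<ge> gH * (norm w)\<^sup>2"
    and A2: "0 < gG" "gG \<le> 1"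
      "\<And>t v. v \<bullet> ((Gjac c (x t) ** transpose (Gjac c (x t))) *v v) \<ge> gG * (norm v)\<^sup>2"
    and A3: "Ups \<ge> 1"
      "\<And>t i j. Max {spec_norm (msub np np {i} {j} (Hh t)),
                    spec_norm (msub np np {i} {j} (Hess f c (x t) (l t))),
                    spec_norm (msub nd np {i} {j} (Gjac c (x t)))} \<le> Ups"
    and A4_mono: "mono_on {0..} (poly pW)" "mono_on {0..} (poly pG)"
    and A4: "\<And>k i j. k \<in> {1..M} \<Longrightarrow> i \<in> W k \<Longrightarrow> j \<in> W k \<Longrightarrow>
               ereal_of_enat (gdist E i j) \<le> ereal (poly pW (real b))"
      "\<And>i (d::nat). real (card {j. gdist E i j \<le> enat d}) \<le> poly pG (real d)"
    and A5: "compact (X \<times> Lam)"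
      "\<And>t a. a \<in> {0..1} \<Longrightarrow> (x t + a *\<^sub>R dx t, l t + a *\<^sub>R dl t) \<in> X \<times> Lam"
      "\<exists>U. open U \<and> X \<subseteq> U \<and> (\<forall>i. Ck_on 3 (f i) U) \<and> (\<forall>q. Ck_on 3 (\<lambda>y. c y $ q) U)"
      "\<And>i j y z. y \<in> X \<Longrightarrow> z \<in> Lam \<Longrightarrow> spec_norm (msub np np {i} {j} (Hess f c y z)) \<le> Ups"
      "\<And>i j y. y \<in> X \<Longrightarrow> spec_norm (msub nd np {i} {j} (Gjac c y)) \<le> Ups"
    and A6: "(\<lambda>t. spec_norm (Hh t - Hess f c (x t) (l t))) \<longlonglongrightarrow> 0"
    and A7: "UpsL \<ge> 1"
      "\<exists>e>0. \<forall>y z y' z'. dist (y, z) (xs, ls) < e \<longrightarrow> dist (y', z') (xs, ls) < e \<longrightarrow>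
         (\<forall>i j.
            spec_norm (msub np np {i} {j} (Hess f c y z) - msub np np {i} {j} (Hess f c y' z'))
              \<le> UpsL * (MAX k\<in>nbhd E 2 {i}. node_norm np nd k ((y, z) - (y', z'))) \<and>
            spec_norm (msub nd np {i} {j} (Gjac c y) - msub nd np {i} {j} (Gjac c y'))
              \<le> UpsL * (MAX k\<in>nbhd E 1 {i}. node_norm np nd k ((y, z) - (y', z'))))"
    and mu_ge: "mu \<ge> mu_hat gH gG Ups pG"
    and eta1_ge: "eta1 \<ge> 9 / (eta2 * gG)"
    and eta2_le: "eta2 \<le> gH / (7 * (Ups_hat Ups pG)\<^sup>2)"
    and delta_le: "delta_mu_b mu b gH gG Ups pG pW
        \<le> (0.5 - beta) / (1.5 - beta) * (eta2 * gG / (8.5 * eta1 * (Ups_hat Ups pG)\<^sup>2))"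
  shows "\<forall>\<^sub>F t in sequentially.
           Psi np nd (x (Suc t), l (Suc t)) (xs, ls)
             \<le> 2 * (Ups_mu mu gH gG Ups pG * poly_GW pG pW (real (b + 4)))\<^sup>2
                 * rho_mu mu gH gG Ups pG ^ b * Psi np nd (x t, l t) (xs, ls)"
proof -

  \<comment> \<open>Smoothness at the iterates and at their limit\<close>
  define U where "U = Ups_hat Ups pG"
  define zs where "zs = (xs, ls)"
  define z where "z t = (x t, l t)" for t
  define d where "d t = (dx t, dl t)" for t
  define e where "e t = z t - zs" for t
  have z_lim: "z \<longlonglongrightarrow> zs"
    unfolding z_def[abs_def] zs_def by (intro tendsto_Pair convergence)
  obtain S where S: "open S" "X \<subseteq> S" "\<And>i. Ck_on 3 (f i) S" "\<And>q. Ck_on 3 (\<lambda>y. c y $ q) S"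
    using A5(3) by blast
  have xX: "x t \<in> X" "l t \<in> Lam" for t
    using A5(2)[of 0 t] by auto
  \<comment> \<open>Step length zero in \<open>A5\<close> places the iterates in
    \<open>X \<times> Lam\<close>, and closedness places the limit there, hence in the open set on
    which derivatives are available.\<close>
  have "zs \<in> X \<times> Lam"
    by (rule closed_sequentially[OF compact_imp_closed[OF A5(1)] _ z_lim]) (simp add: z_def xX)
  then have xsS: "xs \<in> S" and xS: "\<And>t. x t \<in> S"
    using S(2) xX by (auto simp: zs_def)
  obtain D1 D2 where "\<And>i. C2_rep (f i) (D1 i) (D2 i) S"
    using Ck_on_3_imp_C2_rep[OF S(3)] by metis
  then have F: "C2_rep (total_obj f) (\<lambda>p x. \<Sum>i\<in>UNIV. D1 i p x) (\<lambda>p q x. \<Sum>i\<in>UNIV. D2 i p q x) S"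
    unfolding total_obj_def[abs_def] by (rule C2_rep_sum)
  obtain Dc D2c where Dc: "\<And>r. C2_rep (\<lambda>y. c y $ r) (Dc r) (D2c r) S"
    using Ck_on_3_imp_C2_rep[OF S(4)] by metis
  interpret Q: smooth_problem f c S "\<lambda>p x. \<Sum>i\<in>UNIV. D1 i p x" "\<lambda>p q x. \<Sum>i\<in>UNIV. D2 i p q x" Dc D2c
    by unfold_locales (rule S(1) F Dc)+
  define G where "G t = Gjac c (x t)" for t

  \<comment> \<open>Uniform bounds and sparsity\<close>
  have ball: "real (card (nbhd E n {i})) \<le> poly pG (real n)" for n i
    unfolding nbhd_singleton[OF graph] by (rule A4(2))
  have ball1: "real (card (nbhd E 1 {i})) \<le> poly pG 1" for i
    using ball[of 1 i] by simp
  have ball2: "real (card (nbhd E 2 {i})) \<le> (poly pG 1)\<^sup>2" for i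
    by (rule card_nbhd_2_le[OF ball1])
  have pG_ge: "1 \<le> poly pG (real n)" for n
  proof -
    have "nbhd E n {undefined} \<noteq> {}"
      using nbhd_superset[of "{undefined}" E n] by blast
    then have "1 \<le> card (nbhd E n {undefined})"
      by (simp add: Suc_le_eq card_gt_0_iff)
    then show ?thesis using ball[of n undefined] by linarith
  qed
  have pG1: "1 \<le> poly pG 1" using pG_ge[of 1] by simp
  have pG1': "1 \<le> (poly pG 1)\<^sup>2" using pG1 by (rule one_le_power)
  have U_eq: "U = Ups * (poly pG 1)\<^sup>2" by (simp add: U_def Ups_hat_def)
  have "1 * (poly pG 1)\<^sup>2 \<le> U"
    unfolding U_eq using A3(1) by (intro mult_right_mono) auto
  moreover have "poly pG 1 \<le> (poly pG 1)\<^sup>2"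
    using self_le_power[OF pG1, of 2] by simp
  ultimately have U1: "1 \<le> U" and pG1U: "poly pG 1 \<le> U" using pG1' by auto

  have blocks: "spec_norm (msub np np {i} {j} (Hh t)) \<le> Ups" "spec_norm (msub nd np {i} {j} (G t)) \<le> Ups" for i j t
    using A3(2)[of i j t] by (auto simp: G_def)
  have G_band: "nd r \<in> nbhd E 1 {np p}" if "G t $ r $ p \<noteq> 0" for t r p
    using Gjac_band[OF graph structured Q.Gjac_has_derivative[OF xS]] that unfolding G_def by blast
  have H_zero: "msub np np {i} {j} (Hh t) = 0" if "i \<notin> nbhd E 2 {j}" for i j t
    using Hh_structure not_nbhd_imp_gdist[OF that] by (simp add: numeral_eq_enat)
  have H_band: "np p \<in> nbhd E 2 {np q}" if nz: "Hh t $ p $ q \<noteq> 0" for t p q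
  proof (rule ccontr)
    assume "\<not> ?thesis"
    then have "msub np np {np p} {np q} (Hh t) $ p $ q = 0"
      by (simp add: H_zero)
    then show False using nz by (simp add: msub_def)
  qed
  have H_norm: "norm (Hh t *v v) \<le> U * norm v" for t v
    unfolding U_eq
  proof (rule norm_block_banded_le[OF blocks(1) H_zero])
    fix i
    have "{j. i \<in> nbhd E 2 {j}} = nbhd E 2 {i}"
      using nbhd_singleton_sym[OF graph, of i 2] by auto
    then show "real (card {j. i \<in> nbhd E 2 {j}}) \<le> (poly pG 1)\<^sup>2" by (simp only: ball2)
  qed (assumption, rule ball2)
  have G_norm: "norm (G t *v v) \<le> U * norm v" for t v
    unfolding U_eq
  proof (rule norm_block_banded_le[OF blocks(2)])
    show "msub nd np {i} {j} (G t) = 0" if "i \<notin> nbhd E 1 {j}" for i j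
      using G_band that by (auto simp: msub_def vec_eq_iff)
    have le: "real (card (nbhd E 1 {i})) \<le> (poly pG 1)\<^sup>2" for i
      using ball1[of i] \<open>poly pG 1 \<le> (poly pG 1)\<^sup>2\<close> by linarith
    show "real (card {j. i \<in> nbhd E 1 {j}}) \<le> (poly pG 1)\<^sup>2" for i
    proof -
      have "{j. i \<in> nbhd E 1 {j}} = nbhd E 1 {i}"
        using nbhd_singleton_sym[OF graph, of i 1] by auto
      then show ?thesis by (simp only: le)
    qed
    show "real (card (nbhd E 1 {j})) \<le> (poly pG 1)\<^sup>2" for j by (rule le)
  qed
  have mu: "4 * U\<^sup>2 / (gG * gH) \<le> mu"
    using mu_ge by (simp add: mu_hat_def U_def)
  have pk: "penalized_kkt E np nd (Hh t) (G t) U mu gH gG" for t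
    by unfold_locales (use graph Hh_sym H_band G_band H_norm G_norm U1 A1 A2 mu in \<open>auto simp: G_def\<close>)
  \<comment> \<open>\<open>UK\<close>, \<open>g0\<close>, \<open>gK\<close>, \<open>rho\<close> and
    \<open>kappa\<close> depend on \<open>U\<close>, \<open>mu\<close>, \<open>gH\<close>,
    \<open>gG\<close> only, so the instance at iterate zero names the constants of all
    iterates.\<close>
  interpret P: penalized_kkt E np nd "Hh 0" "G 0" U mu gH gG
    by (rule pk)
  have UK: "Ups_K mu Ups pG = P.UK"
    unfolding Ups_K_def P.UK_def by (simp only: U_def)
  have gK: "gam_K mu gH gG Ups pG = P.gK"
    by (simp add: gam_K_def P.gK_def UK)
  have rho: "rho_mu mu gH gG Ups pG = P.rho"
    by (simp add: rho_mu_def P.rho_def UK gK)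

  \<comment> \<open>Size and multiplicity of the extended sets\<close>
  define w where "w = poly_GW pG pW (real b)"
  define w' where "w' = poly_GW pG pW (real (b + 4))"
  define m where "m = (poly pG 1)\<^sup>2 * w"
  define D where "D = nat \<lfloor>poly pW (real b)\<rfloor>"
  have VW: "V k \<subseteq> W k" if "k \<in> {1..M}" for k
    using overlap(2)[OF that] nbhd_superset[of "V k" E b] by blast
  \<comment> \<open>The distance of a node to itself, within a block containing it, shows
    nonnegativity; this puts the argument of \<open>pG\<close> into the range \<open>{0..}\<close>
    where monotonicity is assumed.\<close>
  have pW0: "0 \<le> poly pW (real b)"
  proof -
    obtain k where k: "k \<in> {1..M}" "undefined \<in> V k"
      using partition(2) by blast
    have "ereal_of_enat (gdist E undefined undefined) \<le> ereal (poly pW (real b))"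
      using A4(1)[OF k(1)] VW[OF k(1)] k(2) by blast
    then show ?thesis
      using order_trans[OF ereal_of_enat_nonneg] by fastforce
  qed
  have W_ball: "W k \<subseteq> nbhd E D {i}" if k: "k \<in> {1..M}" and i: "i \<in> W k" for k i
  proof
    fix j assume "j \<in> W k"
    from A4(1)[OF k i this] have le: "ereal_of_enat (gdist E i j) \<le> ereal (poly pW (real b))" .
    then obtain n where n: "gdist E i j = enat n"
      by (cases "gdist E i j") auto
    with le have "real n \<le> poly pW (real b)" by simp
    then have "n \<le> D" unfolding D_def by (simp add: le_nat_floor)
    then show "j \<in> nbhd E D {i}"
      unfolding nbhd_singleton[OF graph] using n by simp
  qed
  have D_card: "real (card (nbhd E D {i})) \<le> w" for i
  proof -
    have "real D \<le> poly pW (real b)"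
      unfolding D_def using pW0 by (simp add: of_nat_floor)
    then have "poly pG (real D) \<le> w"
      unfolding w_def poly_GW_def using pW0 by (intro mono_onD[OF A4_mono(2)]) auto
    then show ?thesis using ball[of D i] by linarith
  qed
  have "poly pG (real 0) \<le> w"
    unfolding w_def poly_GW_def using pW0 by (intro mono_onD[OF A4_mono(2)]) auto
  then have w1: "1 \<le> w" using pG_ge[of 0] by linarith
  have "poly pW (real b) \<le> poly pW (real (b + 4))"
    by (intro mono_onD[OF A4_mono(1)]) auto
  then have ww': "w \<le> w'"
    unfolding w_def w'_def poly_GW_def using pW0 by (intro mono_onD[OF A4_mono(2)]) auto
  have card_W: "real (card (nbhd E 2 (W k))) \<le> m" if "k \<in> {1..M}" "V k \<noteq> {}" for k
    unfolding m_def by (rule card_extended_block[OF ball1 W_ball[OF that(1)] D_card])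
  have mult: "real (card {k \<in> {1..M}. V k \<noteq> {} \<and> i \<in> nbhd E 2 (W k)}) \<le> m" for i
    unfolding m_def by (rule overlap_multiplicity[OF graph ball1 partition(1) VW W_ball D_card])

  \<comment> \<open>The geometric factor against the prescribed constants\<close>
  define k1 where "k1 = P.kappa * sqrt m * P.rho ^ b"
  define del where "del = delta_mu_b mu b gH gG Ups pG pW"
  have "0 \<le> poly pG 1" using pG1 by simp
  note rc = P.rate_constants[OF this pG1U w1 ww' pG_ge[of "b + 2"], folded m_def]
  \<comment> \<open>The factor two reserves a share \<open>k1\<close> for the residual, here in the
    Euclidean norm and in \<open>krate\<close> nodewise.\<close>
  have kdel: "2 * k1 \<le> del"
  proof -
    have "Ups_mu_b mu b gH gG Ups pG pW
        = sqrt 2 * (P.UK / (P.gK\<^sup>2 * P.rho\<^sup>2)) * P.UK / (P.rho * sqrt (1 - P.rho\<^sup>2)) * w * sqrt (poly pG (real (b + 2)))"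
      by (simp only: Ups_mu_b_def Ups_mu_def UK gK rho w_def)
    with rc(1) have "2 * (P.kappa * sqrt m) * P.rho ^ b \<le> Ups_mu_b mu b gH gG Ups pG pW * P.rho ^ b"
      using P.rho(1) by (intro mult_right_mono) auto
    then show ?thesis by (simp add: k1_def del_def delta_mu_b_def rho)
  qed
  define rate where "rate = (Ups_mu mu gH gG Ups pG * w')\<^sup>2 * P.rho ^ b"
  have krate: "2 * k1 \<le> rate"
  proof -
    have "(Ups_mu mu gH gG Ups pG * w')\<^sup>2 = (P.UK / (P.gK\<^sup>2 * P.rho\<^sup>2) * w')\<^sup>2"
      by (simp only: Ups_mu_def UK gK rho)
    with rc(2) have "2 * (P.kappa * sqrt m) * P.rho ^ b \<le> (Ups_mu mu gH gG Ups pG * w')\<^sup>2 * P.rho ^ b"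
      using P.rho(1) by (intro mult_right_mono) auto
    then show ?thesis by (simp add: k1_def rate_def)
  qed
  have "0 < m" unfolding m_def using pG1 w1 by simp
  then have k1: "0 < k1"
    unfolding k1_def using P.kappa_pos P.rho(1) by simp

  \<comment> \<open>Error of the direction at every iterate\<close>
  define res where "res t = norm (Q.Phi (z t) - KKT (Hh t) (G t) (e t))" for t
  define C where "C = (1 + mu * U) / P.g0"
  have C0: "0 < C"
    unfolding C_def using P.mu_ge_4 U1 P.g0 by (intro divide_pos_pos add_pos_nonneg) auto
  have dir: "norm (d t + e t) \<le> k1 * norm (e t) + sqrt (real M) * C * res t"
      "\<And>Ps i. (\<And>i. node_norm np nd i (e t) \<le> Ps) \<Longrightarrow> node_norm np nd i (d t + e t) \<le> k1 * Ps + C * res t" for t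
  proof -
    interpret Pt: penalized_kkt E np nd "Hh t" "G t" U mu gH gG
      by (rule pk)
    have "fogd_direction E np nd f c M V W mu (Hh t) (x t) (l t) (dx t) (dl t)"
      using iterates by (simp add: fogd_iterates_def)
    then obtain wt zt where wz:
      "\<forall>k\<in>{1..M}. sub_pd_solution E np nd mu (W k) (Hh t) (grad_x f c (x t) (l t)) (c (x t)) (G t) (wt k) (zt k)"
      "\<forall>k\<in>{1..M}. \<forall>p. np p \<in> V k \<longrightarrow> dx t $ p = wt k $ p"
      "\<forall>k\<in>{1..M}. \<forall>q. nd q \<in> V k \<longrightarrow> dl t $ q = zt k $ q"
      unfolding fogd_direction_def G_def by (elim exE conjE)
    have sol: "sub_pd_solution E np nd mu (W k) (Hh t) (grad_x f c (x t) (l t)) (c (x t)) (G t) (wt k) (zt k)"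
      if "k \<in> {1..M}" for k
      using wz(1) that by (rule bspec)
    have dx: "dx t $ p = wt k $ p" if "k \<in> {1..M}" "np p \<in> V k" for k p
      using bspec[OF wz(2) that(1)] that(2) by simp
    have dl: "dl t $ q = zt k $ q" if "k \<in> {1..M}" "nd q \<in> V k" for k q
      using bspec[OF wz(3) that(1)] that(2) by simp
    have res: "res t = norm (grad_x f c (x t) (l t) - (Hh t *v fst (e t) + snd (e t) v* G t), c (x t) - G t *v fst (e t))"
      by (simp add: res_def Q.Phi_def KKT_def z_def)
    note as = partition overlap sol dx dl card_W mult
    show "norm (d t + e t) \<le> k1 * norm (e t) + sqrt (real M) * C * res t"
      using Pt.direction_error_norm[OF as, of "e t"] by (simp add: res k1_def C_def d_def)
    show "node_norm np nd i (d t + e t) \<le> k1 * Ps + C * res t"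
      if "\<And>i. node_norm np nd i (e t) \<le> Ps" for Ps i
      using Pt.direction_error_node[OF as that, of i] by (simp add: res k1_def C_def d_def)
  qed

  \<comment> \<open>Properties of the limit matrices\<close>
  define Hs where "Hs = Hess f c xs ls"
  define Gs where "Gs = Gjac c xs"
  have G_lim: "G \<longlonglongrightarrow> Gs"
    unfolding G_def[abs_def] Gs_def by (rule Q.Gjac_tendsto[OF xsS convergence(1)])
  have H_lim: "Hh \<longlonglongrightarrow> Hs"
  proof -
    have "(\<lambda>t. Hh t - Hess f c (x t) (l t)) \<longlonglongrightarrow> 0"
    proof (rule vec_tendstoI, rule vec_tendstoI)
      fix p q
      show "(\<lambda>t. (Hh t - Hess f c (x t) (l t)) $ p $ q) \<longlonglongrightarrow> 0 $ p $ q"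
        unfolding zero_index
        by (rule Lim_null_comparison[OF always_eventually A6])
          (simp add: entry_le_spec_norm del: vector_minus_component)
    qed
    from tendsto_add[OF this Q.Hess_tendsto[OF xsS convergence]] show ?thesis
      by (simp add: Hs_def)
  qed
  have Phi0: "Q.Phi zs = 0"
  proof -
    have "grad (\<lambda>z. lagr f c (fst z) (snd z)) (xs, ls) = (grad_x f c xs ls, c xs)"
      by (rule grad_eqI[OF Q.lagr_has_derivative[OF xsS]])
    then show ?thesis
      using solution by (auto simp: strict_local_solution_def Q.Phi_def zs_def zero_prod_def)
  qed
  have res_small: "\<forall>\<^sub>F t in sequentially. res t \<le> eps * norm (e t)" if "0 < eps" for eps
    unfolding res_def e_def
  proof (rule inexact_residual[where Phi = Q.Phi and zs = zs, OF _ _ z_lim H_lim G_lim that])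
    show "(Q.Phi has_derivative KKT Hs Gs) (at zs)"
      using Q.Phi_has_derivative[of zs] xsS by (simp add: zs_def Hs_def Gs_def)
  qed (rule Phi0)

  have Hs_norm: "norm (Hs *v u) \<le> U * norm u" for u
    by (rule tendsto_upperbound[OF tendsto_norm[OF tendsto_matrix_vector_mult[OF H_lim tendsto_const]]])
      (auto simp: H_norm)
  have Gs_norm: "norm (Gs *v u) \<le> U * norm u" for u
    by (rule tendsto_upperbound[OF tendsto_norm[OF tendsto_matrix_vector_mult[OF G_lim tendsto_const]]])
      (auto simp: G_norm)
  have Hs_sym: "transpose Hs = Hs"
    using LIMSEQ_unique[OF tendsto_transpose[OF H_lim]] H_lim by (simp add: Hh_sym)
  \<comment> \<open>Positivity on kernels does not pass to the limit directly, since the kernel of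
    \<open>G t\<close> varies with \<open>t\<close>. The penalised inequality holds for each fixed
    \<open>u\<close> and is closed under limits.\<close>
  have pen: "gH / 2 * (norm u)\<^sup>2 \<le> u \<bullet> (Hs *v u) + k * (norm (Gs *v u))\<^sup>2" if k: "4 * U\<^sup>2 / (gG * gH) \<le> k" for k u
  proof (rule tendsto_lowerbound)
    show "(\<lambda>t. u \<bullet> (Hh t *v u) + k * (norm (G t *v u))\<^sup>2) \<longlonglongrightarrow> u \<bullet> (Hs *v u) + k * (norm (Gs *v u))\<^sup>2"
      by (intro tendsto_intros tendsto_matrix_vector_mult H_lim G_lim)
    show "\<forall>\<^sub>F t in sequentially. gH / 2 * (norm u)\<^sup>2 \<le> u \<bullet> (Hh t *v u) + k * (norm (G t *v u))\<^sup>2"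
      by (intro always_eventually allI
          penalized_coercive[OF H_norm Hh_sym U1 A1(1,2) A1(3)[folded G_def] A2(1) A2(3)[folded G_def] k])
  qed simp
  have GsT: "gG * (norm v)\<^sup>2 \<le> (norm (v v* Gs))\<^sup>2" for v
  proof (rule tendsto_lowerbound)
    show "(\<lambda>t. (norm (v v* G t))\<^sup>2) \<longlonglongrightarrow> (norm (v v* Gs))\<^sup>2"
      by (intro tendsto_intros tendsto_vector_matrix_mult G_lim)
    have "gG * (norm v)\<^sup>2 \<le> (norm (v v* G t))\<^sup>2" for t
    proof -
      have "v \<bullet> ((G t ** transpose (G t)) *v v) = (norm (v v* G t))\<^sup>2"
        unfolding matrix_vector_mul_assoc[symmetric] transpose_matrix_vector power2_norm_eq_inner dot_lmul_matrix ..
      then show ?thesis using A2(3)[of v t] by (simp add: G_def)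
    qed
    then show "\<forall>\<^sub>F t in sequentially. gG * (norm v)\<^sup>2 \<le> (norm (v v* G t))\<^sup>2" by simp
  qed simp

  \<comment> \<open>Eventual acceptance of the unit step\<close>
  have eta2U: "eta2 \<le> gH / (7 * U\<^sup>2)"
    using eta2_le by (simp add: U_def)
  have del0: "0 < del" using kdel k1 by simp
  have beta: "0 < beta" "beta < 1 / 2" using parameters by auto
  have del_le: "del \<le> (0.5 - beta) / (1.5 - beta) * (eta2 * gG / (8.5 * eta1 * U\<^sup>2))"
    using delta_le by (simp add: del_def U_def)
  note small = small_delta[OF beta U1 A1(1,2) A2(1,2) parameters(3) eta1_ge eta2U less_imp_le[OF del0] del_le]
  define g where "g y = aug_grad eta1 eta2 (Hess f c (fst y) (snd y)) (Gjac c (fst y)) (Q.Phi y)" for y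
  define A where "A h = aug_grad eta1 eta2 Hs Gs (KKT Hs Gs h)" for h
  have fzs: "fst zs \<in> S" by (simp add: zs_def xsS)
  have gz: "(aug_lagr f c eta1 eta2 has_derivative (\<lambda>h. g y \<bullet> h)) (at y)" if "fst y \<in> S" for y
    unfolding g_def by (rule Q.aug_lagr_has_derivative[OF that])
  obtain r where r: "0 < r" "ball zs r \<subseteq> S \<times> UNIV"
    using openE[OF open_Times[OF S(1) open_UNIV], of zs] fzs by (auto simp: mem_Times_iff)
  have "\<forall>\<^sub>F t in sequentially. aug_lagr f c eta1 eta2 (z t + d t) \<le> aug_lagr f c eta1 eta2 (z t) + beta * (g (z t) \<bullet> d t)"
  proof (rule unit_step_armijo[where M = A and a = "eta2 * gG / 4" and B = "2 * U + 3 * eta1 * U\<^sup>2" and del = del])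
    show "(aug_lagr f c eta1 eta2 has_derivative (\<lambda>h. g y \<bullet> h)) (at y)" if "norm (y - zs) < r" for y
    proof (rule gz)
      have "y \<in> ball zs r" using that by (simp add: dist_norm norm_minus_commute)
      then show "fst y \<in> S" using r(2) by auto
    qed
    show "(g has_derivative A) (at zs)"
      unfolding g_def[abs_def] A_def[abs_def]
      using Q.aug_grad_has_derivative[OF fzs Phi0, of eta1 eta2] by (simp add: zs_def Hs_def Gs_def)
    show "g zs = 0"
      by (simp add: g_def Phi0 aug_grad_def zero_prod_def)
    show "eta2 * gG / 4 * (norm h)\<^sup>2 \<le> A h \<bullet> h" for h
      using augmented_coercive[OF pen Hs_norm GsT U1 A1(1,2) A2(1,2) parameters(3) eta1_ge eta2U, of "fst h" "snd h"]
      unfolding A_def aug_Hessian_diag[OF Hs_sym] by (simp add: norm_prod_def)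
    show "\<bar>A u \<bullet> v\<bar> \<le> (2 * U + 3 * eta1 * U\<^sup>2) * norm u * norm v" for u v
      unfolding A_def using U1 parameters(3) small(2) by (intro aug_Hessian_bound Hs_norm Gs_norm) auto
    \<comment> \<open>The tolerance makes the residual contribute at most
      \<open>k1 * norm (e t)\<close>; the \<open>+ 1\<close> keeps the denominator positive.\<close>
    have "\<forall>\<^sub>F t in sequentially. res t \<le> k1 / (sqrt (real M) * C + 1) * norm (e t)"
      using k1 C0 by (intro res_small divide_pos_pos add_nonneg_pos) auto
    then show "\<forall>\<^sub>F t in sequentially. norm (d t + (z t - zs)) \<le> del * norm (z t - zs)"
    proof eventually_elim
      case (elim t)
      define n where "n = sqrt (real M) * C"
      have n: "0 \<le> n" using C0 by (simp add: n_def)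
      have "n * res t \<le> n * (k1 / (n + 1) * norm (e t))"
        using elim n by (intro mult_left_mono) (auto simp: n_def)
      also have "\<dots> = (n / (n + 1)) * (k1 * norm (e t))" by simp
      also have "\<dots> \<le> 1 * (k1 * norm (e t))"
        using n k1 by (intro mult_right_mono) auto
      finally have "norm (d t + e t) \<le> (2 * k1) * norm (e t)"
        using dir(1)[of t] by (simp add: n_def)
      also have "\<dots> \<le> del * norm (e t)"
        using kdel by (rule mult_right_mono) simp
      finally show ?case by (simp add: e_def)
    qed
  qed (use r(1) z_lim del0 small beta U1 parameters in auto)
  then have step: "\<forall>\<^sub>F t in sequentially. alpha t = 1"
  proof eventually_elim
    case (elim t)
    have "grad (aug_lagr f c eta1 eta2) (z t) = g (z t)"
      by (rule grad_eqI[OF gz]) (simp add: z_def xS)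
    then have "armijo f c eta1 eta2 beta (x t, l t) (dx t, dl t) 1"
      using elim unfolding armijo_def z_def d_def by simp
    \<comment> \<open>Were \<open>n\<close> positive, exponent \<open>0\<close> would have been
      rejected, although the unit step passes.\<close>
    moreover obtain n where "alpha t = nu ^ n" "\<forall>m<n. \<not> armijo f c eta1 eta2 beta (x t, l t) (dx t, dl t) (nu ^ m)"
      using iterates unfolding fogd_iterates_def backtracking_step_def by blast
    ultimately show "alpha t = 1"
      by (metis gr0I power_0)
  qed

  \<comment> \<open>Nodewise contraction\<close>
  define N where "N = sqrt (real CARD('v))"
  have N: "0 \<le> N" by (simp add: N_def)
  \<comment> \<open>The residual is small relative to the Euclidean error, which exceeds the
    nodewise maximum at most by the factor \<open>N\<close>; the tolerance absorbs this factor, so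
    it leaves no trace in the rate.\<close>
  have "\<forall>\<^sub>F t in sequentially. res t \<le> k1 / (C * N + 1) * norm (e t)"
    using k1 C0 N by (intro res_small divide_pos_pos add_nonneg_pos) auto
  with step show ?thesis
  proof eventually_elim
    case (elim t)
    define Ps where "Ps = Psi np nd (x t, l t) (xs, ls)"
    have node: "node_norm np nd i (e t) \<le> Ps" for i
      unfolding Ps_def Psi_def e_def z_def zs_def by (rule Max_ge) auto
    have Ps: "0 \<le> Ps"
      using node[of undefined] unfolding node_norm_def by (rule order_trans[rotated]) simp
    have "norm (e t) \<le> N * Ps"
      using P.norm_pr_le_Max[OF node, of UNIV "real CARD('v)"] by (simp add: proj_def N_def)
    then have "k1 / (C * N + 1) * norm (e t) \<le> k1 / (C * N + 1) * (N * Ps)"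
      using k1 C0 N by (intro mult_left_mono) auto
    then have "C * res t \<le> C * (k1 / (C * N + 1) * (N * Ps))"
      using elim(2) C0 by (intro mult_left_mono) auto
    also have "\<dots> = (C * N / (C * N + 1)) * (k1 * Ps)" by simp
    also have "\<dots> \<le> 1 * (k1 * Ps)"
    proof (rule mult_right_mono)
      have "0 \<le> C * N" using C0 N by simp
      then show "C * N / (C * N + 1) \<le> 1" by simp
    qed (use k1 Ps in auto)
    finally have "k1 * Ps + C * res t \<le> 2 * k1 * Ps" by (simp add: mult.commute)
    moreover have "2 * k1 * Ps \<le> 2 * rate * Ps"
      using krate k1 Ps by (intro mult_right_mono) auto
    ultimately have bound: "node_norm np nd i (d t + e t) \<le> 2 * rate * Ps" for i
      using dir(2)[OF node, of i] by linarith
    have "(x (Suc t), l (Suc t)) - (xs, ls) = d t + e t"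
      using iterates elim(1) by (simp add: fogd_iterates_def d_def e_def z_def zs_def)
    then have "Psi np nd (x (Suc t), l (Suc t)) (xs, ls) \<le> 2 * rate * Ps"
      unfolding Psi_def using bound by (subst Max_le_iff) auto
    then show ?case
      by (simp add: rate_def Ps_def w'_def rho mult.assoc)
  qed
qed

end
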